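(* Let $\gamma:I\to\mathbb{R}^2$ be a $C^\infty$ curve with $0\in I$. (1) $\gamma$ is $\mathcal{A}$-equivalent at $t=0$ to $Cusp_{(4,5;+7)}(t)=(t^4,t^5+t^7)$ if and only if $\gamma'(0)=\gamma''(0)=\gamma'''(0)=\mathbf{0}$, $A\neq0$ and $-77B^2+105AD+60AC>0$. (2) $\gamma$ is $\mathcal{A}$-equivalent at $t=0$ to $Cusp_{(4,5;-7)}(t)=(t^4,t^5-t^7)$ if and only if $\gamma'(0)=\gamma''(0)=\gamma'''(0)=\mathbf{0}$, $A\neq0$ and $-77B^2+105AD+60AC<0$. (3) $Cusp_{(4,5;+7)}$ and $Cusp_{(4,5;-7)}$ are not $\mathcal{A}$-equivalent at $t=0$.
   Context: $A=\det(\gamma^{(5)}(0),\gamma^{(4)}(0))$, $B=\det(\gamma^{(6)}(0),\gamma^{(4)}(0))$, $C=\det(\gamma^{(7)}(0),\gamma^{(4)}(0))$, $D=\det(\gamma^{(6)}(0),\gamma^{(5)}(0))$. $\mathcal{A}$-equivalence: existence of $C^\infty$ diffeomorphism germs $\psi$ of $(\mathbb{R},0)$ and $\Psi$ of $\mathbb{R}^2$ with $\Psi\circ\gamma_1\circ\psi^{-1}=\gamma_2$. *)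

theory Defs
  imports "HOL-Analysis.Analysis"
begin

fun Ck_on :: "nat \<Rightarrow> 'a::euclidean_space set \<Rightarrow> ('a \<Rightarrow> 'b::real_normed_vector) \<Rightarrow> bool" where
  "Ck_on 0 U f = continuous_on U f"
| "Ck_on (Suc n) U f =
     ((\<forall>x\<in>U. f differentiable (at x)) \<and>
      (\<forall>i\<in>Basis. Ck_on n U (\<lambda>x. frechet_derivative f (at x) i)))"

definition smooth_on :: "'a::euclidean_space set \<Rightarrow> ('a \<Rightarrow> 'b::real_normed_vector) \<Rightarrow> bool" where
  "smooth_on U f \<longleftrightarrow> open U \<and> (\<forall>n. Ck_on n U f)"

definition local_diffeo_at :: "('a::euclidean_space \<Rightarrow> 'a) \<Rightarrow> ('a \<Rightarrow> 'a) \<Rightarrow> 'a \<Rightarrow> bool" where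
  "local_diffeo_at f g p \<longleftrightarrow>
     (\<exists>U V. open U \<and> open V \<and> p \<in> U \<and> f ` U = V \<and> g ` V = U \<and>
        smooth_on U f \<and> smooth_on V g \<and>
        (\<forall>x\<in>U. g (f x) = x) \<and> (\<forall>y\<in>V. f (g y) = y))"

definition A_equiv_at0 :: "(real \<Rightarrow> real \<times> real) \<Rightarrow> (real \<Rightarrow> real \<times> real) \<Rightarrow> bool" where
  "A_equiv_at0 \<gamma>1 \<gamma>2 \<longleftrightarrow>
     (\<exists>\<psi> \<psi>inv \<Psi> \<Psi>inv. \<psi> 0 = 0 \<and> local_diffeo_at \<psi> \<psi>inv 0 \<and>
        local_diffeo_at \<Psi> \<Psi>inv (\<gamma>1 0) \<and>
        (\<forall>\<^sub>F t in nhds 0. \<Psi> (\<gamma>1 (\<psi>inv t)) = \<gamma>2 t))"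

definition curve_deriv :: "nat \<Rightarrow> (real \<Rightarrow> real \<times> real) \<Rightarrow> real \<Rightarrow> real \<times> real" where
  "curve_deriv n \<gamma> = ((\<lambda>g t. vector_derivative g (at t)) ^^ n) \<gamma>"

definition det2 :: "real \<times> real \<Rightarrow> real \<times> real \<Rightarrow> real" where
  "det2 u v = fst u * snd v - snd u * fst v"

definition cusp_plus :: "real \<Rightarrow> real \<times> real" where
  "cusp_plus t = (t ^ 4, t ^ 5 + t ^ 7)"

definition cusp_minus :: "real \<Rightarrow> real \<times> real" where
  "cusp_minus t = (t ^ 4, t ^ 5 - t ^ 7)"

end

theory Submission
  imports Defs
begin

text \<open>Both directions rest on the expansion of a curve modulo \<open>t\<^sup>8\<close>. If \<open>\<gamma>\<close> is equivalent to
  \<open>(t\<^sup>4, t\<^sup>5 + k t\<^sup>7)\<close>, then \<open>\<gamma>\<close> is the composition of a reparametrisation, the model cusp and a plane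
  diffeomorphism, whose quadratic terms only contribute at order 8; so the jet of \<open>\<gamma>\<close> is explicit, and
  \<open>-77 B\<^sup>2 + 105 A D + 60 A C\<close> turns out to be a positive multiple of \<open>k\<close>. Conversely, a
  reparametrisation brings the jet into the form \<open>t\<^sup>4 u + (t\<^sup>5 \<plusminus> t\<^sup>7) v\<close> and a second one removes the last
  obstruction, at \<open>t\<^sup>1\<^sup>1\<close>. Then every component of the curve is a smooth function of the two components
  of the model cusp: modulo \<open>t\<^sup>1\<^sup>2\<close> this is a matter of polynomials, and the remainder is split as
  \<open>t\<^sup>1\<^sup>2 (g\<^sub>0(t\<^sup>4) + t g\<^sub>1(t\<^sup>4) + t\<^sup>2 g\<^sub>2(t\<^sup>4) + t\<^sup>3 g\<^sub>3(t\<^sup>4))\<close> with smooth \<open>g\<^sub>i\<close>. Borel's lemma realises the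
  Taylor coefficients, and a flat function of \<open>t\<close> is smooth in \<open>t\<^sup>4\<close>. The resulting plane map has an
  invertible derivative, hence is a diffeomorphism germ.\<close>

subsection \<open>Closure properties of smooth functions\<close>

text \<open>The exponents missing from the semigroup generated by 4 and 5 are 1, 2, 3, 6, 7, 11.
  Orders 1 to 3 are excluded by hypothesis, and reparametrisations have enough freedom to normalise
  orders 6 and 11. At order 7 one number k survives; rescaling t by l multiplies it by l^2, so
  exactly its sign is invariant, which is why there are two models. With v_j the j-th derivative of
  the curve at 0 divided by j!, write v_6 = \<alpha> v_4 + \<beta> v_5 and v_7 = \<alpha>' v_4 +
  \<beta>' v_5. Then k = \<beta>' - 5/4 \<alpha> - 11/10 \<beta>^2, and clearing factorials and
  denominators in this formula produces the weights -77, 105, 60. The delicate point of the converse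
  is that agreement of finite jets, or even of full Taylor series, does not yet give a smooth plane
  map: a formal solution has to be corrected by flat terms, and these must factor through the cusp
  as well.\<close>

lemma Ck_on_cong:
  assumes "open U" "\<And>x. x \<in> U \<Longrightarrow> f x = g x" "Ck_on n U f"
  shows "Ck_on n U g"
  using assms(2,3)
proof (induction n arbitrary: f g)
  case 0
  then show ?case
    using continuous_on_eq by fastforce
next
  case (Suc n)
  have f: "f differentiable (at x)" if "x \<in> U" for x
    using Suc.prems that by simp
  have "g differentiable (at x)" if "x \<in> U" for x
    using f[OF that] has_derivative_transform_within_open[OF _ assms(1) that Suc.prems(1)]
    unfolding differentiable_def by meson
  moreover have "Ck_on n U (\<lambda>x. frechet_derivative g (at x) i)" if "i \<in> Basis" for i
  proof (rule Suc.IH)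
    show "frechet_derivative f (at x) i = frechet_derivative g (at x) i" if "x \<in> U" for x
      using frechet_derivative_transform_within_open[OF f[OF that] assms(1) that Suc.prems(1)] by simp
    show "Ck_on n U (\<lambda>x. frechet_derivative f (at x) i)"
      using Suc.prems(2) that by simp
  qed
  ultimately show ?case by simp
qed

text \<open>\<open>frechet_derivative\<close> is a choice operator; this rule lets later proofs
  supply an explicit derivative formula instead and check regularity only for its values on the
  basis.\<close>

lemma Ck_on_SucI:
  assumes "open U" "\<And>x. x \<in> U \<Longrightarrow> (f has_derivative f' x) (at x)"
    and "\<And>i. i \<in> Basis \<Longrightarrow> Ck_on n U (\<lambda>x. f' x i)"
  shows "Ck_on (Suc n) U f"
proof -
  have "Ck_on n U (\<lambda>x. frechet_derivative f (at x) i)" if "i \<in> Basis" for i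
  proof (rule Ck_on_cong[OF assms(1) _ assms(3)[OF that]])
    show "f' x i = frechet_derivative f (at x) i" if "x \<in> U" for x
      using frechet_derivative_at[OF assms(2)[OF that]] by simp
  qed
  then show ?thesis
    using assms(2) by (auto simp: differentiable_def)
qed

lemma Ck_on_SucD:
  assumes "Ck_on (Suc n) U f"
  shows "x \<in> U \<Longrightarrow> (f has_derivative frechet_derivative f (at x)) (at x)"
    and "i \<in> Basis \<Longrightarrow> Ck_on n U (\<lambda>x. frechet_derivative f (at x) i)"
  using assms by (auto simp: frechet_derivative_works[symmetric])

text \<open>The product, chain and reciprocal rules leave undifferentiated factors behind; the
  inductions below need these factors one order lower.\<close>

lemma Ck_on_Suc_imp: "Ck_on (Suc n) U f \<Longrightarrow> Ck_on n U f"
proof (induction n arbitrary: f)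
  case 0
  then show ?case
    by (auto intro!: continuous_at_imp_continuous_on differentiable_imp_continuous_within)
next
  case (Suc n)
  have "Ck_on n U (\<lambda>x. frechet_derivative f (at x) i)" if "i \<in> Basis" for i
    using Suc.IH[OF Ck_on_SucD(2)[OF Suc.prems that]] .
  moreover have "\<forall>x\<in>U. f differentiable (at x)"
    using Suc.prems by simp
  ultimately show ?case by simp
qed

lemma Ck_on_subset: "Ck_on n U f \<Longrightarrow> V \<subseteq> U \<Longrightarrow> Ck_on n V f"
  by (induction n arbitrary: f) (auto intro: continuous_on_subset)

lemma Ck_on_local:
  assumes "\<And>x. x \<in> U \<Longrightarrow> \<exists>V. open V \<and> x \<in> V \<and> Ck_on n V f"
  shows "Ck_on n U f"
  using assms
proof (induction n arbitrary: f)
  case 0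
  have "isCont f x" if "x \<in> U" for x
    using 0[OF that] by (auto simp: continuous_on_eq_continuous_at)
  then show ?case
    by (simp add: continuous_at_imp_continuous_on)
next
  case (Suc n)
  have "Ck_on n U (\<lambda>x. frechet_derivative f (at x) i)" if "i \<in> Basis" for i
  proof (rule Suc.IH)
    show "\<exists>V. open V \<and> x \<in> V \<and> Ck_on n V (\<lambda>x. frechet_derivative f (at x) i)" if "x \<in> U" for x
      using Suc.prems[OF that] \<open>i \<in> Basis\<close> by auto
  qed
  moreover have "f differentiable (at x)" if "x \<in> U" for x
    using Suc.prems[OF that] by auto
  ultimately show ?case by simp
qed

lemma Ck_on_const: "open U \<Longrightarrow> Ck_on n U (\<lambda>x. c)"
proof (induction n arbitrary: c)
  case (Suc n)
  show ?case
    by (rule Ck_on_SucI[where f'="\<lambda>x h. 0"]) (use Suc in auto)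
qed simp

lemma Ck_on_bounded_linear:
  assumes "open U" "bounded_linear L"
  shows "Ck_on n U L"
proof (cases n)
  case 0
  then show ?thesis
    using assms(2) by (simp add: linear_continuous_on)
next
  case (Suc m)
  have "Ck_on (Suc m) U L"
    by (rule Ck_on_SucI[where f'="\<lambda>x h. L h"])
      (use assms in \<open>auto intro: Ck_on_const bounded_linear_imp_has_derivative\<close>)
  then show ?thesis using Suc by simp
qed

lemma Ck_on_bounded_linear_compose:
  assumes "open U" "bounded_linear L" "Ck_on n U f"
  shows "Ck_on n U (\<lambda>x. L (f x))"
  using assms(3)
proof (induction n arbitrary: f)
  case 0
  then show ?case
    using assms(2) by (simp add: bounded_linear.continuous_on)
next
  case (Suc n)
  show ?case
  proof (rule Ck_on_SucI[where f'="\<lambda>x h. L (frechet_derivative f (at x) h)"])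
    show "open U" by fact
    show "((\<lambda>x. L (f x)) has_derivative (\<lambda>h. L (frechet_derivative f (at x) h))) (at x)"
      if "x \<in> U" for x
      by (rule bounded_linear.has_derivative[OF assms(2) Ck_on_SucD(1)[OF Suc.prems that]])
    show "Ck_on n U (\<lambda>x. L (frechet_derivative f (at x) i))" if "i \<in> Basis" for i
      by (rule Suc.IH[OF Ck_on_SucD(2)[OF Suc.prems that]])
  qed
qed

lemma Ck_on_add:
  assumes "open U" "Ck_on n U f" "Ck_on n U g"
  shows "Ck_on n U (\<lambda>x. f x + g x)"
  using assms(2,3)
proof (induction n arbitrary: f g)
  case 0
  then show ?case by (simp add: continuous_on_add)
next
  case (Suc n)
  show ?case
  proof (rule Ck_on_SucI[where
        f'="\<lambda>x h. frechet_derivative f (at x) h + frechet_derivative g (at x) h"])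
    show "open U" by fact
    show "((\<lambda>x. f x + g x) has_derivative
        (\<lambda>h. frechet_derivative f (at x) h + frechet_derivative g (at x) h)) (at x)"
      if "x \<in> U" for x
      by (rule has_derivative_add[OF Ck_on_SucD(1)[OF Suc.prems(1) that]
            Ck_on_SucD(1)[OF Suc.prems(2) that]])
    show "Ck_on n U (\<lambda>x. frechet_derivative f (at x) i + frechet_derivative g (at x) i)"
      if "i \<in> Basis" for i
      by (rule Suc.IH[OF Ck_on_SucD(2)[OF Suc.prems(1) that] Ck_on_SucD(2)[OF Suc.prems(2) that]])
  qed
qed

lemma Ck_on_sum:
  assumes "open U" "finite J" "\<And>j. j \<in> J \<Longrightarrow> Ck_on n U (f j)"
  shows "Ck_on n U (\<lambda>x. \<Sum>j\<in>J. f j x)"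
  using assms(2,3)
proof (induction J rule: finite_induct)
  case empty
  then show ?case using Ck_on_const[OF assms(1), of n 0] by simp
next
  case (insert j J)
  have "Ck_on n U (\<lambda>x. f j x + (\<Sum>j\<in>J. f j x))"
    by (rule Ck_on_add[OF assms(1)]) (use insert in auto)
  then show ?case using insert by simp
qed

lemma Ck_on_scaleR:
  fixes f :: "'a::euclidean_space \<Rightarrow> real" and g :: "'a \<Rightarrow> 'b::real_normed_vector"
  assumes "open U" "Ck_on n U f" "Ck_on n U g"
  shows "Ck_on n U (\<lambda>x. f x *\<^sub>R g x)"
  using assms(2,3)
proof (induction n arbitrary: f g)
  case 0
  then show ?case by (simp add: continuous_on_scaleR)
next
  case (Suc n)
  note f = Suc.prems(1) and g = Suc.prems(2)
  show ?case
  proof (rule Ck_on_SucI[where f'="\<lambda>x h. f x *\<^sub>R frechet_derivative g (at x) h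
        + frechet_derivative f (at x) h *\<^sub>R g x"])
    show "open U" by fact
    show "((\<lambda>x. f x *\<^sub>R g x) has_derivative
        (\<lambda>h. f x *\<^sub>R frechet_derivative g (at x) h + frechet_derivative f (at x) h *\<^sub>R g x)) (at x)"
      if "x \<in> U" for x
      by (rule has_derivative_scaleR[OF Ck_on_SucD(1)[OF f that] Ck_on_SucD(1)[OF g that]])
    show "Ck_on n U (\<lambda>x. f x *\<^sub>R frechet_derivative g (at x) i
        + frechet_derivative f (at x) i *\<^sub>R g x)" if "i \<in> Basis" for i
      by (intro Ck_on_add[OF assms(1)] Suc.IH Ck_on_SucD(2)[OF f that]
          Ck_on_SucD(2)[OF g that] Ck_on_Suc_imp[OF f] Ck_on_Suc_imp[OF g])
  qed
qed

text \<open>Expanded over the basis, the chain rule is a sum of products of components of the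
  derivative of \<open>f\<close> with partials of \<open>g\<close> composed with \<open>f\<close>.
  The latter fall under the induction hypothesis because \<open>g\<close> is generalised while
  \<open>f\<close> stays fixed.\<close>

lemma Ck_on_compose:
  fixes f :: "'a::euclidean_space \<Rightarrow> 'b::euclidean_space" and g :: "'b \<Rightarrow> 'c::real_normed_vector"
  assumes "open U" "f ` U \<subseteq> V" "Ck_on n U f" "Ck_on n V g"
  shows "Ck_on n U (\<lambda>x. g (f x))"
  using assms(3,4)
proof (induction n arbitrary: g)
  case 0
  then show ?case
    using continuous_on_compose2[OF _ _ assms(2)] by simp
next
  case (Suc n)
  note f = Suc.prems(1) and g = Suc.prems(2)
  let ?D = "\<lambda>x h. \<Sum>j\<in>Basis.
      (frechet_derivative f (at x) h \<bullet> j) *\<^sub>R frechet_derivative g (at (f x)) j"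
  show ?case
  proof (rule Ck_on_SucI[where f'="?D"])
    show "open U" by fact
    show "((\<lambda>x. g (f x)) has_derivative ?D x) (at x)" if "x \<in> U" for x
    proof -
      have fx: "f x \<in> V" using assms(2) that by auto
      have dg: "(g has_derivative frechet_derivative g (at (f x))) (at (f x))"
        by (rule Ck_on_SucD(1)[OF g fx])
      have lin: "linear (frechet_derivative g (at (f x)))"
        using dg has_derivative_linear by blast
      have "?D x = (\<lambda>h. frechet_derivative g (at (f x)) (frechet_derivative f (at x) h))"
      proof
        fix h
        have "frechet_derivative g (at (f x)) (frechet_derivative f (at x) h)
            = frechet_derivative g (at (f x))
                (\<Sum>j\<in>Basis. (frechet_derivative f (at x) h \<bullet> j) *\<^sub>R j)"
          by (simp add: euclidean_representation)
        also have "\<dots> = ?D x h"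
          by (simp add: linear_sum[OF lin] linear_scale[OF lin])
        finally show "?D x h = frechet_derivative g (at (f x)) (frechet_derivative f (at x) h)"
          by simp
      qed
      then show ?thesis
        using has_derivative_compose[OF Ck_on_SucD(1)[OF f that] dg] by simp
    qed
    show "Ck_on n U (\<lambda>x. ?D x i)" if "i \<in> Basis" for i
      by (intro Ck_on_sum Ck_on_scaleR assms(1) finite_Basis Suc.IH Ck_on_Suc_imp[OF f]
          Ck_on_SucD(2)[OF g] Ck_on_bounded_linear_compose[OF assms(1) bounded_linear_inner_left]
          Ck_on_SucD(2)[OF f that])
  qed
qed

text \<open>The derivative of the reciprocal is expressed through the reciprocal itself, so each
  order of regularity yields the next.\<close>

lemma Ck_on_inverse:
  fixes f :: "'a::euclidean_space \<Rightarrow> real"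
  assumes "open U" "Ck_on n U f" "\<And>x. x \<in> U \<Longrightarrow> f x \<noteq> 0"
  shows "Ck_on n U (\<lambda>x. inverse (f x))"
  using assms(2)
proof (induction n)
  case 0
  then show ?case
    using assms(3) by (simp add: continuous_on_inverse)
next
  case (Suc n)
  note f = Suc.prems
  let ?D = "\<lambda>x h. (inverse (f x)) *\<^sub>R (inverse (f x) *\<^sub>R (- frechet_derivative f (at x) h))"
  have inv: "Ck_on n U (\<lambda>x. inverse (f x))"
    by (rule Suc.IH[OF Ck_on_Suc_imp[OF f]])
  show ?case
  proof (rule Ck_on_SucI[where f'="?D"])
    show "open U" by fact
    show "((\<lambda>x. inverse (f x)) has_derivative ?D x) (at x)" if "x \<in> U" for x
      using Deriv.has_derivative_inverse[OF assms(3)[OF that] Ck_on_SucD(1)[OF f that]]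
      by (simp add: algebra_simps)
    show "Ck_on n U (\<lambda>x. ?D x i)" if "i \<in> Basis" for i
      by (intro Ck_on_scaleR assms(1) inv
          Ck_on_bounded_linear_compose[OF assms(1) bounded_linear_minus[OF bounded_linear_ident]]
          Ck_on_SucD(2)[OF f that])
  qed
qed

section \<open>Germs of smooth maps at a point\<close>

definition smooth_at :: "'a::euclidean_space \<Rightarrow> ('a \<Rightarrow> 'b::real_normed_vector) \<Rightarrow> bool" where
  "smooth_at p f \<longleftrightarrow> (\<exists>U. p \<in> U \<and> smooth_on U f)"

lemma smooth_onI: "open U \<Longrightarrow> (\<And>n. Ck_on n U f) \<Longrightarrow> smooth_on U f"
  by (simp add: smooth_on_def)

lemma smooth_on_imp_at: "smooth_on U f \<Longrightarrow> p \<in> U \<Longrightarrow> smooth_at p f"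
  by (auto simp: smooth_at_def)

lemma smooth_atI: "p \<in> U \<Longrightarrow> open U \<Longrightarrow> (\<And>n. Ck_on n U f) \<Longrightarrow> smooth_at p f"
  unfolding smooth_at_def smooth_on_def by (intro exI[of _ U] conjI allI)

lemma smooth_atE:
  assumes "smooth_at p f"
  obtains U where "p \<in> U" "open U" "\<forall>n. Ck_on n U f"
proof -
  obtain U where "p \<in> U" and U: "smooth_on U f"
    using assms unfolding smooth_at_def by (elim exE conjE)
  then show ?thesis
    using that[of U] unfolding smooth_on_def by simp
qed

lemma smooth_onI_local:
  assumes "open U" "\<And>p. p \<in> U \<Longrightarrow> smooth_at p f"
  shows "smooth_on U f"
proof (rule smooth_onI[OF assms(1)])
  show "Ck_on n U f" for n
  proof (rule Ck_on_local)
    fix x assume "x \<in> U"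
    obtain V where "x \<in> V" "open V" "\<forall>n. Ck_on n V f"
      by (rule smooth_atE[OF assms(2)[OF \<open>x \<in> U\<close>]])
    then show "\<exists>V. open V \<and> x \<in> V \<and> Ck_on n V f"
      by (intro exI[of _ V] conjI) simp_all
  qed
qed

lemma smooth_on_subset: "smooth_on U f \<Longrightarrow> open V \<Longrightarrow> V \<subseteq> U \<Longrightarrow> smooth_on V f"
  unfolding smooth_on_def by (simp add: Ck_on_subset[of _ U f V])

lemma smooth_at_cong:
  assumes "smooth_at p f" "\<forall>\<^sub>F x in nhds p. f x = g x"
  shows "smooth_at p g"
proof -
  obtain U where U: "p \<in> U" "open U" "\<forall>n. Ck_on n U f"
    by (rule smooth_atE[OF assms(1)])
  obtain V where V: "open V" "p \<in> V" "\<And>x. x \<in> V \<Longrightarrow> f x = g x"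
    using assms(2) by (auto simp: eventually_nhds)
  show ?thesis
  proof (rule smooth_atI)
    show "p \<in> U \<inter> V" using U(1) V(2) by simp
    show o: "open (U \<inter> V)" using U(2) V(1) by (rule open_Int)
    show "Ck_on n (U \<inter> V) g" for n
      by (rule Ck_on_cong[OF o _ Ck_on_subset[OF U(3)[rule_format]]]) (use V(3) in simp_all)
  qed
qed

lemma smooth_at_eventually:
  assumes "smooth_at p f"
  shows "\<forall>\<^sub>F x in nhds p. smooth_at x f"
proof -
  obtain U where U: "p \<in> U" "open U" "\<forall>n. Ck_on n U f"
    by (rule smooth_atE[OF assms])
  have "smooth_at x f" if "x \<in> U" for x
    by (rule smooth_atI[OF that U(2) U(3)[rule_format]])
  then show ?thesis
    unfolding eventually_nhds using U(1,2) by (intro exI[of _ U]) simp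
qed

lemma smooth_at_const [simp]: "smooth_at p (\<lambda>x. c)"
  by (rule smooth_atI[of _ UNIV]) (simp_all add: Ck_on_const)

lemma smooth_at_bounded_linear: "bounded_linear L \<Longrightarrow> smooth_at p L"
  by (rule smooth_atI[of _ UNIV]) (simp_all add: Ck_on_bounded_linear)

lemma smooth_at_ident [simp]: "smooth_at p (\<lambda>x. x)"
  by (rule smooth_at_bounded_linear[OF bounded_linear_ident])

lemma smooth_at_common_nbhd:
  assumes "smooth_at p f" "smooth_at p g"
  obtains U where "p \<in> U" "open U" "\<forall>n. Ck_on n U f" "\<forall>n. Ck_on n U g"
proof -
  obtain U where U: "p \<in> U" "open U" "\<forall>n. Ck_on n U f"
    by (rule smooth_atE[OF assms(1)])
  obtain V where V: "p \<in> V" "open V" "\<forall>n. Ck_on n V g"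
    by (rule smooth_atE[OF assms(2)])
  show ?thesis
  proof (rule that[of "U \<inter> V"])
    show "\<forall>n. Ck_on n (U \<inter> V) f" "\<forall>n. Ck_on n (U \<inter> V) g"
      by (intro allI Ck_on_subset[OF U(3)[rule_format]] Ck_on_subset[OF V(3)[rule_format]], simp)+
  qed (use U(1,2) V(1,2) in auto)
qed

lemma smooth_at_add:
  assumes "smooth_at p f" "smooth_at p g" shows "smooth_at p (\<lambda>x. f x + g x)"
proof -
  obtain U where U: "p \<in> U" "open U" "\<forall>n. Ck_on n U f" "\<forall>n. Ck_on n U g"
    by (rule smooth_at_common_nbhd[OF assms])
  show ?thesis
    by (rule smooth_atI[OF U(1,2) Ck_on_add[OF U(2) U(3,4)[rule_format]]])
qed

lemma smooth_at_scaleR: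
  assumes "smooth_at p f" "smooth_at p g" shows "smooth_at p (\<lambda>x. f x *\<^sub>R g x)"
proof -
  obtain U where U: "p \<in> U" "open U" "\<forall>n. Ck_on n U f" "\<forall>n. Ck_on n U g"
    by (rule smooth_at_common_nbhd[OF assms])
  show ?thesis
    by (rule smooth_atI[OF U(1,2) Ck_on_scaleR[OF U(2) U(3,4)[rule_format]]])
qed

lemma smooth_at_compose:
  fixes f :: "'a::euclidean_space \<Rightarrow> 'b::euclidean_space" and g :: "'b \<Rightarrow> 'c::real_normed_vector"
  assumes "smooth_at p f" "smooth_at (f p) g"
  shows "smooth_at p (\<lambda>x. g (f x))"
proof -
  obtain U where U: "p \<in> U" "open U" "\<forall>n. Ck_on n U f"
    by (rule smooth_atE[OF assms(1)])
  obtain V where V: "f p \<in> V" "open V" "\<forall>n. Ck_on n V g"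
    by (rule smooth_atE[OF assms(2)])
  have "continuous_on U f" using spec[OF U(3), of 0] by simp
  then obtain T where T: "open T" "T \<inter> U = f -` V \<inter> U"
    using V(2) U(2) by (meson continuous_on_open_invariant)
  let ?W = "U \<inter> T"
  have W: "open ?W" "p \<in> ?W" "f ` ?W \<subseteq> V"
    using T U V by auto
  have "Ck_on n ?W (\<lambda>x. g (f x))" for n
    by (rule Ck_on_compose[OF W(1,3) Ck_on_subset[OF U(3)[rule_format]] V(3)[rule_format]]) auto
  then show ?thesis
    by (rule smooth_atI[OF W(2,1)])
qed

lemma smooth_at_linear_compose:
  fixes f :: "'a::euclidean_space \<Rightarrow> 'b::euclidean_space"
  assumes "smooth_at p f" "bounded_linear L"
  shows "smooth_at p (\<lambda>x. L (f x))"
  by (rule smooth_at_compose[OF assms(1) smooth_at_bounded_linear[OF assms(2)]])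

lemma smooth_at_minus:
  fixes f :: "'a::euclidean_space \<Rightarrow> 'b::euclidean_space"
  shows "smooth_at p f \<Longrightarrow> smooth_at p (\<lambda>x. - f x)"
  by (rule smooth_at_linear_compose[OF _ bounded_linear_minus[OF bounded_linear_ident]])

lemma smooth_at_diff:
  fixes f :: "'a::euclidean_space \<Rightarrow> 'b::euclidean_space"
  assumes "smooth_at p f" "smooth_at p g" shows "smooth_at p (\<lambda>x. f x - g x)"
  using smooth_at_add[OF assms(1) smooth_at_minus[OF assms(2)]] by simp

lemma smooth_at_fst:
  fixes f :: "'a::euclidean_space \<Rightarrow> 'b::euclidean_space \<times> 'c::euclidean_space"
  shows "smooth_at p f \<Longrightarrow> smooth_at p (\<lambda>x. fst (f x))"
  by (rule smooth_at_linear_compose[OF _ bounded_linear_fst])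

lemma smooth_at_snd:
  fixes f :: "'a::euclidean_space \<Rightarrow> 'b::euclidean_space \<times> 'c::euclidean_space"
  shows "smooth_at p f \<Longrightarrow> smooth_at p (\<lambda>x. snd (f x))"
  by (rule smooth_at_linear_compose[OF _ bounded_linear_snd])

lemma smooth_at_Pair:
  fixes f :: "'a::euclidean_space \<Rightarrow> 'b::euclidean_space" and g :: "'a \<Rightarrow> 'c::euclidean_space"
  assumes "smooth_at p f" "smooth_at p g" shows "smooth_at p (\<lambda>x. (f x, g x))"
proof -
  have "smooth_at p (\<lambda>x. (f x, 0::'c))"
    by (rule smooth_at_linear_compose[OF assms(1)])
      (intro bounded_linear_Pair bounded_linear_ident bounded_linear_zero)
  moreover have "smooth_at p (\<lambda>x. (0::'b, g x))"
    by (rule smooth_at_linear_compose[OF assms(2)])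
      (intro bounded_linear_Pair bounded_linear_ident bounded_linear_zero)
  ultimately show ?thesis
    using smooth_at_add[of p "\<lambda>x. (f x, 0)" "\<lambda>x. (0, g x)"] by simp
qed

lemma smooth_at_mult:
  fixes f g :: "'a::euclidean_space \<Rightarrow> real"
  assumes "smooth_at p f" "smooth_at p g" shows "smooth_at p (\<lambda>x. f x * g x)"
  using smooth_at_scaleR[OF assms] by simp

lemma smooth_at_power:
  fixes f :: "'a::euclidean_space \<Rightarrow> real"
  assumes "smooth_at p f" shows "smooth_at p (\<lambda>x. f x ^ n)"
  by (induction n) (simp_all add: smooth_at_mult[OF assms])

lemma smooth_at_sum:
  assumes "finite J" "\<And>j. j \<in> J \<Longrightarrow> smooth_at p (f j)"
  shows "smooth_at p (\<lambda>x. \<Sum>j\<in>J. f j x)"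
  using assms
proof (induction J rule: finite_induct)
  case (insert j J)
  then show ?case
    using smooth_at_add[of p "f j" "\<lambda>x. \<Sum>j\<in>J. f j x"] by simp
qed simp

lemma smooth_at_continuous:
  assumes "smooth_at p f" shows "isCont f p"
proof -
  obtain U where U: "p \<in> U" "open U" "\<forall>n. Ck_on n U f"
    by (rule smooth_atE[OF assms])
  have "continuous_on U f"
    using spec[OF U(3), of 0] by simp
  then show ?thesis
    using U(1,2) by (simp add: continuous_on_eq_continuous_at)
qed

lemma smooth_at_differentiable:
  assumes "smooth_at p f" shows "(f has_derivative frechet_derivative f (at p)) (at p)"
proof -
  obtain U where U: "p \<in> U" "open U" "\<forall>n. Ck_on n U f"
    by (rule smooth_atE[OF assms])
  show ?thesis by (rule Ck_on_SucD(1)[OF U(3)[rule_format] U(1)])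
qed

lemma smooth_at_partial:
  assumes "smooth_at p f" "i \<in> Basis"
  shows "smooth_at p (\<lambda>x. frechet_derivative f (at x) i)"
proof -
  obtain U where U: "p \<in> U" "open U" "\<forall>n. Ck_on n U f"
    by (rule smooth_atE[OF assms(1)])
  have "Ck_on n U (\<lambda>x. frechet_derivative f (at x) i)" for n
    using Ck_on_SucD(2)[OF U(3)[rule_format] assms(2)] .
  then show ?thesis by (rule smooth_atI[OF U(1,2)])
qed

lemma smooth_at_eventually_nonzero:
  assumes "smooth_at p f" "f p \<noteq> 0" shows "\<forall>\<^sub>F x in nhds p. f x \<noteq> 0"
  using tendsto_imp_eventually_ne[OF
      smooth_at_continuous[OF assms(1), unfolded isCont_def] assms(2)]
  unfolding eventually_at_filter by (rule eventually_mono) (use assms(2) in auto)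

lemma smooth_at_inverse:
  fixes f :: "'a::euclidean_space \<Rightarrow> real"
  assumes "smooth_at p f" "f p \<noteq> 0" shows "smooth_at p (\<lambda>x. inverse (f x))"
proof -
  obtain U where U: "p \<in> U" "open U" "\<forall>n. Ck_on n U f"
    by (rule smooth_atE[OF assms(1)])
  have "\<forall>\<^sub>F x in nhds p. f x \<noteq> 0"
    by (rule smooth_at_eventually_nonzero[OF assms])
  then obtain V where V: "open V" "p \<in> V" "\<And>x. x \<in> V \<Longrightarrow> f x \<noteq> 0"
    by (auto simp: eventually_nhds)
  have "Ck_on n (U \<inter> V) (\<lambda>x. inverse (f x))" for n
    by (rule Ck_on_inverse[OF _ Ck_on_subset[OF U(3)[rule_format]]]) (use U V in auto)
  then show ?thesis
    by (rule smooth_atI[rotated 2]) (use U(1,2) V(1,2) in auto)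
qed

lemma smooth_at_divide:
  fixes f g :: "'a::euclidean_space \<Rightarrow> real"
  assumes "smooth_at p f" "smooth_at p g" "g p \<noteq> 0" shows "smooth_at p (\<lambda>x. f x / g x)"
  using smooth_at_mult[OF assms(1) smooth_at_inverse[OF assms(2,3)]] by (simp add: divide_inverse)

lemmas smooth_at_intros =
  smooth_at_add smooth_at_diff smooth_at_minus smooth_at_mult smooth_at_scaleR smooth_at_power
  smooth_at_Pair smooth_at_fst smooth_at_snd smooth_at_const smooth_at_ident

subsection \<open>The inverse function theorem for smooth maps\<close>

lemma local_diffeo_at_sym: "local_diffeo_at f g p \<Longrightarrow> local_diffeo_at g f (f p)"
  unfolding local_diffeo_at_def
proof (elim exE conjE)
  fix U V
  assume "open U" "open V" "p \<in> U" "f ` U = V" "g ` V = U" "smooth_on U f" "smooth_on V g"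
    "\<forall>x\<in>U. g (f x) = x" "\<forall>y\<in>V. f (g y) = y"
  then show "\<exists>U V. open U \<and> open V \<and> f p \<in> U \<and> g ` U = V \<and> f ` V = U \<and> smooth_on U g
      \<and> smooth_on V f \<and> (\<forall>x\<in>U. f (g x) = x) \<and> (\<forall>y\<in>V. g (f y) = y)"
    by (intro exI[of _ V] exI[of _ U] conjI) (assumption | blast)+
qed

lemma local_diffeo_at_smooth:
  assumes "local_diffeo_at f g p"
  shows "smooth_at p f" "smooth_at (f p) g" "\<forall>\<^sub>F x in nhds p. g (f x) = x"
    "\<forall>\<^sub>F y in nhds (f p). f (g y) = y"
proof -
  obtain U V where U: "open U" "open V" "p \<in> U" "f ` U = V" "smooth_on U f" "smooth_on V g"
    "\<forall>x\<in>U. g (f x) = x" "\<forall>y\<in>V. f (g y) = y"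
    using assms unfolding local_diffeo_at_def by (elim exE conjE)
  have fp: "f p \<in> V" using U(3,4) by auto
  show "smooth_at p f" by (rule smooth_on_imp_at[OF U(5,3)])
  show "smooth_at (f p) g" by (rule smooth_on_imp_at[OF U(6) fp])
  show "\<forall>\<^sub>F x in nhds p. g (f x) = x"
    unfolding eventually_nhds using U(1,3,7) by (intro exI[of _ U] conjI)
  show "\<forall>\<^sub>F y in nhds (f p). f (g y) = y"
    unfolding eventually_nhds using U(2,8) fp by (intro exI[of _ V] conjI)
qed

text \<open>Bootstrapping: the C^1 theorem gives an inverse \<open>g\<close> whose partials are
  \<open>M i (g y)\<close>, so if \<open>g\<close> is C^n then its partials are C^n and
  \<open>g\<close> is C^(n+1). Assuming the columns \<open>M i\<close> of the inverse Jacobian as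
  smooth data spares a proof that matrix inversion is smooth in arbitrary dimension.\<close>

lemma smooth_inverse_function:
  fixes f :: "'a::euclidean_space \<Rightarrow> 'a"
  assumes f: "smooth_at p f"
    and M: "\<And>i. i \<in> Basis \<Longrightarrow> smooth_at p (M i)"
    and inv: "\<forall>\<^sub>F x in nhds p. \<forall>i\<in>Basis. frechet_derivative f (at x) (M i x) = i"
  shows "\<exists>g. local_diffeo_at f g p"
proof -
  have "\<forall>\<^sub>F x in nhds p. \<forall>i\<in>Basis. smooth_at x (M i)"
    by (rule eventually_ball_finite) (simp_all add: smooth_at_eventually[OF M])
  then have "\<forall>\<^sub>F x in nhds p. smooth_at x f \<and> (\<forall>i\<in>Basis. smooth_at x (M i))
      \<and> (\<forall>i\<in>Basis. frechet_derivative f (at x) (M i x) = i)"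
    using smooth_at_eventually[OF f] inv by (simp add: eventually_conj_iff)
  then obtain U where U: "open U" "p \<in> U" and
    ev: "\<forall>x\<in>U. smooth_at x f \<and> (\<forall>i\<in>Basis. smooth_at x (M i))
      \<and> (\<forall>i\<in>Basis. frechet_derivative f (at x) (M i x) = i)"
    unfolding eventually_nhds by (elim exE conjE)
  have fx: "smooth_at x f" if "x \<in> U" for x using ev that by simp
  have Mx: "smooth_at x (M i)" if "x \<in> U" "i \<in> Basis" for x i using ev that by simp
  have invx: "frechet_derivative f (at x) (M i x) = i" if "x \<in> U" "i \<in> Basis" for x i
    using ev that by simp
  have fU: "smooth_on U f" by (rule smooth_onI_local[OF U(1) fx])
  have MU: "smooth_on U (M i)" if "i \<in> Basis" for i
    by (rule smooth_onI_local[OF U(1) Mx[OF _ that]])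
  have der: "(f has_derivative frechet_derivative f (at x)) (at x)" if "x \<in> U" for x
    by (rule smooth_at_differentiable[OF fx[OF that]])
  have bl: "bounded_linear (frechet_derivative f (at x))" if "x \<in> U" for x
    by (rule has_derivative_bounded_linear[OF der[OF that]])
  define f' where "f' x = Blinfun (frechet_derivative f (at x))" for x
  have f'_apply: "blinfun_apply (f' x) = frechet_derivative f (at x)" if "x \<in> U" for x
    unfolding f'_def by (rule bounded_linear_Blinfun_apply[OF bl[OF that]])
  have der': "(f has_derivative blinfun_apply (f' x)) (at x)" if "x \<in> U" for x
    using der[OF that] by (simp add: f'_apply[OF that])
  have cont: "continuous_on U f'"
  proof (rule continuous_on_blinfun_componentwise)
    fix i :: 'a assume i: "i \<in> Basis"
    have "Ck_on (Suc 0) U f" using fU unfolding smooth_on_def by simp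
    then have "continuous_on U (\<lambda>x. frechet_derivative f (at x) i)"
      using i by simp
    then show "continuous_on U (\<lambda>x. blinfun_apply (f' x) i)"
      by (rule continuous_on_eq) (simp add: f'_apply)
  qed
  have lin: "linear (frechet_derivative f (at p))"
    using bl[OF U(2)] by (rule bounded_linear.linear)
  \<comment> \<open>The columns \<open>M i p\<close> give a right inverse, hence surjectivity, which
    for an endomorphism in finite dimension is bijectivity.\<close>
  have "frechet_derivative f (at p) (\<Sum>i\<in>Basis. (y \<bullet> i) *\<^sub>R M i p) = y" for y
  proof -
    have "frechet_derivative f (at p) (\<Sum>i\<in>Basis. (y \<bullet> i) *\<^sub>R M i p)
        = (\<Sum>i\<in>Basis. (y \<bullet> i) *\<^sub>R frechet_derivative f (at p) (M i p))"
      by (simp add: linear_sum[OF lin] linear_scale[OF lin])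
    also have "\<dots> = (\<Sum>i\<in>Basis. (y \<bullet> i) *\<^sub>R i)"
      by (rule sum.cong) (simp_all add: invx[OF U(2)])
    finally show ?thesis by (simp add: euclidean_representation)
  qed
  then have "surj (frechet_derivative f (at p))" by (rule surjI)
  from linear_surjective_isomorphism[OF lin this]
  obtain h where h: "linear h" "\<And>x. h (frechet_derivative f (at p) x) = x"
    by metis
  have hbl: "bounded_linear h" using h(1) by (simp add: linear_conv_bounded_linear)
  have invf: "Blinfun h o\<^sub>L f' p = id_blinfun"
    by (rule blinfun_eqI)
      (simp add: f'_apply[OF U(2)] bounded_linear_Blinfun_apply[OF hbl] h(2))
  obtain U' V g g' where U': "open U'" "U' \<subseteq> U" "p \<in> U'" "open V" "f p \<in> V"
    and hom: "homeomorphism U' V f g"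
    and dg: "\<And>y. y \<in> V \<Longrightarrow> (g has_derivative (g' y)) (at y)"
    and g': "\<And>y. y \<in> V \<Longrightarrow> g' y = Hilbert_Choice.inv (blinfun_apply (f'(g y)))"
    and bij: "\<And>y. y \<in> V \<Longrightarrow> bij (blinfun_apply (f'(g y)))"
    by (rule inverse_function_theorem[OF U(1) der' cont U(2) invf]) auto
  have gV: "g ` V = U'" and fU': "f ` U' = V" and contg: "continuous_on V g"
    and gf: "\<And>x. x \<in> U' \<Longrightarrow> g (f x) = x" and fg: "\<And>y. y \<in> V \<Longrightarrow> f (g y) = y"
    using hom by (auto simp: homeomorphism_def)
  have gU: "g y \<in> U" if "y \<in> V" for y using gV U'(2) that by auto
  have g'i: "g' y i = M i (g y)" if "y \<in> V" "i \<in> Basis" for y i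
  proof -
    have "blinfun_apply (f' (g y)) (M i (g y)) = i"
      by (simp add: f'_apply[OF gU[OF that(1)]] invx[OF gU[OF that(1)] that(2)])
    then show ?thesis
      using g'[OF that(1)] bij_is_inj[OF bij[OF that(1)]] by (metis inv_f_f)
  qed
  have "Ck_on n V g" for n
  proof (induction n)
    case 0
    then show ?case using contg by simp
  next
    case (Suc n)
    show ?case
    proof (rule Ck_on_SucI[OF U'(4) dg])
      fix i :: 'a assume i: "i \<in> Basis"
      have "Ck_on n U (M i)" using MU[OF i] unfolding smooth_on_def by simp
      then have "Ck_on n V (\<lambda>y. M i (g y))"
        using Ck_on_compose[OF U'(4) _ Suc] gU by blast
      then show "Ck_on n V (\<lambda>y. g' y i)"
        by (rule Ck_on_cong[OF U'(4), rotated]) (simp add: g'i[OF _ i])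
    qed
  qed
  then have "smooth_on V g" by (rule smooth_onI[OF U'(4)])
  moreover have "smooth_on U' f" by (rule smooth_on_subset[OF fU U'(1,2)])
  ultimately show ?thesis
    unfolding local_diffeo_at_def
    using U'(1,3,4) fU' gV gf fg by (intro exI[of _ g] exI[of _ U'] exI[of _ V]) simp
qed

lemma smooth_inverse_function_real:
  fixes f :: "real \<Rightarrow> real"
  assumes "smooth_at p f" "(f has_real_derivative d) (at p)" "d \<noteq> 0"
  shows "\<exists>g. local_diffeo_at f g p"
proof -
  have s: "smooth_at p (\<lambda>x. frechet_derivative f (at x) 1)"
    by (rule smooth_at_partial[OF assms(1)]) simp
  have d: "frechet_derivative f (at p) 1 = d"
    by (simp add: frechet_derivative_at[OF assms(2)[unfolded has_field_derivative_def], symmetric])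
  have ne: "\<forall>\<^sub>F x in nhds p. frechet_derivative f (at x) 1 \<noteq> 0"
    by (rule smooth_at_eventually_nonzero[OF s]) (simp add: d assms(3))
  show ?thesis
  proof (rule smooth_inverse_function[where M="\<lambda>i x. inverse (frechet_derivative f (at x) 1)"])
    show "smooth_at p f" by fact
    show "smooth_at p (\<lambda>x. inverse (frechet_derivative f (at x) 1))"
      by (rule smooth_at_inverse[OF s]) (simp add: d assms(3))
    show "\<forall>\<^sub>F x in nhds p. \<forall>i\<in>Basis.
        frechet_derivative f (at x) (inverse (frechet_derivative f (at x) 1)) = i"
      using ne smooth_at_eventually[OF assms(1)]
    proof eventually_elim
      case (elim x)
      have "linear (frechet_derivative f (at x))"
        using smooth_at_differentiable[OF elim(2)] by (rule has_derivative_linear)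
      then have "frechet_derivative f (at x) (c *\<^sub>R 1) = c *\<^sub>R frechet_derivative f (at x) 1" for c
        by (rule linear_scale)
      from this[of "inverse (frechet_derivative f (at x) 1)"] elim(1) show ?case
        by (simp only: real_scaleR_def mult_1_right left_inverse Basis_real_def simp_thms)
          simp
    qed
  qed
qed

lemma smooth_inverse_function_plane:
  fixes f :: "real \<times> real \<Rightarrow> real \<times> real"
  assumes "smooth_at p f"
    and "det2 (frechet_derivative f (at p) (1,0)) (frechet_derivative f (at p) (0,1)) \<noteq> 0"
  shows "\<exists>g. local_diffeo_at f g p"
proof -
  let ?u = "\<lambda>x. frechet_derivative f (at x) (1,0)" and ?v = "\<lambda>x. frechet_derivative f (at x) (0,1)"
  let ?d = "\<lambda>x. det2 (?u x) (?v x)"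
  \<comment> \<open>Cramer's rule: the two columns of the inverse of the matrix with columns
    \<open>?u x\<close> and \<open>?v x\<close>.\<close>
  let ?M = "\<lambda>(i::real \<times> real) x. if i = (1,0) then (snd (?v x) / ?d x, - snd (?u x) / ?d x)
                  else (- fst (?v x) / ?d x, fst (?u x) / ?d x)"
  have u: "smooth_at p ?u" by (rule smooth_at_partial[OF assms(1)]) (simp add: Basis_prod_def)
  have v: "smooth_at p ?v" by (rule smooth_at_partial[OF assms(1)]) (simp add: Basis_prod_def)
  have d: "smooth_at p ?d"
    unfolding det2_def by (intro smooth_at_intros u v)
  have ne: "\<forall>\<^sub>F x in nhds p. ?d x \<noteq> 0"
    by (rule smooth_at_eventually_nonzero[OF d assms(2)])
  show ?thesis
  proof (rule smooth_inverse_function[where M="?M"])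
    show "smooth_at p f" by fact
    show "smooth_at p (?M i)" for i
    proof (cases "i = (1,0)")
      case True
      have "smooth_at p (\<lambda>x. (snd (?v x) / ?d x, - snd (?u x) / ?d x))"
        by (intro smooth_at_Pair smooth_at_divide[OF _ d assms(2)] smooth_at_minus
          smooth_at_snd u v)
      then show ?thesis by (simp only: True simp_thms if_True)
    next
      case False
      have "smooth_at p (\<lambda>x. (- fst (?v x) / ?d x, fst (?u x) / ?d x))"
        by (intro smooth_at_Pair smooth_at_divide[OF _ d assms(2)] smooth_at_minus
          smooth_at_fst u v)
      then show ?thesis by (simp only: False simp_thms if_False)
    qed
    show "\<forall>\<^sub>F x in nhds p. \<forall>i\<in>Basis. frechet_derivative f (at x) (?M i x) = i"
      using ne smooth_at_eventually[OF assms(1)]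
    proof eventually_elim
      case (elim x)
      have lin: "linear (frechet_derivative f (at x))"
        using smooth_at_differentiable[OF elim(2)] by (rule has_derivative_linear)
      have expand: "frechet_derivative f (at x) (a, b) = a *\<^sub>R ?u x + b *\<^sub>R ?v x" for a b
      proof -
        have "(a, b) = a *\<^sub>R (1, 0) + b *\<^sub>R (0::real, 1::real)" by simp
        then show ?thesis
          by (metis linear_add[OF lin] linear_scale[OF lin])
      qed
      obtain a b c e where ab: "?u x = (a, b)" and ce: "?v x = (c, e)" by fastforce
      have expand': "frechet_derivative f (at x) (s, t) = s *\<^sub>R (a, b) + t *\<^sub>R (c, e)" for s t
        using expand[of s t] by (simp only: ab ce)
      have ne': "a * e - b * c \<noteq> 0" using elim(1) by (simp add: ab ce det2_def)
      define d where "d = a * e - b * c"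
      have dx: "?d x = d" by (simp add: ab ce det2_def d_def)
      have "a * e - b * c = d" "d \<noteq> 0" using ne' by (simp_all add: d_def)
      then have "(e / d) * a + (- b / d) * c = 1" "(e / d) * b + (- b / d) * e = 0"
        "(- c / d) * a + (a / d) * c = 0" "(- c / d) * b + (a / d) * e = 1"
        by (simp_all add: field_simps)
      then have D: "frechet_derivative f (at x) (e / d, - b / d) = (1,0)"
        "frechet_derivative f (at x) (- c / d, a / d) = (0,1)"
        using expand'[of "e / d" "- b / d"] expand'[of "- c / d" "a / d"] by simp_all
      have "?M (1::real,0::real) x = (e / d, - b / d)" "?M (0::real,1::real) x = (- c / d, a / d)"
        unfolding dx unfolding ab ce by simp_all
      then have M: "frechet_derivative f (at x) (?M (1::real,0::real) x) = (1,0)"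
        "frechet_derivative f (at x) (?M (0::real,1::real) x) = (0,1)"
        using D by (simp_all only:)
      have basis: "i = (1,0) \<or> i = (0,1)" if "i \<in> Basis" for i :: "real \<times> real"
        using that by (auto simp: Basis_prod_def)
      show ?case
      proof (rule ballI)
        fix i :: "real \<times> real" assume "i \<in> Basis"
        from basis[OF this] show "frechet_derivative f (at x) (?M i x) = i"
          by (elim disjE) (simp_all only: M)
      qed
    qed
  qed
qed

subsection \<open>Taylor expansions of smooth functions of one variable\<close>

lemma smooth_at_deriv:
  fixes f :: "real \<Rightarrow> real"
  assumes "smooth_at p f"
  shows "(f has_real_derivative deriv f p) (at p)" "smooth_at p (deriv f)"
proof -
  have ev: "(f has_real_derivative frechet_derivative f (at x) 1) (at x)" if "smooth_at x f" for x
  proof -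
    have d: "(f has_derivative frechet_derivative f (at x)) (at x)"
      by (rule smooth_at_differentiable[OF that])
    define k where "k = frechet_derivative f (at x) 1"
    have "frechet_derivative f (at x) (h *\<^sub>R 1) = h *\<^sub>R k" for h
      unfolding k_def by (rule linear_scale[OF has_derivative_linear[OF d]])
    then have "frechet_derivative f (at x) = (*) k"
      by (intro ext) (simp add: mult.commute)
    then show ?thesis
      using d by (simp add: has_field_derivative_def)
  qed
  show "(f has_real_derivative deriv f p) (at p)"
    using ev[OF assms] by (simp add: DERIV_imp_deriv[OF ev[OF assms]])
  have "\<forall>\<^sub>F x in nhds p. frechet_derivative f (at x) 1 = deriv f x"
    using smooth_at_eventually[OF assms]
    by eventually_elim (simp add: DERIV_imp_deriv[OF ev])
  moreover have "smooth_at p (\<lambda>x. frechet_derivative f (at x) 1)"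
    by (rule smooth_at_partial[OF assms]) simp
  ultimately show "smooth_at p (deriv f)"
    by (rule smooth_at_cong[rotated])
qed

lemma smooth_at_higher_deriv:
  fixes f :: "real \<Rightarrow> real"
  shows "smooth_at p f \<Longrightarrow> smooth_at p ((deriv ^^ n) f)"
  by (induction n) (simp_all add: smooth_at_deriv)

text \<open>Parameter integrals and function series arrive with explicit candidates for all their
  derivatives; this turns such a list into smoothness.\<close>

lemma smooth_on_tower:
  fixes D :: "nat \<Rightarrow> real \<Rightarrow> real"
  assumes "open S" "\<And>n x. x \<in> S \<Longrightarrow> (D n has_real_derivative D (Suc n) x) (at x)"
  shows "smooth_on S (D n)"
proof (rule smooth_onI[OF assms(1)])
  show "Ck_on k S (D n)" for k
  proof (induction k arbitrary: n)
    case 0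
    show ?case
      using assms(2) by (auto intro!: continuous_at_imp_continuous_on DERIV_isCont)
  next
    case (Suc k)
    show ?case
    proof (rule Ck_on_SucI[OF assms(1)])
      show "(D n has_derivative (*) (D (Suc n) x)) (at x)" if "x \<in> S" for x
        using assms(2)[OF that] by (simp add: has_field_derivative_def)
      show "Ck_on k S (\<lambda>x. D (Suc n) x * i)" if "i \<in> Basis" for i
        using Suc that by simp
    qed
  qed
qed

text \<open>f(t) - f(0) is t times the integral of f'(s t) over s in [0,1], and that integral may be
  differentiated in t under the integral sign as often as desired.\<close>

lemma Hadamard_division:
  fixes f :: "real \<Rightarrow> real"
  assumes "smooth_at 0 f"
  obtains g where "smooth_at 0 g" "\<forall>\<^sub>F t in nhds 0. f t = f 0 + t * g t"
proof -
  obtain r where r: "r > 0" "\<forall>y. dist y 0 < r \<longrightarrow> smooth_at y f"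
    using smooth_at_eventually[OF assms] unfolding eventually_nhds_metric by (elim exE conjE)
  define S where "S = {-r<..<r}"
  have S: "open S" "convex S" "0 \<in> S"
    using r(1) by (simp_all add: S_def)
  have fS: "smooth_at x f" if "x \<in> S" for x
    using r(2) that by (auto simp: S_def dist_real_def)
  define D where "D n = (deriv ^^ n) f" for n
  have D: "(D n has_real_derivative D (Suc n) x) (at x)" if "x \<in> S" for n x
    using smooth_at_deriv(1)[OF smooth_at_higher_deriv[OF fS[OF that]]] by (simp add: D_def)
  have contD: "continuous_on S (D n)" for n
    using D by (auto intro!: continuous_at_imp_continuous_on DERIV_isCont)
  have scaled: "s * x \<in> S" if "x \<in> S" "s \<in> {0..1}" for s x
  proof -
    have "\<bar>s * x\<bar> \<le> 1 * \<bar>x\<bar>"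
      unfolding abs_mult by (rule mult_right_mono) (use that in auto)
    then show ?thesis using that(1) by (auto simp: S_def)
  qed
  \<comment> \<open>\<open>q n\<close> is the candidate for the n-th derivative of the quotient
    \<open>q 0\<close>: every differentiation in t brings down one more factor s.\<close>
  define q where "q n t = integral {0..1} (\<lambda>s. s ^ n * D (Suc n) (s * t))" for n t
  have q: "(q n has_real_derivative q (Suc n) x) (at x)" if x: "x \<in> S" for n x
  proof -
    have "((\<lambda>x. integral (cbox 0 1) (\<lambda>s. s ^ n * D (Suc n) (s * x))) has_real_derivative
        integral (cbox 0 1) (\<lambda>s. s ^ Suc n * D (Suc (Suc n)) (s * x))) (at x within S)"
    proof (rule leibniz_rule_field_derivative[OF _ _ _ x S(2),
          where f="\<lambda>x s. s ^ n * D (Suc n) (s * x)" and fx="\<lambda>x s. s ^ Suc n * D (Suc (Suc n)) (s * x)"])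
      fix y s :: real assume y: "y \<in> S" and s: "s \<in> cbox 0 1"
      have "s * y \<in> S" using scaled[OF y] s by simp
      from D[OF this, of "Suc n"]
      have "((\<lambda>x. D (Suc n) (s * x)) has_real_derivative D (Suc (Suc n)) (s * y) * s) (at y)"
        by (rule DERIV_chain2) (auto intro!: derivative_eq_intros)
      from DERIV_cmult[OF this, of "s ^ n"]
      show "((\<lambda>x. s ^ n * D (Suc n) (s * x)) has_real_derivative s ^ Suc n * D (Suc (Suc n)) (s * y))
          (at y within S)"
        by (simp add: mult_ac has_field_derivative_at_within)
    next
      fix y assume y: "y \<in> S"
      have "continuous_on {0..1} (\<lambda>s. s ^ n * D (Suc n) (s * y))"
        by (intro continuous_intros continuous_on_compose2[OF contD]) (use scaled[OF y] in auto)
      then show "(\<lambda>s. s ^ n * D (Suc n) (s * y)) integrable_on cbox 0 1"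
        by (simp add: integrable_continuous_interval)
    next
      show "continuous_on (S \<times> cbox 0 1) (\<lambda>(x, s). s ^ Suc n * D (Suc (Suc n)) (s * x))"
        unfolding split_def
        by (intro continuous_intros continuous_on_compose2[OF contD]) (use scaled in auto)
    qed
    moreover have "(\<lambda>x. integral (cbox 0 1) (\<lambda>s. s ^ n * D (Suc n) (s * x))) = q n"
      by (simp add: q_def fun_eq_iff)
    moreover have "integral (cbox 0 1) (\<lambda>s. s ^ Suc n * D (Suc (Suc n)) (s * x)) = q (Suc n) x"
      by (simp add: q_def)
    ultimately show ?thesis
      using at_within_open[OF x S(1)] by simp
  qed
  have "smooth_on S (q 0)" using smooth_on_tower[where D=q, OF S(1)] q by simp
  then have "smooth_at 0 (q 0)" by (rule smooth_on_imp_at[OF _ S(3)])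
  moreover have "f t = f 0 + t * q 0 t" if t: "t \<in> S" for t
  proof -
    have "((\<lambda>s. t * D (Suc 0) (s * t)) has_integral (D 0 (1 * t) - D 0 (0 * t))) {0..1}"
    proof (rule fundamental_theorem_of_calculus)
      fix s :: real assume s: "s \<in> {0..1}"
      from D[OF scaled[OF t s], of 0]
      have "((\<lambda>s. D 0 (s * t)) has_real_derivative D (Suc 0) (s * t) * t) (at s)"
        by (rule DERIV_chain2) (auto intro!: derivative_eq_intros)
      then show "((\<lambda>s. D 0 (s * t)) has_vector_derivative t * D (Suc 0) (s * t)) (at s within {0..1})"
        by (simp add: mult.commute has_real_derivative_iff_has_vector_derivative[symmetric]
            has_field_derivative_at_within)
    qed simp
    from integral_unique[OF this]
    have "integral {0..1} (\<lambda>s. t * D (Suc 0) (s * t)) = f t - f 0"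
      by (simp add: D_def)
    then show ?thesis by (simp add: q_def)
  qed
  then have "\<forall>\<^sub>F t in nhds 0. f t = f 0 + t * q 0 t"
    unfolding eventually_nhds using S(1,3) by (intro exI[of _ S] conjI ballI)
  ultimately show ?thesis by (rule that)
qed

lemma smooth_expansion_exists:
  fixes f :: "real \<Rightarrow> real"
  assumes "smooth_at 0 f"
  shows "\<exists>c g. smooth_at 0 g \<and> (\<forall>\<^sub>F t in nhds 0. f t = (\<Sum>j<M. c j * t ^ j) + t ^ M * g t)"
proof (induction M)
  case 0
  show ?case
    by (rule exI[of _ "\<lambda>_. 0"], rule exI[of _ f]) (simp add: assms)
next
  case (Suc M)
  then obtain c g where g: "smooth_at 0 g"
    and ev: "\<forall>\<^sub>F t in nhds 0. f t = (\<Sum>j<M. c j * t ^ j) + t ^ M * g t"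
    by (elim exE conjE)
  obtain h where h: "smooth_at 0 h" "\<forall>\<^sub>F t in nhds 0. g t = g 0 + t * h t"
    by (rule Hadamard_division[OF g])
  have "\<forall>\<^sub>F t in nhds 0. f t = (\<Sum>j<Suc M. (c(M := g 0)) j * t ^ j) + t ^ Suc M * h t"
    using ev h(2)
  proof eventually_elim
    case (elim t)
    have "(\<Sum>j<M. (c(M := g 0)) j * t ^ j) = (\<Sum>j<M. c j * t ^ j)"
      by (rule sum.cong) auto
    then show ?case using elim by (simp add: algebra_simps)
  qed
  then show ?case using h(1) by (intro exI conjI)
qed

text \<open>Uniqueness of Taylor coefficients. Differentiating shifts the coefficients and turns t^M
  g into t^(M-1) (M g + t g'), whose second factor is again smooth, so the induction runs over all
  expansions at once.\<close>

lemma higher_deriv_of_expansion: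
  fixes f :: "real \<Rightarrow> real"
  assumes "smooth_at 0 g" "\<forall>\<^sub>F t in nhds 0. f t = (\<Sum>j<M. c j * t ^ j) + t ^ M * g t" "n < M"
  shows "(deriv ^^ n) f 0 = fact n * c n"
  using assms
proof (induction n arbitrary: f c g M)
  case 0
  then obtain K where M: "M = Suc K" by (cases M) auto
  have "(\<Sum>j<M. c j * 0 ^ j) = c 0"
    unfolding M sum.lessThan_Suc_shift by simp
  then show ?case
    using eventually_nhds_x_imp_x[OF 0(2)] M by simp
next
  case (Suc n)
  then obtain K where M: "M = Suc K" by (cases M) auto
  let ?g = "\<lambda>t. of_nat M * g t + t * deriv g t"
  have sg: "smooth_at 0 ?g"
    by (intro smooth_at_intros Suc.prems(1) smooth_at_deriv(2))
  have "\<forall>\<^sub>F t in nhds 0. \<forall>\<^sub>F s in nhds t. f s = (\<Sum>j<M. c j * s ^ j) + s ^ M * g s"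
    using Suc.prems(2) by (simp add: eventually_eventually)
  then have ev: "\<forall>\<^sub>F t in nhds 0. deriv f t = (\<Sum>j<K. (real (Suc j) * c (Suc j)) * t ^ j) + t ^ K * ?g t"
    using smooth_at_eventually[OF Suc.prems(1)]
  proof eventually_elim
    case (elim t)
    have der: "((\<lambda>s. (\<Sum>j<M. c j * s ^ j) + s ^ M * g s) has_real_derivative
        (\<Sum>j<M. c j * (real j * t ^ (j - 1))) + (real M * t ^ (M - 1) * g t + deriv g t * t ^ M)) (at t)"
      by (rule derivative_eq_intros smooth_at_deriv(1)[OF elim(2)] refl | simp add: mult_ac)+
    have "deriv f t = (\<Sum>j<M. c j * (real j * t ^ (j - 1)))
        + (real M * t ^ (M - 1) * g t + deriv g t * t ^ M)"
      unfolding deriv_cong_ev[OF elim(1) refl] by (rule DERIV_imp_deriv[OF der])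
    also have "(\<Sum>j<M. c j * (real j * t ^ (j - 1))) = (\<Sum>j<K. (real (Suc j) * c (Suc j)) * t ^ j)"
      unfolding M sum.lessThan_Suc_shift by (simp add: mult_ac)
    finally show ?case by (simp add: M algebra_simps)
  qed
  have "(deriv ^^ n) (deriv f) 0 = fact n * (real (Suc n) * c (Suc n))"
    by (rule Suc.IH[OF sg ev]) (use Suc.prems(3) M in simp)
  then show ?case
    by (simp add: funpow_swap1 del: funpow.simps) (simp add: funpow_swap1 algebra_simps)
qed

lemma smooth_Taylor:
  fixes f :: "real \<Rightarrow> real"
  assumes "smooth_at 0 f"
  obtains g where "smooth_at 0 g"
    "\<forall>\<^sub>F t in nhds 0. f t = (\<Sum>j<M. (deriv ^^ j) f 0 / fact j * t ^ j) + t ^ M * g t"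
proof -
  obtain c g where g: "smooth_at 0 g"
    and ev: "\<forall>\<^sub>F t in nhds 0. f t = (\<Sum>j<M. c j * t ^ j) + t ^ M * g t"
    using smooth_expansion_exists[OF assms, of M] by (elim exE conjE)
  have "(\<Sum>j<M. (deriv ^^ j) f 0 / fact j * t ^ j) = (\<Sum>j<M. c j * t ^ j)" for t
    by (rule sum.cong) (simp_all add: higher_deriv_of_expansion[OF g ev])
  then show ?thesis using that[OF g] ev by simp
qed

text \<open>Integration gains one order. Along the cusps the chain rule gives information about
  derivatives, and this carries it back to the functions.\<close>

lemma smooth_divisible_if_deriv_divisible:
  fixes f :: "real \<Rightarrow> real"
  assumes f: "smooth_at 0 f" and g: "smooth_at 0 g" and ev: "\<forall>\<^sub>F t in nhds 0. deriv f t = t ^ m * g t"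
  obtains h where "smooth_at 0 h" "\<forall>\<^sub>F t in nhds 0. f t = f 0 + t ^ Suc m * h t"
proof -
  obtain h where h: "smooth_at 0 h"
    "\<forall>\<^sub>F t in nhds 0. f t = (\<Sum>j<Suc m. (deriv ^^ j) f 0 / fact j * t ^ j) + t ^ Suc m * h t"
    by (rule smooth_Taylor[OF f])
  have ev': "\<forall>\<^sub>F t in nhds 0. deriv f t = (\<Sum>j<m. 0 * t ^ j) + t ^ m * g t"
    using ev by simp
  have "(deriv ^^ Suc j) f 0 = 0" if "j < m" for j
    using higher_deriv_of_expansion[OF g ev' that] by (simp add: funpow_swap1)
  then have "(\<Sum>j<m. (deriv ^^ Suc j) f 0 / fact (Suc j) * t ^ Suc j) = 0" for t
    by (intro sum.neutral) auto
  then have "(\<Sum>j<Suc m. (deriv ^^ j) f 0 / fact j * t ^ j) = f 0" for t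
    unfolding sum.lessThan_Suc_shift by simp
  then show ?thesis using that[OF h(1)] h(2) by simp
qed

subsection \<open>Borel's lemma\<close>

text \<open>Bounded building blocks all of whose derivatives are bounded. They replace the usual cut-off
  functions: a multiple of \<open>sin (l * x) ^ n / l ^ n\<close> has a prescribed \<open>n\<close>-th derivative at \<open>0\<close>,
  while its derivatives of lower order are uniformly small for large \<open>l\<close>.\<close>

inductive trig :: "(real \<Rightarrow> real) \<Rightarrow> bool" where
  trig_const: "trig (\<lambda>x. c)"
| trig_sin: "trig (\<lambda>x. sin (l * x))"
| trig_cos: "trig (\<lambda>x. cos (l * x))"
| trig_add: "trig f \<Longrightarrow> trig g \<Longrightarrow> trig (\<lambda>x. f x + g x)"
| trig_mult: "trig f \<Longrightarrow> trig g \<Longrightarrow> trig (\<lambda>x. f x * g x)"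

lemma trig_bounded: "trig f \<Longrightarrow> \<exists>K. \<forall>x. \<bar>f x\<bar> \<le> K"
proof (induction rule: trig.induct)
  case (trig_const c)
  then show ?case by auto
next
  case (trig_sin l)
  then show ?case using abs_sin_le_one by blast
next
  case (trig_cos l)
  then show ?case using abs_cos_le_one by blast
next
  case (trig_add f g)
  then obtain K L where "\<And>x. \<bar>f x\<bar> \<le> K" "\<And>x. \<bar>g x\<bar> \<le> L" by metis
  then have "\<bar>f x + g x\<bar> \<le> K + L" for x
    using abs_triangle_ineq[of "f x" "g x"] by (meson add_mono order_trans)
  then show ?case by (intro exI[of _ "K + L"]) simp
next
  case (trig_mult f g)
  then obtain K L where KL: "\<And>x. \<bar>f x\<bar> \<le> K" "\<And>x. \<bar>g x\<bar> \<le> L" by metis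
  have "\<bar>f x * g x\<bar> \<le> K * L" for x
    unfolding abs_mult by (rule mult_mono[OF KL]) (use KL(1)[of x] in auto)
  then show ?case by (intro exI[of _ "K * L"]) simp
qed

lemma trig_has_deriv: "trig f \<Longrightarrow> \<exists>f'. trig f' \<and> (\<forall>x. (f has_real_derivative f' x) (at x))"
proof (induction rule: trig.induct)
  case (trig_const c)
  show ?case
    by (rule exI[of _ "\<lambda>x. 0"]) (auto intro: trig.trig_const)
next
  case (trig_sin l)
  have "trig (\<lambda>x. l * cos (l * x))" by (intro trig.intros)
  moreover have "\<forall>x. ((\<lambda>x. sin (l * x)) has_real_derivative l * cos (l * x)) (at x)"
    by (auto intro!: derivative_eq_intros)
  ultimately show ?case by (intro exI conjI)
next
  case (trig_cos l)
  have "trig (\<lambda>x. (- l) * sin (l * x))" by (intro trig.intros)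
  moreover have "\<forall>x. ((\<lambda>x. cos (l * x)) has_real_derivative (- l) * sin (l * x)) (at x)"
    by (auto intro!: derivative_eq_intros)
  ultimately show ?case by (intro exI conjI)
next
  case (trig_add f g)
  then obtain f' g' where "trig f'" "trig g'"
    and d: "\<forall>x. (f has_real_derivative f' x) (at x)" "\<forall>x. (g has_real_derivative g' x) (at x)"
    by (elim exE conjE)
  then have "trig (\<lambda>x. f' x + g' x)" by (intro trig.intros)
  moreover have "\<forall>x. ((\<lambda>x. f x + g x) has_real_derivative f' x + g' x) (at x)"
    by (intro allI DERIV_add d[rule_format])
  ultimately show ?case by (intro exI conjI)
next
  case (trig_mult f g)
  then obtain f' g' where t: "trig f'" "trig g'"
    and d: "\<forall>x. (f has_real_derivative f' x) (at x)" "\<forall>x. (g has_real_derivative g' x) (at x)"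
    by (elim exE conjE)
  have "trig (\<lambda>x. f' x * g x + g' x * f x)"
    by (intro trig.trig_add trig.trig_mult t trig_mult.hyps)
  moreover have "\<forall>x. ((\<lambda>x. f x * g x) has_real_derivative f' x * g x + g' x * f x) (at x)"
    by (intro allI DERIV_mult d[rule_format])
  ultimately show ?case by (intro exI conjI)
qed

lemma trig_deriv:
  assumes "trig f"
  shows "(f has_real_derivative deriv f x) (at x)" "trig (deriv f)"
proof -
  obtain f' where f': "trig f'" "\<forall>x. (f has_real_derivative f' x) (at x)"
    using trig_has_deriv[OF assms] by (elim exE conjE)
  have "deriv f = f'"
    by (rule ext) (rule DERIV_imp_deriv[OF f'(2)[rule_format]])
  then show "(f has_real_derivative deriv f x) (at x)" "trig (deriv f)"
    using f' by simp_all
qed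

lemma trig_higher_deriv: "trig f \<Longrightarrow> trig ((deriv ^^ n) f)"
  by (induction n) (simp_all add: trig_deriv(2))

lemma trig_smooth: "trig f \<Longrightarrow> smooth_at p f"
  using smooth_on_tower[of UNIV "\<lambda>n. (deriv ^^ n) f" 0] trig_deriv(1)[OF trig_higher_deriv]
  by (simp add: smooth_on_imp_at)

lemma trig_power: "trig f \<Longrightarrow> trig (\<lambda>x. f x ^ n)"
  by (induction n) (simp_all add: trig.trig_const trig.trig_mult)

lemma trig_scale: "trig f \<Longrightarrow> trig (\<lambda>x. f (l * x))"
proof (induction rule: trig.induct)
  case (trig_sin k)
  show ?case using trig.trig_sin[of "k * l"] by (simp add: mult.assoc)
next
  case (trig_cos k)
  show ?case using trig.trig_cos[of "k * l"] by (simp add: mult.assoc)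
qed (auto intro: trig.intros)

lemma higher_deriv_add:
  assumes "trig f" "trig g"
  shows "(deriv ^^ k) (\<lambda>x. f x + g x) = (\<lambda>x. (deriv ^^ k) f x + (deriv ^^ k) g x)"
proof (induction k)
  case (Suc k)
  show ?case
  proof
    fix x
    have "((\<lambda>x. (deriv ^^ k) f x + (deriv ^^ k) g x) has_real_derivative
        (deriv ^^ Suc k) f x + (deriv ^^ Suc k) g x) (at x)"
      using DERIV_add[OF trig_deriv(1)[OF trig_higher_deriv[OF assms(1)]]
          trig_deriv(1)[OF trig_higher_deriv[OF assms(2)]]] by simp
    from DERIV_imp_deriv[OF this]
    show "(deriv ^^ Suc k) (\<lambda>x. f x + g x) x = (deriv ^^ Suc k) f x + (deriv ^^ Suc k) g x"
      using Suc by simp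
  qed
qed simp

lemma higher_deriv_scale:
  assumes "trig f"
  shows "(deriv ^^ k) (\<lambda>x. b * f (l * x)) = (\<lambda>x. b * l ^ k * (deriv ^^ k) f (l * x))"
proof (induction k)
  case (Suc k)
  show ?case
  proof
    fix x
    have "((\<lambda>x. (deriv ^^ k) f (l * x)) has_real_derivative deriv ((deriv ^^ k) f) (l * x) * l) (at x)"
      by (rule DERIV_chain2[OF trig_deriv(1)[OF trig_higher_deriv[OF assms]]])
        (auto intro!: derivative_eq_intros)
    from DERIV_imp_deriv[OF DERIV_cmult[OF this, of "b * l ^ k"]]
    show "(deriv ^^ Suc k) (\<lambda>x. b * f (l * x)) x = b * l ^ Suc k * (deriv ^^ Suc k) f (l * x)"
      using Suc by (simp add: mult_ac)
  qed
qed simp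

text \<open>With sin t = t s(t) and s(0) = 1, the n-th power of sin is t^n plus terms of order n +
  1.\<close>

lemma higher_deriv_sin_power:
  shows "k < n \<Longrightarrow> (deriv ^^ k) (\<lambda>x::real. sin x ^ n) 0 = 0"
    and "(deriv ^^ n) (\<lambda>x::real. sin x ^ n) 0 \<noteq> 0"
proof -
  have sin: "smooth_at 0 (\<lambda>x::real. sin x)"
    using trig_smooth[OF trig_sin[of 1]] by simp
  obtain s where s: "smooth_at 0 s" "\<forall>\<^sub>F t in nhds 0. sin t = sin 0 + t * s (t::real)"
    by (rule Hadamard_division[OF sin])
  have "smooth_at 0 (\<lambda>x. s x ^ n)" by (rule smooth_at_power[OF s(1)])
  then obtain h where h: "smooth_at 0 h" "\<forall>\<^sub>F t in nhds 0. s t ^ n = s 0 ^ n + t * h t"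
    by (rule Hadamard_division)
  obtain h1 where h1: "smooth_at 0 h1" "\<forall>\<^sub>F t in nhds 0. s t = s 0 + t * h1 t"
    by (rule Hadamard_division[OF s(1)])
  \<comment> \<open>One more Hadamard step exhibits \<open>s 0\<close> as the linear Taylor
    coefficient of sin, hence as its derivative at 0.\<close>
  have "\<forall>\<^sub>F t in nhds 0. sin t = (\<Sum>j<2. (if j = 1 then s 0 else 0) * t ^ j) + t ^ 2 * h1 (t::real)"
    using s(2) h1(2)
    by eventually_elim (simp add: numeral_2_eq_2 algebra_simps)
  from higher_deriv_of_expansion[OF h1(1) this, of 1]
  have "deriv sin (0::real) = s 0" by simp
  moreover have "deriv sin (0::real) = 1"
    using DERIV_imp_deriv[OF DERIV_sin[of "0::real"]] by simp
  ultimately have s0: "s 0 = 1" by simp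
  have ev: "\<forall>\<^sub>F t in nhds 0. sin t ^ n
      = (\<Sum>j<Suc n. (if j = n then s 0 ^ n else 0) * t ^ j) + t ^ Suc n * h (t::real)"
    using s(2) h(2)
  proof eventually_elim
    case (elim t)
    have "(\<Sum>j<n. (if j = n then s 0 ^ n else 0) * t ^ j) = 0"
      by (rule sum.neutral) auto
    moreover have "sin t ^ n = t ^ n * s t ^ n"
      using elim(1) by (simp add: power_mult_distrib)
    ultimately show ?case
      by (simp only: elim(2) sum.lessThan_Suc) (simp add: algebra_simps)
  qed
  show "(deriv ^^ k) (\<lambda>x::real. sin x ^ n) 0 = 0" if "k < n"
    using higher_deriv_of_expansion[OF h(1) ev, of k] that by simp
  show "(deriv ^^ n) (\<lambda>x::real. sin x ^ n) 0 \<noteq> 0"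
    using higher_deriv_of_expansion[OF h(1) ev, of n] s0 by simp
qed

lemma trig_adjust_higher_deriv:
  assumes S: "trig S"
  obtains T where "trig T" "\<And>k. k < n \<Longrightarrow> (deriv ^^ k) T 0 = (deriv ^^ k) S 0" "(deriv ^^ n) T 0 = c"
    "\<And>k x. k < n \<Longrightarrow> \<bar>(deriv ^^ k) T x - (deriv ^^ k) S x\<bar> \<le> (1/2) ^ n"
proof -
  define w where "w = (\<lambda>x::real. sin x ^ n)"
  have w: "trig w"
    unfolding w_def using trig_power[OF trig_sin[of 1]] by simp
  have wn: "(deriv ^^ n) w 0 \<noteq> 0"
    unfolding w_def by (rule higher_deriv_sin_power(2))
  define b where "b = (c - (deriv ^^ n) S 0) / (deriv ^^ n) w 0"
  have "\<forall>k. \<exists>K. \<forall>x. \<bar>(deriv ^^ k) w x\<bar> \<le> K"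
    using trig_bounded[OF trig_higher_deriv[OF w]] by blast
  then obtain K where K: "\<And>k x. \<bar>(deriv ^^ k) w x\<bar> \<le> K k" by metis
  have K0: "0 \<le> K k" for k using K[of k 0] by linarith
  \<comment> \<open>In the k-th derivative of \<open>u\<close> below, scaling contributes l^k / l^n,
    at most 1 / l for k < n. The product in \<open>l\<close> absorbs all the bounds and the required
    2^n; the summand 1 guarantees \<open>1 \<le> l\<close>, which makes powers of \<open>l\<close>
    monotone.\<close>
  define l where "l = 1 + \<bar>b\<bar> * (\<Sum>k<n. K k) * 2 ^ n"
  have l: "1 \<le> l" unfolding l_def by (simp add: sum_nonneg K0)
  define u where "u = (\<lambda>x. (b / l ^ n) * w (l * x))"
  have u: "trig u"
    unfolding u_def by (intro trig_mult trig_const trig_scale w)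
  have Du: "(deriv ^^ k) u x = b * (l ^ k / l ^ n) * (deriv ^^ k) w (l * x)" for k x
    unfolding u_def higher_deriv_scale[OF w] by simp
  have T: "(deriv ^^ k) (\<lambda>x. S x + u x) x = (deriv ^^ k) S x + (deriv ^^ k) u x" for k x
    by (simp add: higher_deriv_add[OF S u])
  show ?thesis
  proof (rule that[of "\<lambda>x. S x + u x"])
    show "trig (\<lambda>x. S x + u x)" by (intro trig_add S u)
    show "(deriv ^^ k) (\<lambda>x. S x + u x) 0 = (deriv ^^ k) S 0" if "k < n" for k
      using higher_deriv_sin_power(1)[OF that] by (simp add: T Du w_def)
    show "(deriv ^^ n) (\<lambda>x. S x + u x) 0 = c"
      using wn l by (simp add: T Du b_def)
    show "\<bar>(deriv ^^ k) (\<lambda>x. S x + u x) x - (deriv ^^ k) S x\<bar> \<le> (1/2) ^ n" if "k < n" for k x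
    proof -
      have "l * l ^ k \<le> l ^ n"
        using power_increasing[of "Suc k" n l] that l by simp
      then have lk: "l ^ k / l ^ n \<le> 1 / l"
        using l by (simp add: divide_simps mult.commute)
      have Kk: "\<bar>(deriv ^^ k) w (l * x)\<bar> \<le> (\<Sum>k<n. K k)"
        using K[of k "l * x"] member_le_sum[of k "{..<n}" K] that K0 by simp
      have "\<bar>(deriv ^^ k) u x\<bar> = \<bar>b\<bar> * (l ^ k / l ^ n) * \<bar>(deriv ^^ k) w (l * x)\<bar>"
        unfolding Du abs_mult using l by simp
      also have "\<dots> \<le> \<bar>b\<bar> * (1 / l) * (\<Sum>k<n. K k)"
        by (intro mult_mono Kk lk mult_left_mono) (use l in auto)
      also have "\<dots> \<le> (1/2) ^ n"
      proof -
        have "\<bar>b\<bar> * (\<Sum>k<n. K k) * 2 ^ n \<le> l" by (simp add: l_def)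
        then show ?thesis
          using l by (simp add: divide_simps power_divide mult_ac)
      qed
      finally show ?thesis by (simp add: T)
    qed
  qed
qed

text \<open>The n-th correction sets the n-th derivative at 0, preserves the lower ones there, and
  moves them by at most 2^(-n) everywhere. For each fixed order the series of corrections therefore
  converges uniformly and can be differentiated termwise.\<close>

theorem Borel_lemma:
  fixes c :: "nat \<Rightarrow> real"
  obtains E where "smooth_at 0 E" "\<And>k. (deriv ^^ k) E 0 = c k"
proof -
  \<comment> \<open>The invariant at stage n concerns only orders below n, so the starting function
    is unconstrained.\<close>
  have "\<exists>f. \<forall>n. (trig (f n) \<and> (\<forall>k<n. (deriv ^^ k) (f n) 0 = c k)) \<and>
      (\<forall>k<n. \<forall>x. \<bar>(deriv ^^ k) (f (Suc n)) x - (deriv ^^ k) (f n) x\<bar> \<le> (1/2) ^ n)"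
  proof (rule dependent_nat_choice)
    show "\<exists>S. trig S \<and> (\<forall>k<0. (deriv ^^ k) S 0 = c k)"
      by (rule exI[of _ "\<lambda>x. 0"]) (simp add: trig_const)
  next
    fix S n assume S: "trig S \<and> (\<forall>k<n. (deriv ^^ k) S 0 = c k)"
    obtain T where T: "trig T" "\<And>k. k < n \<Longrightarrow> (deriv ^^ k) T 0 = (deriv ^^ k) S 0"
      "(deriv ^^ n) T 0 = c n"
      "\<And>k x. k < n \<Longrightarrow> \<bar>(deriv ^^ k) T x - (deriv ^^ k) S x\<bar> \<le> (1/2) ^ n"
      using trig_adjust_higher_deriv[of S n "c n"] S by metis
    have "\<forall>k<Suc n. (deriv ^^ k) T 0 = c k"
      using T(2,3) S by (auto simp: less_Suc_eq)
    then show "\<exists>T. (trig T \<and> (\<forall>k<Suc n. (deriv ^^ k) T 0 = c k)) \<and>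
        (\<forall>k<n. \<forall>x. \<bar>(deriv ^^ k) T x - (deriv ^^ k) S x\<bar> \<le> (1/2) ^ n)"
      using T(1,4) by (intro exI[of _ T] conjI allI impI) simp_all
  qed
  then obtain f where f: "\<And>n. trig (f n)" "\<And>n k. k < n \<Longrightarrow> (deriv ^^ k) (f n) 0 = c k"
    "\<And>n k x. k < n \<Longrightarrow> \<bar>(deriv ^^ k) (f (Suc n)) x - (deriv ^^ k) (f n) x\<bar> \<le> (1/2) ^ n"
    by metis
  define U where "U k n x = (deriv ^^ k) (f (Suc n)) x - (deriv ^^ k) (f n) x" for k n x
  have U: "(U k n has_real_derivative U (Suc k) n x) (at x)" for k n x
    unfolding U_def
    using DERIV_diff[OF trig_deriv(1)[OF trig_higher_deriv[OF f(1)]]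
        trig_deriv(1)[OF trig_higher_deriv[OF f(1)]]] by simp
  \<comment> \<open>Order k is controlled only from stage k + 1 on, so the M-test is used in its
    eventual form.\<close>
  have ev: "\<forall>\<^sub>F n in sequentially. \<forall>x\<in>UNIV. norm (U k n x) \<le> (1/2) ^ n" for k
    using eventually_gt_at_top[of k] by eventually_elim (simp add: U_def f(3))
  have unif: "uniform_limit UNIV (\<lambda>n x. \<Sum>i<n. U k i x) (\<lambda>x. suminf (\<lambda>i. U k i x)) sequentially" for k
    by (rule Weierstrass_m_test_ev[OF ev]) (simp add: summable_geometric)
  define L where "L k x = (deriv ^^ k) (f 0) x + (\<Sum>i. U k i x)" for k x
  \<comment> \<open>At 0 the partial sums telescope and are stationary once n > k. This gives the
    prescribed value and also the one point of convergence required for termwise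
    differentiation.\<close>
  have sums0: "(\<lambda>i. U k i 0) sums (c k - (deriv ^^ k) (f 0) 0)" for k
    unfolding sums_def
  proof (rule tendsto_eventually)
    show "\<forall>\<^sub>F n in sequentially. (\<Sum>i<n. U k i 0) = c k - (deriv ^^ k) (f 0) 0"
      using eventually_gt_at_top[of k]
    proof eventually_elim
      case (elim n)
      have "(\<Sum>i<n. U k i 0) = (deriv ^^ k) (f n) 0 - (deriv ^^ k) (f 0) 0"
        unfolding U_def by (rule sum_lessThan_telescope)
      then show ?case using f(2)[OF elim] by simp
    qed
  qed
  have L: "(L k has_real_derivative L (Suc k) x) (at x)" for k x
  proof -
    have "\<exists>g. \<forall>x\<in>UNIV. (\<lambda>i. U k i x) sums g x \<and>
        (g has_real_derivative (\<Sum>i. U (Suc k) i x)) (at x within UNIV)"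
      by (rule has_field_derivative_series[where f="U k" and f'="U (Suc k)" and ?x0.0=0])
        (simp_all add: U unif sums_summable[OF sums0])
    then obtain g where g: "\<And>x. (\<lambda>i. U k i x) sums g x"
      "\<And>x. (g has_real_derivative (\<Sum>i. U (Suc k) i x)) (at x)" by auto
    have "g = (\<lambda>x. \<Sum>i. U k i x)" using sums_unique[OF g(1)] by (rule ext)
    then have "((\<lambda>x. \<Sum>i. U k i x) has_real_derivative (\<Sum>i. U (Suc k) i x)) (at x)"
      using g(2) by simp
    from DERIV_add[OF trig_deriv(1)[OF trig_higher_deriv[OF f(1)]] this]
    show ?thesis unfolding L_def[abs_def] by simp
  qed
  have DL: "(deriv ^^ k) (L 0) = L k" for k
  proof (induction k)
    case (Suc k)
    then show ?case by (auto intro!: ext DERIV_imp_deriv L)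
  qed simp
  show ?thesis
  proof (rule that[of "L 0"])
    show "smooth_at 0 (L 0)"
      using smooth_on_tower[of UNIV L 0] L by (simp add: smooth_on_imp_at)
    show "(deriv ^^ k) (L 0) 0 = c k" for k
      unfolding DL L_def using sums_unique[OF sums0, of k] by simp
  qed
qed

subsection \<open>Smooth functions as polynomials in \<open>t\<close> with coefficients in \<open>t ^ 4\<close>\<close>

lemma eventually_nhds_compose:
  assumes "isCont \<phi> p" "\<forall>\<^sub>F y in nhds (\<phi> p). P y"
  shows "\<forall>\<^sub>F x in nhds p. P (\<phi> x)"
proof -
  have "filterlim \<phi> (nhds (\<phi> p)) (nhds p)"
    using assms(1) by (simp add: isCont_def tendsto_at_iff_tendsto_nhds)
  then show ?thesis
    using assms(2) by (simp add: filterlim_iff)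
qed

text \<open>Divisibility by every power with a smooth quotient, rather than vanishing of all
  derivatives at 0: in this form division by powers of t and differentiation preserve flatness by
  short computations.\<close>

definition flat :: "(real \<Rightarrow> real) \<Rightarrow> bool" where
  "flat f \<longleftrightarrow> (\<forall>M. \<exists>g. smooth_at 0 g \<and> (\<forall>\<^sub>F t in nhds 0. f t = t ^ M * g t))"

lemma flatE:
  assumes "flat f"
  obtains g where "smooth_at 0 g" "\<forall>\<^sub>F t in nhds 0. f t = t ^ M * g t"
  using assms[unfolded flat_def, rule_format, of M] by (elim exE conjE)

lemma flat_smooth:
  assumes "flat f" shows "smooth_at 0 f"
proof -
  obtain g where g: "smooth_at 0 g" "\<forall>\<^sub>F t in nhds 0. f t = t ^ 0 * g t"
    by (rule flatE[OF assms])
  have "\<forall>\<^sub>F t in nhds 0. g t = f t" using g(2) by eventually_elim simp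
  then show ?thesis by (rule smooth_at_cong[OF g(1)])
qed

lemma flat_zero:
  assumes "flat f" shows "f 0 = 0"
proof -
  obtain g where g: "smooth_at 0 g" "\<forall>\<^sub>F t in nhds 0. f t = t ^ 1 * g t"
    by (rule flatE[OF assms])
  then show ?thesis using eventually_nhds_x_imp_x[OF g(2)] by simp
qed

lemma flat_add:
  assumes "flat f" "flat g" shows "flat (\<lambda>t. f t + g t)"
  unfolding flat_def
proof
  fix M
  obtain h k where h: "smooth_at 0 h" "\<forall>\<^sub>F t in nhds 0. f t = t ^ M * h t"
    and k: "smooth_at 0 k" "\<forall>\<^sub>F t in nhds 0. g t = t ^ M * k t"
    by (rule flatE[OF assms(1), of M], rule flatE[OF assms(2), of M])
  have "\<forall>\<^sub>F t in nhds 0. f t + g t = t ^ M * (h t + k t)"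
    using h(2) k(2) by eventually_elim (simp add: algebra_simps)
  then show "\<exists>k. smooth_at 0 k \<and> (\<forall>\<^sub>F t in nhds 0. f t + g t = t ^ M * k t)"
    using smooth_at_add[OF h(1) k(1)] by (intro exI conjI)
qed

lemma flat_mult:
  assumes "smooth_at 0 f" "flat g" shows "flat (\<lambda>t. f t * g t)"
  unfolding flat_def
proof
  fix M
  obtain h where h: "smooth_at 0 h" "\<forall>\<^sub>F t in nhds 0. g t = t ^ M * h t"
    by (rule flatE[OF assms(2)])
  have "\<forall>\<^sub>F t in nhds 0. f t * g t = t ^ M * (f t * h t)"
    using h(2) by eventually_elim simp
  then show "\<exists>k. smooth_at 0 k \<and> (\<forall>\<^sub>F t in nhds 0. f t * g t = t ^ M * k t)"
    using smooth_at_mult[OF assms(1) h(1)] by (intro exI conjI)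
qed

lemma flat_reflect:
  assumes "flat f" shows "flat (\<lambda>t. f (- t))"
  unfolding flat_def
proof
  fix M
  obtain h where h: "smooth_at 0 h" "\<forall>\<^sub>F t in nhds 0. f t = t ^ M * h t"
    by (rule flatE[OF assms])
  have "\<forall>\<^sub>F t in nhds 0. f (- t) = (- t) ^ M * h (- t)"
    by (rule eventually_nhds_compose[where \<phi>="\<lambda>t. - t"]) (use h(2) in simp_all)
  then have "\<forall>\<^sub>F t in nhds 0. f (- t) = t ^ M * ((- 1) ^ M * h (- t))"
  proof eventually_elim
    case (elim t)
    show ?case unfolding elim power_minus[of t] by simp
  qed
  moreover have "smooth_at 0 (\<lambda>t. (- 1) ^ M * h (- t))"
    by (intro smooth_at_mult smooth_at_const smooth_at_compose[where f="\<lambda>t. - t" and g=h])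
      (use h(1) in \<open>simp_all add: smooth_at_minus\<close>)
  ultimately show "\<exists>k. smooth_at 0 k \<and> (\<forall>\<^sub>F t in nhds 0. f (- t) = t ^ M * k t)"
    by (intro exI conjI)
qed

lemma flat_deriv:
  assumes "flat f" shows "flat (deriv f)"
  unfolding flat_def
proof
  fix M
  obtain h where h: "smooth_at 0 h" "\<forall>\<^sub>F t in nhds 0. f t = t ^ Suc M * h t"
    by (rule flatE[OF assms])
  let ?k = "\<lambda>t. real (Suc M) * h t + t * deriv h t"
  have "\<forall>\<^sub>F t in nhds 0. \<forall>\<^sub>F s in nhds t. f s = s ^ Suc M * h s"
    using h(2) by (simp add: eventually_eventually)
  then have "\<forall>\<^sub>F t in nhds 0. deriv f t = t ^ M * ?k t"
    using smooth_at_eventually[OF h(1)]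
  proof eventually_elim
    case (elim t)
    have "((\<lambda>s. s ^ Suc M * h s) has_real_derivative t ^ M * ?k t) (at t)"
      by (rule derivative_eq_intros smooth_at_deriv(1)[OF elim(2)] refl | simp add: algebra_simps)+
    then show ?case
      unfolding deriv_cong_ev[OF elim(1) refl] by (rule DERIV_imp_deriv)
  qed
  moreover have "smooth_at 0 ?k"
    by (intro smooth_at_intros h(1) smooth_at_deriv(2))
  ultimately show "\<exists>k. smooth_at 0 k \<and> (\<forall>\<^sub>F t in nhds 0. deriv f t = t ^ M * k t)"
    by (intro exI conjI)
qed

lemma flat_divide_power:
  assumes "flat f" shows "flat (\<lambda>t. if t = 0 then 0 else f t / t ^ m)"
  unfolding flat_def
proof
  fix M
  obtain h where h: "smooth_at 0 h" "\<forall>\<^sub>F t in nhds 0. f t = t ^ (Suc M + m) * h t"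
    by (rule flatE[OF assms])
  have "\<forall>\<^sub>F t in nhds 0. (if t = 0 then 0 else f t / t ^ m) = t ^ M * (t * h t)"
    using h(2) by eventually_elim (simp add: power_add)
  moreover have "smooth_at 0 (\<lambda>t. t * h t)"
    by (intro smooth_at_intros h(1))
  ultimately show "\<exists>k. smooth_at 0 k \<and> (\<forall>\<^sub>F t in nhds 0. (if t = 0 then 0 else f t / t ^ m) = t ^ M * k t)"
    by (intro exI conjI)
qed

text \<open>With t the fourth root of x, the x-derivative of f(t) is f'(t) / (4 t^3). This is again
  a flat function of t, since division by t^3 is harmless, so the argument repeats for every order.
  Flatness also makes the extension by 0 to x \<le> 0 fit at the origin.\<close>

lemma flat_root_smooth:
  assumes "flat f"
  shows "smooth_at 0 (\<lambda>x. if x > 0 then f (root 4 x) else 0)"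
proof -
  define G :: "(real \<Rightarrow> real) \<Rightarrow> real \<Rightarrow> real"
    where "G f x = (if x > 0 then f (root 4 x) else 0)" for f x
  obtain r where r: "r > 0" "\<forall>y. dist y 0 < r \<longrightarrow> smooth_at y f"
    using smooth_at_eventually[OF flat_smooth[OF assms]] unfolding eventually_nhds_metric
    by (elim exE conjE)
  define S where "S = {..<r ^ 4}"
  \<comment> \<open>The operator on functions of t that corresponds to d/dx for x = t^4; its
    iterates describe all derivatives of \<open>G f\<close>.\<close>
  define N where "N f = (\<lambda>t. 1/4 * (if t = 0 then 0 else deriv f t / t ^ 3))" for f :: "real \<Rightarrow> real"
  have N: "flat (N f)" "\<And>x. \<bar>x\<bar> < r \<Longrightarrow> smooth_at x (N f)"
    if f: "flat f" "\<And>x. \<bar>x\<bar> < r \<Longrightarrow> smooth_at x f" for f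
  proof -
    show fl: "flat (N f)"
      unfolding N_def by (intro flat_mult smooth_at_const flat_divide_power flat_deriv f(1))
    show "smooth_at x (N f)" if "\<bar>x\<bar> < r" for x
    proof (cases "x = 0")
      case True
      then show ?thesis using flat_smooth[OF fl] by simp
    next
      case False
      have "smooth_at x (\<lambda>t. 1/4 * (deriv f t / t ^ 3))"
        using False by (intro smooth_at_mult smooth_at_const smooth_at_divide smooth_at_power
            smooth_at_ident smooth_at_deriv(2) f(2)[OF that]) simp
      moreover have "\<forall>\<^sub>F t in nhds x. 1/4 * (deriv f t / t ^ 3) = N f t"
        using t1_space_nhds[OF False] by eventually_elim (simp add: N_def)
      ultimately show ?thesis by (rule smooth_at_cong)
    qed
  qed
  have der: "(G f has_real_derivative G (N f) x) (at x)"
    if f: "flat f" "\<And>x. \<bar>x\<bar> < r \<Longrightarrow> smooth_at x f" and x: "x < r ^ 4" for f x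
  proof -
    consider "x < 0" | "x > 0" | "x = 0" by linarith
    then show ?thesis
    proof cases
      case 1
      have "((\<lambda>x. 0) has_real_derivative G (N f) x) (at x)"
        using 1 by (simp add: G_def)
      then show ?thesis
        by (rule has_field_derivative_transform_within_open[where S="{..<0}"])
          (use 1 in \<open>auto simp: G_def\<close>)
    next
      case 2
      let ?t = "root 4 x"
      have t: "?t > 0" using 2 by simp
      have "?t < root 4 (r ^ 4)" using x by (intro real_root_less_mono) simp_all
      also have "\<dots> = r" using r(1) by (intro real_root_power_cancel) simp_all
      finally have tr: "\<bar>?t\<bar> < r" using t by simp
      have "((\<lambda>x. f (root 4 x)) has_real_derivative deriv f ?t * inverse (real 4 * ?t ^ (4 - Suc 0))) (at x)"
        by (rule DERIV_chain2[OF smooth_at_deriv(1)[OF f(2)[OF tr]] DERIV_real_root]) (use 2 in simp_all)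
      moreover have "deriv f ?t * inverse (real 4 * ?t ^ (4 - Suc 0)) = G (N f) x"
      proof -
        have "G (N f) x = 1/4 * (deriv f ?t / ?t ^ 3)"
          using 2 t by (simp only: G_def N_def if_True if_False less_irrefl simp_thms) simp
        then show ?thesis by (simp only: divide_inverse) simp
      qed
      ultimately have "((\<lambda>x. f (root 4 x)) has_real_derivative G (N f) x) (at x)"
        by simp
      then show ?thesis
        by (rule has_field_derivative_transform_within_open[where S="{0<..}"])
          (use 2 in \<open>auto simp: G_def\<close>)
    next
      case 3
      \<comment> \<open>Order 8 is twice 4: it bounds f at the fourth root of x by a multiple of
        x^2, so the difference quotient at 0 tends to 0.\<close>
      obtain g where g: "smooth_at 0 g" "\<forall>\<^sub>F t in nhds 0. f t = t ^ 8 * g t"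
        by (rule flatE[OF f(1)])
      have "\<forall>\<^sub>F t in nhds 0. \<bar>g t\<bar> < \<bar>g 0\<bar> + 1"
      proof -
        have "isCont (\<lambda>t. \<bar>g t\<bar>) 0"
          using smooth_at_continuous[OF g(1)] by (rule continuous_rabs)
        moreover have "\<forall>\<^sub>F y in nhds \<bar>g 0\<bar>. y < \<bar>g 0\<bar> + 1"
          using eventually_nhds_in_open[of "{..<\<bar>g 0\<bar> + 1}" "\<bar>g 0\<bar>"] by simp
        ultimately show ?thesis
          by (rule eventually_nhds_compose)
      qed
      then have "\<forall>\<^sub>F t in nhds 0. \<bar>f t\<bar> \<le> t ^ 8 * (\<bar>g 0\<bar> + 1)"
        using g(2) by eventually_elim (auto simp: abs_mult intro!: mult_left_mono)
      then have "\<forall>\<^sub>F x in nhds 0. \<bar>f (root 4 x)\<bar> \<le> root 4 x ^ 8 * (\<bar>g 0\<bar> + 1)"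
        by (intro eventually_nhds_compose[where \<phi>="root 4"]) (simp_all add: isCont_real_root)
      then have bound: "\<forall>\<^sub>F x in nhds 0. \<bar>G f x / x\<bar> \<le> \<bar>x\<bar> * (\<bar>g 0\<bar> + 1)"
      proof eventually_elim
        case (elim x)
        show ?case
        proof (cases "x > 0")
          case True
          have "root 4 x ^ 8 = (root 4 x ^ 4) ^ 2" by simp
          also have "\<dots> = x ^ 2" using True by (simp add: real_root_pow_pos)
          finally have "\<bar>f (root 4 x)\<bar> \<le> x * (x * (\<bar>g 0\<bar> + 1))"
            using elim by (simp add: power2_eq_square mult.assoc)
          then show ?thesis
            using True by (simp add: G_def divide_simps mult_ac)
        next
          case False
          have "0 \<le> \<bar>x\<bar> * (\<bar>g 0\<bar> + 1)" by (intro mult_nonneg_nonneg) simp_all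
          with False show ?thesis by (simp only: G_def if_False div_0 abs_zero)
        qed
      qed
      have "((\<lambda>x. G f x / x) \<longlongrightarrow> 0) (at 0)"
      proof (rule Lim_null_comparison)
        show "\<forall>\<^sub>F x in at 0. norm (G f x / x) \<le> \<bar>x\<bar> * (\<bar>g 0\<bar> + 1)"
          using bound unfolding eventually_at_filter by eventually_elim simp
        show "((\<lambda>x. \<bar>x\<bar> * (\<bar>g 0\<bar> + 1)) \<longlongrightarrow> 0) (at (0::real))"
          by (auto intro!: tendsto_eq_intros)
      qed
      then show ?thesis
        using 3 by (simp add: has_field_derivative_iff G_def)
    qed
  qed
  have Ck: "Ck_on n S (G f)" if "flat f" "\<And>x. \<bar>x\<bar> < r \<Longrightarrow> smooth_at x f" for n f
    using that
  proof (induction n arbitrary: f)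
    case 0
    have "isCont (G f) x" if "x \<in> S" for x
      by (rule DERIV_isCont[OF der[OF 0]]) (use that in \<open>simp_all add: S_def\<close>)
    then show ?case
      by (simp add: continuous_at_imp_continuous_on)
  next
    case (Suc n)
    show ?case
    proof (rule Ck_on_SucI)
      show "open S" by (simp add: S_def)
      show "(G f has_derivative (*) (G (N f) x)) (at x)" if "x \<in> S" for x
        using der[OF Suc.prems, of x] that by (simp add: has_field_derivative_def S_def)
      show "Ck_on n S (\<lambda>x. G (N f) x * i)" if "i \<in> Basis" for i
        using Suc.IH[OF N[OF Suc.prems]] that by simp
    qed
  qed
  have "Ck_on n S (G f)" for n
    by (rule Ck[OF assms]) (use r(2) in simp)
  moreover have "0 \<in> S" "open S" using r(1) by (simp_all add: S_def)
  ultimately have "smooth_at 0 (G f)"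
    by (intro smooth_atI[of _ S])
  then show ?thesis by (simp add: G_def[abs_def])
qed

text \<open>The fourth root of t^4 is the absolute value of t; evenness removes the absolute
  value.\<close>

lemma even_flat_factors:
  assumes "flat f" "\<And>t. f (- t) = f t"
  obtains g where "smooth_at 0 g" "\<And>t. f t = g (t ^ 4)"
proof (rule that[OF flat_root_smooth[OF assms(1)]])
  fix t :: real
  show "f t = (if 0 < t ^ 4 then f (root 4 (t ^ 4)) else 0)"
  proof (cases "t = 0")
    case True
    then show ?thesis by (simp add: flat_zero[OF assms(1)])
  next
    case False
    have "root 4 (t ^ 4) = root 4 (\<bar>t\<bar> ^ 4)" by simp
    also have "\<dots> = \<bar>t\<bar>" by (rule real_root_power_cancel) simp_all
    finally show ?thesis
      using False assms(2)[of t] by (auto simp: abs_if zero_less_power_eq)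
  qed
qed

text \<open>\<open>e\<close> is the even part and \<open>d\<close> the odd part divided by t, both
  flat and even.\<close>

lemma flat_factors:
  assumes "flat f"
  obtains g h where "smooth_at 0 g" "smooth_at 0 h" "\<forall>t. f t = g (t ^ 4) + t * h (t ^ 4)"
proof -
  define e where "e = (\<lambda>t. 1/2 * (f t + f (- t)))"
  define d where "d = (\<lambda>t. if t = 0 then 0 else (1/2 * (f t + (- 1) * f (- t))) / t ^ 1)"
  have "flat e" "flat d"
    unfolding e_def d_def
    by (intro flat_mult flat_add flat_divide_power flat_reflect assms smooth_at_const)+
  moreover have "e (- t) = e t" "d (- t) = d t" for t
    by (auto simp: e_def d_def divide_simps)
  ultimately obtain g h where g: "smooth_at 0 g" "\<And>t. e t = g (t ^ 4)"
    and h: "smooth_at 0 h" "\<And>t. d t = h (t ^ 4)"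
    using even_flat_factors[of e] even_flat_factors[of d] by metis
  have "f t = e t + t * d t" for t
    by (cases "t = 0") (simp_all add: e_def d_def flat_zero[OF assms] field_simps)
  then show ?thesis using that[OF g(1) h(1)] g(2) h(2) by simp
qed

lemma sum_mod_4:
  fixes t :: real
  shows "(\<Sum>j<4 * N. c j * t ^ j) = (\<Sum>i<N. c (4 * i) * (t ^ 4) ^ i)
    + t * (\<Sum>i<N. c (4 * i + 1) * (t ^ 4) ^ i) + t ^ 2 * (\<Sum>i<N. c (4 * i + 2) * (t ^ 4) ^ i)
    + t ^ 3 * (\<Sum>i<N. c (4 * i + 3) * (t ^ 4) ^ i)"
proof (induction N)
  case (Suc N)
  have e: "4 * Suc N = Suc (Suc (Suc (Suc (4 * N))))" by simp
  have idx: "4 * N + 1 = Suc (4 * N)" "4 * N + 2 = Suc (Suc (4 * N))" "4 * N + 3 = Suc (Suc (Suc (4 * N)))"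
    by simp_all
  have "(\<Sum>j<4 * Suc N. c j * t ^ j) = (\<Sum>j<4 * N. c j * t ^ j) + c (4 * N) * (t ^ 4) ^ N
      + c (4 * N + 1) * (t * (t ^ 4) ^ N) + c (4 * N + 2) * (t ^ 2 * (t ^ 4) ^ N)
      + c (4 * N + 3) * (t ^ 3 * (t ^ 4) ^ N)"
    unfolding e sum.lessThan_Suc idx power_Suc power_mult power2_eq_square power3_eq_cube
    by (simp only: mult.assoc)
  then show ?case
    unfolding Suc sum.lessThan_Suc by (simp add: distrib_left mult_ac)
qed simp

text \<open>Sorting the Taylor series by exponents modulo 4 gives four formal series in t^4, which
  Borel's lemma realises as \<open>E b\<close>. What remains is flat, and its even and odd parts are
  absorbed into the terms for residues 0 and 1.\<close>

theorem smooth_split_mod_4: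
  fixes f :: "real \<Rightarrow> real"
  assumes "smooth_at 0 f"
  obtains g0 g1 g2 g3 where "smooth_at 0 g0" "smooth_at 0 g1" "smooth_at 0 g2" "smooth_at 0 g3"
    "\<forall>\<^sub>F t in nhds 0. f t = g0 (t ^ 4) + t * g1 (t ^ 4) + t ^ 2 * g2 (t ^ 4) + t ^ 3 * g3 (t ^ 4)"
proof -
  define c where "c j = (deriv ^^ j) f 0 / fact j" for j
  have "\<exists>E. smooth_at 0 E \<and> (\<forall>i. (deriv ^^ i) E 0 = fact i * c (4 * i + b))" for b
    using Borel_lemma[of "\<lambda>i. fact i * c (4 * i + b)"] by metis
  then obtain E where E: "\<And>b. smooth_at 0 (E b)"
    "\<And>b i. (deriv ^^ i) (E b) 0 = fact i * c (4 * i + b)" by metis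
  have pow: "smooth_at 0 (\<lambda>t. h (t ^ 4))" if "smooth_at 0 h" for h :: "real \<Rightarrow> real"
    by (rule smooth_at_compose[where f="\<lambda>t. t ^ 4" and g=h])
      (use that in \<open>simp_all add: smooth_at_power\<close>)
  define R where "R t = f t - (E 0 (t ^ 4) + t * E 1 (t ^ 4) + t ^ 2 * E 2 (t ^ 4) + t ^ 3 * E 3 (t ^ 4))" for t
  have "flat R"
    unfolding flat_def
  proof
    fix M
    obtain g where g: "smooth_at 0 g"
      "\<forall>\<^sub>F t in nhds 0. f t = (\<Sum>j<4 * M. (deriv ^^ j) f 0 / fact j * t ^ j) + t ^ (4 * M) * g t"
      by (rule smooth_Taylor[OF assms])
    have "\<forall>b. \<exists>h. smooth_at 0 h \<and> (\<forall>\<^sub>F x in nhds 0. E b x = (\<Sum>i<M. c (4 * i + b) * x ^ i) + x ^ M * h x)"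
    proof
      fix b
      obtain h where h: "smooth_at 0 h"
        "\<forall>\<^sub>F x in nhds 0. E b x = (\<Sum>i<M. (deriv ^^ i) (E b) 0 / fact i * x ^ i) + x ^ M * h x"
        by (rule smooth_Taylor[OF E(1)])
      then show "\<exists>h. smooth_at 0 h \<and> (\<forall>\<^sub>F x in nhds 0. E b x = (\<Sum>i<M. c (4 * i + b) * x ^ i) + x ^ M * h x)"
        by (intro exI[of _ h]) (simp add: E(2))
    qed
    from choice[OF this] obtain h where "\<forall>b. smooth_at 0 (h b)
        \<and> (\<forall>\<^sub>F x in nhds 0. E b x = (\<Sum>i<M. c (4 * i + b) * x ^ i) + x ^ M * h b x)"
      by (elim exE)
    then have h: "smooth_at 0 (h b)"
      "\<forall>\<^sub>F x in nhds 0. E b x = (\<Sum>i<M. c (4 * i + b) * x ^ i) + x ^ M * h b x" for b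
      by simp_all
    have ev: "\<forall>\<^sub>F t in nhds 0. E b (t ^ 4) = (\<Sum>i<M. c (4 * i + b) * (t ^ 4) ^ i) + (t ^ 4) ^ M * h b (t ^ 4)" for b
      by (rule eventually_nhds_compose[where \<phi>="\<lambda>t. t ^ 4"]) (use h(2)[of b] in simp_all)
    \<comment> \<open>Truncating each \<open>E b\<close> after M terms matches the Taylor polynomial
      of f of length 4 M, so the error has order 4 M; only the factor t^M is needed and t^(3 M) goes
      into the quotient.\<close>
    let ?k = "\<lambda>t. t ^ (3 * M) * (g t - (h 0 (t ^ 4) + t * h 1 (t ^ 4) + t ^ 2 * h 2 (t ^ 4) + t ^ 3 * h 3 (t ^ 4)))"
    have "\<forall>\<^sub>F t in nhds 0. R t = t ^ M * ?k t"
      using g(2) ev[of 0] ev[of 1] ev[of 2] ev[of 3]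
    proof eventually_elim
      case (elim t)
      have t4: "t ^ (4 * M) = (t ^ 4) ^ M" by (simp add: power_mult)
      have t4': "t ^ M * (t ^ (3 * M) * z) = (t ^ 4) ^ M * z" for z
        unfolding mult.assoc[symmetric] power_add[symmetric] power_mult[symmetric] by simp
      show ?case
        unfolding R_def elim sum_mod_4[of "\<lambda>j. (deriv ^^ j) f 0 / fact j"] t4 t4'
        by (simp add: c_def algebra_simps)
    qed
    moreover have "smooth_at 0 ?k"
      by (intro smooth_at_intros g(1) pow h(1))
    ultimately show "\<exists>k. smooth_at 0 k \<and> (\<forall>\<^sub>F t in nhds 0. R t = t ^ M * k t)"
      by (intro exI conjI)
  qed
  then obtain p q where pq: "smooth_at 0 p" "smooth_at 0 q" "\<forall>t. R t = p (t ^ 4) + t * q (t ^ 4)"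
    by (rule flat_factors)
  show ?thesis
  proof (rule that[of "\<lambda>x. E 0 x + p x" "\<lambda>x. E 1 x + q x" "E 2" "E 3"])
    have "f t = (E 0 (t ^ 4) + p (t ^ 4)) + t * (E 1 (t ^ 4) + q (t ^ 4)) + t ^ 2 * E 2 (t ^ 4) + t ^ 3 * E 3 (t ^ 4)" for t
      using spec[OF pq(3), of t] by (simp add: R_def algebra_simps)
    then show "\<forall>\<^sub>F t in nhds 0. f t = (E 0 (t ^ 4) + p (t ^ 4)) + t * (E 1 (t ^ 4) + q (t ^ 4))
        + t ^ 2 * E 2 (t ^ 4) + t ^ 3 * E 3 (t ^ 4)"
      by (rule always_eventually[OF allI])
  qed (intro smooth_at_add E(1) pq(1,2))+
qed

subsection \<open>Functions along the model cusps\<close>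

definition cusp :: "real \<Rightarrow> real \<Rightarrow> real \<times> real" where
  "cusp k t = (t ^ 4, t ^ 5 + k * t ^ 7)"

lemma cusp_0 [simp]: "cusp k 0 = 0"
  by (simp add: cusp_def zero_prod_def)

lemma smooth_at_cusp: "smooth_at t (cusp k)"
  unfolding cusp_def[abs_def] by (intro smooth_at_intros)

lemma smooth_at_cusp_compose:
  fixes H :: "real \<times> real \<Rightarrow> real"
  assumes "smooth_at 0 H"
  shows "smooth_at 0 (\<lambda>t. H (cusp k t))"
  by (rule smooth_at_compose[OF smooth_at_cusp]) (simp add: assms)

lemma linear_plane_expand:
  fixes L :: "real \<times> real \<Rightarrow> real"
  assumes "linear L" shows "L (a, b) = a * L (1,0) + b * L (0,1)"
proof -
  have "L (a *\<^sub>R (1,0) + b *\<^sub>R (0,1)) = a * L (1,0) + b * L (0,1)"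
    unfolding linear_add[OF assms] linear_scale[OF assms] by simp
  then show ?thesis by simp
qed

lemma deriv_along_cusp:
  fixes H :: "real \<times> real \<Rightarrow> real"
  assumes "smooth_at (cusp k t) H"
  shows "((\<lambda>t. H (cusp k t)) has_real_derivative
    frechet_derivative H (at (cusp k t)) (1,0) * (4 * t ^ 3)
    + frechet_derivative H (at (cusp k t)) (0,1) * (5 * t ^ 4 + 7 * k * t ^ 6)) (at t)"
proof -
  let ?L = "frechet_derivative H (at (cusp k t))"
  have H: "(H has_derivative ?L) (at (cusp k t))"
    by (rule smooth_at_differentiable[OF assms])
  have "(cusp k has_derivative (\<lambda>h. ((4 * t ^ 3) * h, (5 * t ^ 4 + 7 * k * t ^ 6) * h))) (at t)"
    unfolding cusp_def[abs_def]
    by (rule has_derivative_Pair)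
      (auto intro!: derivative_eq_intros simp: algebra_simps)
  from has_derivative_compose[OF this H]
  have "((\<lambda>t. H (cusp k t)) has_derivative
      (\<lambda>h. ?L ((4 * t ^ 3) * h, (5 * t ^ 4 + 7 * k * t ^ 6) * h))) (at t)" .
  moreover have "(\<lambda>h. ?L ((4 * t ^ 3) * h, (5 * t ^ 4 + 7 * k * t ^ 6) * h))
      = (*) (?L (1,0) * (4 * t ^ 3) + ?L (0,1) * (5 * t ^ 4 + 7 * k * t ^ 6))"
    by (rule ext, subst linear_plane_expand[OF has_derivative_linear[OF H]])
      (simp only: distrib_left distrib_right mult_ac)
  ultimately show ?thesis by (simp only: has_field_derivative_def)
qed

lemma eventually_smooth_along_cusp:
  fixes H :: "real \<times> real \<Rightarrow> real"
  assumes "smooth_at 0 H"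
  shows "\<forall>\<^sub>F t in nhds 0. smooth_at (cusp k t) H"
  by (rule eventually_nhds_compose[OF smooth_at_continuous[OF smooth_at_cusp]])
    (simp add: smooth_at_eventually[OF assms])

text \<open>The velocity of the cusp is divisible by t^3, hence so is the derivative of
  \<open>H\<close> along it; integrating gives order 4.\<close>

lemma smooth_along_cusp_order_4:
  fixes H :: "real \<times> real \<Rightarrow> real"
  assumes "smooth_at 0 H"
  obtains g where "smooth_at 0 g" "\<forall>\<^sub>F t in nhds 0. H (cusp k t) = H 0 + t ^ 4 * g t"
proof -
  let ?p = "\<lambda>i t. frechet_derivative H (at (cusp k t)) i"
  let ?g = "\<lambda>t. ?p (1,0) t * 4 + ?p (0,1) t * (5 * t + 7 * k * t ^ 3)"
  have p: "smooth_at 0 (?p i)" if "i \<in> Basis" for i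
    by (rule smooth_at_cusp_compose[OF smooth_at_partial[OF assms that]])
  have g: "smooth_at 0 ?g"
    by (intro smooth_at_intros p) (auto simp: Basis_prod_def)
  have "\<forall>\<^sub>F t in nhds 0. deriv (\<lambda>t. H (cusp k t)) t = t ^ 3 * ?g t"
    using eventually_smooth_along_cusp[OF assms, of k]
  proof eventually_elim
    case (elim t)
    show ?case
      unfolding DERIV_imp_deriv[OF deriv_along_cusp[OF elim]]
      by (simp add: algebra_simps eval_nat_numeral)
  qed
  then obtain h where h: "smooth_at 0 h"
    "\<forall>\<^sub>F t in nhds 0. H (cusp k t) = H (cusp k 0) + t ^ Suc 3 * h t"
    by (rule smooth_divisible_if_deriv_divisible[OF smooth_at_cusp_compose[OF assms] g])
  have "\<forall>\<^sub>F t in nhds 0. H (cusp k t) = H 0 + t ^ 4 * h t"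
    using h(2) by (simp only: cusp_0) simp
  with h(1) show ?thesis by (rule that)
qed

text \<open>The previous lemma applied to the partials of \<open>H\<close> shows that they differ
  from their values at 0 by order 4. The chain rule contributes another t^3, so the derivative of
  the error has order 7 and the error itself order 8.\<close>

lemma smooth_along_cusp:
  fixes H :: "real \<times> real \<Rightarrow> real"
  assumes "smooth_at 0 H"
  obtains g where "smooth_at 0 g"
    "\<forall>\<^sub>F t in nhds 0. H (cusp k t) = H 0 + frechet_derivative H (at 0) (1,0) * t ^ 4
      + frechet_derivative H (at 0) (0,1) * (t ^ 5 + k * t ^ 7) + t ^ 8 * g t"
proof -
  let ?p = "\<lambda>z. frechet_derivative H (at z) (1,0)" and ?q = "\<lambda>z. frechet_derivative H (at z) (0,1)"
  have ps: "smooth_at 0 ?p" and qs: "smooth_at 0 ?q"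
    by (rule smooth_at_partial[OF assms], simp add: Basis_prod_def)+
  obtain a where a: "smooth_at 0 a" "\<forall>\<^sub>F t in nhds 0. ?p (cusp k t) = ?p 0 + t ^ 4 * a t"
    by (rule smooth_along_cusp_order_4[OF ps])
  obtain b where b: "smooth_at 0 b" "\<forall>\<^sub>F t in nhds 0. ?q (cusp k t) = ?q 0 + t ^ 4 * b t"
    by (rule smooth_along_cusp_order_4[OF qs])
  define F where "F t = H (cusp k t) - (?p 0 * t ^ 4 + ?q 0 * (t ^ 5 + k * t ^ 7))" for t
  have F: "smooth_at 0 F"
    unfolding F_def[abs_def] by (intro smooth_at_intros smooth_at_cusp_compose[OF assms])
  let ?g = "\<lambda>t. a t * 4 + b t * (5 * t + 7 * k * t ^ 3)"
  have g: "smooth_at 0 ?g"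
    by (intro smooth_at_intros a(1) b(1))
  have "\<forall>\<^sub>F t in nhds 0. deriv F t = t ^ 7 * ?g t"
    using eventually_smooth_along_cusp[OF assms, of k] a(2) b(2)
  proof eventually_elim
    case (elim t)
    have "((\<lambda>t. ?p 0 * t ^ 4 + ?q 0 * (t ^ 5 + k * t ^ 7)) has_real_derivative
        ?p 0 * (4 * t ^ 3) + ?q 0 * (5 * t ^ 4 + 7 * k * t ^ 6)) (at t)"
      by (auto intro!: derivative_eq_intros simp: algebra_simps)
    from DERIV_diff[OF deriv_along_cusp[OF elim(1)] this]
    have "(F has_real_derivative ?p (cusp k t) * (4 * t ^ 3) + ?q (cusp k t) * (5 * t ^ 4 + 7 * k * t ^ 6)
        - (?p 0 * (4 * t ^ 3) + ?q 0 * (5 * t ^ 4 + 7 * k * t ^ 6))) (at t)"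
      unfolding F_def[abs_def] .
    from DERIV_imp_deriv[OF this] show ?case
      unfolding elim(2,3) by (simp add: algebra_simps eval_nat_numeral)
  qed
  then obtain h where h: "smooth_at 0 h" "\<forall>\<^sub>F t in nhds 0. F t = F 0 + t ^ Suc 7 * h t"
    by (rule smooth_divisible_if_deriv_divisible[OF F g])
  have F0: "F 0 = H 0" by (simp add: F_def)
  have "\<forall>\<^sub>F t in nhds 0. H (cusp k t) = H 0 + ?p 0 * t ^ 4 + ?q 0 * (t ^ 5 + k * t ^ 7) + t ^ 8 * h t"
    using h(2)
  proof eventually_elim
    case (elim t)
    have "F t = H 0 + t ^ 8 * h t" using elim by (simp add: F0)
    then show ?case unfolding F_def by linarith
  qed
  with h(1) show ?thesis by (rule that)
qed

text \<open>The exponents 13, 14 and 15 are attained by power series in the two components \<open>x\<close>, \<open>y\<close> of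
  the cusp, because \<open>x\<^sup>2 y = t\<^sup>1\<^sup>3 + k t\<^sup>1\<^sup>5\<close>, \<open>x y\<^sup>2 = (1 + k\<^sup>2 x) t\<^sup>1\<^sup>4 + 2 k x\<^sup>4\<close> and
  \<open>y\<^sup>3 = (1 + 3 k\<^sup>2 x) t\<^sup>1\<^sup>5 + (3 k x + k\<^sup>3 x\<^sup>2) t\<^sup>1\<^sup>3\<close>.\<close>

lemma order_12_factors:
  assumes "smooth_at 0 g"
  obtains h :: "real \<times> real \<Rightarrow> real"
  where "smooth_at 0 h" "\<forall>\<^sub>F t in nhds 0. t ^ 12 * g t = h (cusp k t)"
proof -
  obtain a0 a1 a2 a3 where a: "smooth_at 0 a0" "smooth_at 0 a1" "smooth_at 0 a2" "smooth_at 0 a3"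
    "\<forall>\<^sub>F t in nhds 0. g t = a0 (t ^ 4) + t * a1 (t ^ 4) + t ^ 2 * a2 (t ^ 4) + t ^ 3 * a3 (t ^ 4)"
    by (rule smooth_split_mod_4[OF assms])
  \<comment> \<open>Eliminating t^13 from the relations for x^2 y and y^3 leaves (1 - k^4 x^2) t^15.
    The denominators in \<open>T15\<close> and \<open>T14\<close> equal 1 at the origin, so both are
    smooth germs.\<close>
  define T15 :: "real \<times> real \<Rightarrow> real" where "T15 z = (snd z ^ 3
      - fst z ^ 2 * snd z * (3 * k * fst z + k ^ 3 * fst z ^ 2)) / (1 - k ^ 4 * fst z ^ 2)" for z
  define T14 :: "real \<times> real \<Rightarrow> real"
    where "T14 z = (fst z * snd z ^ 2 - 2 * k * fst z ^ 4) / (1 + k ^ 2 * fst z)" for z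
  define T13 :: "real \<times> real \<Rightarrow> real" where "T13 z = fst z ^ 2 * snd z - k * T15 z" for z
  have T15: "smooth_at 0 T15"
    unfolding T15_def[abs_def] by (intro smooth_at_divide smooth_at_intros) simp
  have T14: "smooth_at 0 T14"
    unfolding T14_def[abs_def] by (intro smooth_at_divide smooth_at_intros) simp
  have T13: "smooth_at 0 T13"
    unfolding T13_def[abs_def] by (intro smooth_at_intros T15)
  define h where "h z = fst z ^ 3 * a0 (fst z) + T13 z * a1 (fst z) + T14 z * a2 (fst z)
      + T15 z * a3 (fst z)" for z
  have fst: "smooth_at 0 (\<lambda>z::real \<times> real. b (fst z))" if "smooth_at 0 b" for b :: "real \<Rightarrow> real"
    by (rule smooth_at_compose[where f=fst and g=b])
      (simp_all add: that smooth_at_bounded_linear[OF bounded_linear_fst])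
  have h: "smooth_at 0 h"
    unfolding h_def[abs_def] by (intro smooth_at_intros T13 T14 T15 fst a(1-4))
  have "smooth_at 0 (\<lambda>t::real. 1 - k ^ 4 * (t ^ 4) ^ 2)" by (intro smooth_at_intros)
  then have "\<forall>\<^sub>F t in nhds 0. 1 - k ^ 4 * (t ^ 4) ^ 2 \<noteq> 0"
    by (rule smooth_at_eventually_nonzero) simp
  then have "\<forall>\<^sub>F t in nhds 0. t ^ 12 * g t = h (cusp k t)"
    using a(5)
  proof eventually_elim
    case (elim t)
    have ne: "1 + k ^ 2 * t ^ 4 \<noteq> 0"
    proof -
      have "k ^ 2 * t ^ 4 \<ge> 0" by simp
      then show ?thesis by linarith
    qed
    have "(t ^ 5 + k * t ^ 7) ^ 3 - (t ^ 4) ^ 2 * (t ^ 5 + k * t ^ 7) * (3 * k * t ^ 4 + k ^ 3 * (t ^ 4) ^ 2)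
        = t ^ 15 * (1 - k ^ 4 * (t ^ 4) ^ 2)" by algebra
    then have 15: "T15 (cusp k t) = t ^ 15"
      using elim(1) by (simp add: T15_def cusp_def)
    have "t ^ 4 * (t ^ 5 + k * t ^ 7) ^ 2 - 2 * k * (t ^ 4) ^ 4 = t ^ 14 * (1 + k ^ 2 * t ^ 4)"
      by algebra
    then have 14: "T14 (cusp k t) = t ^ 14"
      using ne by (simp add: T14_def cusp_def)
    have 13: "T13 (cusp k t) = t ^ 13"
      unfolding T13_def 15 by (simp add: cusp_def) algebra
    show ?case
      unfolding h_def 13 14 15 elim(2) by (simp add: cusp_def) algebra
  qed
  with h show ?thesis by (rule that)
qed

text \<open>Below order 12 the available monomials are x, y, x^2, x y and y^2. Since x y = t^9 + k
  t^11, the coefficient of t^11 is tied to that of t^9; the excess 2 k t^12 + k^2 t^14 of y^2 over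
  t^10 is moved into the remainder.\<close>

lemma expansion_factors_through_cusp:
  assumes "smooth_at 0 g"
    and "\<forall>\<^sub>F t in nhds 0. f t = c0 + c4 * t ^ 4 + c5 * (t ^ 5 + k * t ^ 7) + c8 * t ^ 8
      + c9 * (t ^ 9 + k * t ^ 11) + c10 * t ^ 10 + t ^ 12 * g t"
  obtains h :: "real \<times> real \<Rightarrow> real"
  where "smooth_at 0 h" "\<forall>\<^sub>F t in nhds 0. f t = h (cusp k t)"
proof -
  have "smooth_at 0 (\<lambda>t. g t - c10 * (2 * k + k ^ 2 * t ^ 2))"
    by (intro smooth_at_intros assms(1))
  then obtain h :: "real \<times> real \<Rightarrow> real" where h: "smooth_at 0 h"
    "\<forall>\<^sub>F t in nhds 0. t ^ 12 * (g t - c10 * (2 * k + k ^ 2 * t ^ 2)) = h (cusp k t)"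
    by (rule order_12_factors)
  define H where "H z = c0 + c4 * fst z + c5 * snd z + c8 * fst z ^ 2 + c9 * (fst z * snd z)
      + c10 * snd z ^ 2 + h z" for z :: "real \<times> real"
  have "smooth_at 0 H"
    unfolding H_def[abs_def] by (intro smooth_at_intros h(1))
  moreover have "\<forall>\<^sub>F t in nhds 0. f t = H (cusp k t)"
    using assms(2) h(2)
  proof eventually_elim
    case (elim t)
    show ?case
      unfolding H_def elim(1) elim(2)[symmetric] by (simp add: cusp_def) algebra
  qed
  ultimately show ?thesis by (rule that)
qed

subsection \<open>Third-order jets\<close>

text \<open>Four coefficients suffice: after division by t^4 the relevant orders 4 to 7 of the curve
  become 0 to 3.\<close>

definition jet3 :: "(real \<Rightarrow> real) \<Rightarrow> real \<Rightarrow> real \<Rightarrow> real \<Rightarrow> real \<Rightarrow> bool" where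
  "jet3 f a0 a1 a2 a3 \<longleftrightarrow>
    (\<exists>g. smooth_at 0 g \<and> (\<forall>\<^sub>F t in nhds 0. f t = a0 + a1 * t + a2 * t ^ 2 + a3 * t ^ 3 + t ^ 4 * g t))"

lemma jet3E:
  assumes "jet3 f a0 a1 a2 a3"
  obtains g where "smooth_at 0 g"
    "\<forall>\<^sub>F t in nhds 0. f t = a0 + a1 * t + a2 * t ^ 2 + a3 * t ^ 3 + t ^ 4 * g t"
  using assms unfolding jet3_def by (elim exE conjE)

lemma jet3_eq: "jet3 f a0 a1 a2 a3 \<Longrightarrow> a0 = b0 \<Longrightarrow> a1 = b1 \<Longrightarrow> a2 = b2 \<Longrightarrow> a3 = b3 \<Longrightarrow> jet3 f b0 b1 b2 b3"
  by simp

lemma jet3_add: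
  assumes "jet3 f a0 a1 a2 a3" "jet3 g b0 b1 b2 b3"
  shows "jet3 (\<lambda>t. f t + g t) (a0 + b0) (a1 + b1) (a2 + b2) (a3 + b3)"
proof -
  obtain u where u: "smooth_at 0 u"
    "\<forall>\<^sub>F t in nhds 0. f t = a0 + a1 * t + a2 * t ^ 2 + a3 * t ^ 3 + t ^ 4 * u t"
    by (rule jet3E[OF assms(1)])
  obtain v where v: "smooth_at 0 v"
    "\<forall>\<^sub>F t in nhds 0. g t = b0 + b1 * t + b2 * t ^ 2 + b3 * t ^ 3 + t ^ 4 * v t"
    by (rule jet3E[OF assms(2)])
  have "\<forall>\<^sub>F t in nhds 0. f t + g t = (a0 + b0) + (a1 + b1) * t + (a2 + b2) * t ^ 2 + (a3 + b3) * t ^ 3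
      + t ^ 4 * (u t + v t)"
    using u(2) v(2) by eventually_elim (simp add: algebra_simps)
  then show ?thesis
    unfolding jet3_def using smooth_at_add[OF u(1) v(1)] by (intro exI conjI)
qed

lemma jet3_mult:
  assumes "jet3 f a0 a1 a2 a3" "jet3 g b0 b1 b2 b3"
  shows "jet3 (\<lambda>t. f t * g t) (a0 * b0) (a0 * b1 + a1 * b0) (a0 * b2 + a1 * b1 + a2 * b0)
    (a0 * b3 + a1 * b2 + a2 * b1 + a3 * b0)"
proof -
  obtain u where u: "smooth_at 0 u"
    "\<forall>\<^sub>F t in nhds 0. f t = a0 + a1 * t + a2 * t ^ 2 + a3 * t ^ 3 + t ^ 4 * u t"
    by (rule jet3E[OF assms(1)])
  obtain v where v: "smooth_at 0 v"
    "\<forall>\<^sub>F t in nhds 0. g t = b0 + b1 * t + b2 * t ^ 2 + b3 * t ^ 3 + t ^ 4 * v t"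
    by (rule jet3E[OF assms(2)])
  let ?w = "\<lambda>t. (a1 * b3 + a2 * b2 + a3 * b1) + (a2 * b3 + a3 * b2) * t + a3 * b3 * t ^ 2
      + u t * (b0 + b1 * t + b2 * t ^ 2 + b3 * t ^ 3) + v t * (a0 + a1 * t + a2 * t ^ 2 + a3 * t ^ 3)
      + t ^ 4 * (u t * v t)"
  have "\<forall>\<^sub>F t in nhds 0. f t * g t = a0 * b0 + (a0 * b1 + a1 * b0) * t + (a0 * b2 + a1 * b1 + a2 * b0) * t ^ 2
      + (a0 * b3 + a1 * b2 + a2 * b1 + a3 * b0) * t ^ 3 + t ^ 4 * ?w t"
    using u(2) v(2)
  proof eventually_elim
    case (elim t)
    show ?case unfolding elim by algebra
  qed
  moreover have "smooth_at 0 ?w"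
    by (intro smooth_at_intros u(1) v(1))
  ultimately show ?thesis
    unfolding jet3_def by (intro exI conjI)
qed

lemma jet3_poly: "jet3 (\<lambda>t. a0 + a1 * t + a2 * t ^ 2 + a3 * t ^ 3) a0 a1 a2 a3"
  unfolding jet3_def by (rule exI[of _ "\<lambda>t. 0"]) simp

lemma jet3_const: "jet3 (\<lambda>t. c) c 0 0 0"
  unfolding jet3_def by (rule exI[of _ "\<lambda>t. 0"]) simp

lemma jet3_ident: "jet3 (\<lambda>t. t) 0 1 0 0"
  unfolding jet3_def by (rule exI[of _ "\<lambda>t. 0"]) simp

lemma jet3_order_4: "smooth_at 0 g \<Longrightarrow> jet3 (\<lambda>t. t ^ 4 * g t) 0 0 0 0"
  unfolding jet3_def by (rule exI[of _ g]) simp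

lemma jet3_smooth:
  fixes f :: "real \<Rightarrow> real"
  assumes "smooth_at 0 f"
  obtains a0 a1 a2 a3 where "jet3 f a0 a1 a2 a3"
proof -
  obtain c g where g: "smooth_at 0 g" "\<forall>\<^sub>F t in nhds 0. f t = (\<Sum>j<4. c j * t ^ j) + t ^ 4 * g t"
    using smooth_expansion_exists[OF assms, of 4] by (elim exE conjE)
  have "\<forall>\<^sub>F t in nhds 0. f t = c 0 + c 1 * t + c 2 * t ^ 2 + c 3 * t ^ 3 + t ^ 4 * g t"
    using g(2) by eventually_elim (simp add: eval_nat_numeral)
  then have "jet3 f (c 0) (c 1) (c 2) (c 3)"
    unfolding jet3_def using g(1) by (intro exI conjI)
  then show ?thesis by (rule that)
qed

text \<open>A function of order 4 is handled through the jet of its quotient by \<open>t ^ 4\<close>.\<close>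

lemma higher_deriv_of_order_4:
  assumes "jet3 F c4 c5 c6 c7" "\<forall>\<^sub>F t in nhds 0. f t = c0 + t ^ 4 * F t"
  shows "(deriv ^^ 1) f 0 = 0" "(deriv ^^ 2) f 0 = 0" "(deriv ^^ 3) f 0 = 0"
    "(deriv ^^ 4) f 0 = 24 * c4" "(deriv ^^ 5) f 0 = 120 * c5"
    "(deriv ^^ 6) f 0 = 720 * c6" "(deriv ^^ 7) f 0 = 5040 * c7"
proof -
  obtain g where g: "smooth_at 0 g"
    "\<forall>\<^sub>F t in nhds 0. F t = c4 + c5 * t + c6 * t ^ 2 + c7 * t ^ 3 + t ^ 4 * g t"
    by (rule jet3E[OF assms(1)])
  define c where "c j = [c0, 0, 0, 0, c4, c5, c6, c7] ! j" for j
  have c: "c 0 = c0" "c 1 = 0" "c 2 = 0" "c 3 = 0" "c 4 = c4" "c 5 = c5" "c 6 = c6" "c 7 = c7"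
    by (simp_all add: c_def)
  have "{..<8::nat} = {0,1,2,3,4,5,6,7}" by auto
  then have sum: "(\<Sum>j<8. c j * t ^ j) = c0 + c4 * t ^ 4 + c5 * t ^ 5 + c6 * t ^ 6 + c7 * t ^ 7" for t
    using c by simp
  have ev: "\<forall>\<^sub>F t in nhds 0. f t = (\<Sum>j<8. c j * t ^ j) + t ^ 8 * g t"
    using assms(2) g(2)
  proof eventually_elim
    case (elim t)
    show ?case unfolding sum elim by algebra
  qed
  note D = higher_deriv_of_expansion[OF g(1) ev]
  show "(deriv ^^ 1) f 0 = 0" "(deriv ^^ 2) f 0 = 0" "(deriv ^^ 3) f 0 = 0"
    "(deriv ^^ 4) f 0 = 24 * c4" "(deriv ^^ 5) f 0 = 120 * c5"
    "(deriv ^^ 6) f 0 = 720 * c6" "(deriv ^^ 7) f 0 = 5040 * c7"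
    using D[of 1] D[of 2] D[of 3] D[of 4] D[of 5] D[of 6] D[of 7] c
    by (simp_all add: fact_numeral del: funpow.simps)
qed

lemma order_4_expansion:
  fixes f :: "real \<Rightarrow> real"
  assumes "smooth_at 0 f" "(deriv ^^ 1) f 0 = 0" "(deriv ^^ 2) f 0 = 0" "(deriv ^^ 3) f 0 = 0"
  obtains F where "jet3 F ((deriv ^^ 4) f 0 / 24) ((deriv ^^ 5) f 0 / 120)
      ((deriv ^^ 6) f 0 / 720) ((deriv ^^ 7) f 0 / 5040)"
    "smooth_at 0 F" "\<forall>\<^sub>F t in nhds 0. f t = f 0 + t ^ 4 * F t"
proof -
  let ?d = "\<lambda>j. (deriv ^^ j) f 0"
  obtain g where g: "smooth_at 0 g"
    "\<forall>\<^sub>F t in nhds 0. f t = (\<Sum>j<8. ?d j / fact j * t ^ j) + t ^ 8 * g t"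
    by (rule smooth_Taylor[OF assms(1)])
  have idx: "{..<8::nat} = {0,1,2,3,4,5,6,7}" by auto
  have fact: "fact 4 = (24::real)" "fact 5 = (120::real)" "fact 6 = (720::real)" "fact 7 = (5040::real)"
    by (simp_all add: fact_numeral)
  have "(\<Sum>j<8. ?d j / fact j * t ^ j) = ?d 0 / fact 0 * t ^ 0 + ?d 1 / fact 1 * t ^ 1 + ?d 2 / fact 2 * t ^ 2
      + ?d 3 / fact 3 * t ^ 3 + ?d 4 / fact 4 * t ^ 4 + ?d 5 / fact 5 * t ^ 5 + ?d 6 / fact 6 * t ^ 6
      + ?d 7 / fact 7 * t ^ 7" for t
    unfolding idx by (simp del: funpow.simps fact_Suc)
  then have sum: "(\<Sum>j<8. ?d j / fact j * t ^ j) = f 0 + ?d 4 / 24 * t ^ 4 + ?d 5 / 120 * t ^ 5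
      + ?d 6 / 720 * t ^ 6 + ?d 7 / 5040 * t ^ 7" for t
    unfolding assms(2-4) fact by simp
  define F where "F t = ?d 4 / 24 + ?d 5 / 120 * t + ?d 6 / 720 * t ^ 2 + ?d 7 / 5040 * t ^ 3 + t ^ 4 * g t" for t
  show ?thesis
  proof (rule that[of F])
    show "jet3 F (?d 4 / 24) (?d 5 / 120) (?d 6 / 720) (?d 7 / 5040)"
      unfolding jet3_def F_def by (rule exI[of _ g]) (simp add: g(1))
    show "smooth_at 0 F"
      unfolding F_def[abs_def] by (intro smooth_at_intros g(1))
    show "\<forall>\<^sub>F t in nhds 0. f t = f 0 + t ^ 4 * F t"
      using g(2)
    proof eventually_elim
      case (elim t)
      show ?case
        unfolding elim[unfolded sum] F_def
        by (simp add: distrib_left eval_nat_numeral mult_ac del: funpow.simps)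
    qed
  qed
qed

lemma curve_deriv_components:
  fixes \<gamma> :: "real \<Rightarrow> real \<times> real"
  assumes "smooth_at t \<gamma>"
  shows "curve_deriv n \<gamma> t = ((deriv ^^ n) (\<lambda>s. fst (\<gamma> s)) t, (deriv ^^ n) (\<lambda>s. snd (\<gamma> s)) t)"
  using assms
proof (induction n arbitrary: t)
  case 0
  then show ?case by (simp add: curve_deriv_def)
next
  case (Suc n)
  let ?f = "\<lambda>n. (deriv ^^ n) (\<lambda>s. fst (\<gamma> s))" and ?g = "\<lambda>n. (deriv ^^ n) (\<lambda>s. snd (\<gamma> s))"
  obtain U where U: "open U" "t \<in> U" "\<forall>s\<in>U. smooth_at s \<gamma>"
    using smooth_at_eventually[OF Suc.prems] unfolding eventually_nhds by (elim exE conjE)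
  have f: "(?f n has_real_derivative ?f (Suc n) t) (at t)"
    using smooth_at_deriv(1)[OF smooth_at_higher_deriv[OF smooth_at_fst[OF Suc.prems]]] by simp
  have g: "(?g n has_real_derivative ?g (Suc n) t) (at t)"
    using smooth_at_deriv(1)[OF smooth_at_higher_deriv[OF smooth_at_snd[OF Suc.prems]]] by simp
  have "((\<lambda>s. (?f n s, ?g n s)) has_vector_derivative (?f (Suc n) t, ?g (Suc n) t)) (at t)"
    using f g unfolding has_real_derivative_iff_has_vector_derivative
    by (rule has_vector_derivative_Pair)
  then have "(curve_deriv n \<gamma> has_vector_derivative (?f (Suc n) t, ?g (Suc n) t)) (at t)"
    by (rule has_vector_derivative_transform_within_open[OF _ U(1,2)]) (use Suc.IH U(3) in simp)
  then show ?case
    using vector_derivative_at by (simp add: curve_deriv_def)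
qed

subsection \<open>Necessity of the conditions\<close>

lemma local_diffeo_at_deriv_injective:
  assumes "local_diffeo_at f g p" "frechet_derivative f (at p) h = 0"
  shows "h = 0"
proof -
  note fg = local_diffeo_at_smooth[OF assms(1)]
  have gf: "((\<lambda>x. g (f x)) has_derivative
      (\<lambda>h. frechet_derivative g (at (f p)) (frechet_derivative f (at p) h))) (at p)"
    by (rule has_derivative_compose[OF smooth_at_differentiable[OF fg(1)]
          smooth_at_differentiable[OF fg(2)]])
  obtain U where U: "open U" "p \<in> U" "\<forall>x\<in>U. g (f x) = x"
    using fg(3) unfolding eventually_nhds by (elim exE conjE)
  have "((\<lambda>x. x) has_derivative
      (\<lambda>h. frechet_derivative g (at (f p)) (frechet_derivative f (at p) h))) (at p)"
    by (rule has_derivative_transform_within_open[OF gf U(1,2)]) (use U(3) in simp)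
  from has_derivative_unique[OF this has_derivative_ident]
  have "frechet_derivative g (at (f p)) (frechet_derivative f (at p) h) = h"
    by (simp add: fun_eq_iff)
  moreover have "linear (frechet_derivative g (at (f p)))"
    by (rule has_derivative_linear[OF smooth_at_differentiable[OF fg(2)]])
  ultimately show ?thesis
    using assms(2) by (simp add: linear_0)
qed

lemma local_diffeo_at_det:
  fixes f :: "real \<times> real \<Rightarrow> real \<times> real"
  assumes "local_diffeo_at f g p"
  shows "det2 (frechet_derivative f (at p) (0,1)) (frechet_derivative f (at p) (1,0)) \<noteq> 0"
proof
  let ?L = "frechet_derivative f (at p)"
  obtain a b c e where ab: "?L (1,0) = (a, b)" and ce: "?L (0,1) = (c, e)" by fastforce
  assume "det2 (?L (0,1)) (?L (1,0)) = 0"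
  then have det: "c * b - e * a = 0" by (simp add: ab ce det2_def)
  have lin: "linear ?L"
    by (rule has_derivative_linear[OF smooth_at_differentiable[OF local_diffeo_at_smooth(1)[OF assms]]])
  have L: "?L (x, y) = (x * a + y * c, x * b + y * e)" for x y
  proof -
    have "?L (x *\<^sub>R (1,0) + y *\<^sub>R (0,1)) = x *\<^sub>R (a, b) + y *\<^sub>R (c, e)"
      unfolding linear_add[OF lin] linear_scale[OF lin] ab ce ..
    then show ?thesis by simp
  qed
  \<comment> \<open>Up to sign these are the columns of the adjugate matrix, which a singular matrix
    annihilates. Injectivity forces them, and with them the whole matrix, to vanish.\<close>
  have "?L (e, - b) = 0" "?L (c, - a) = 0"
    unfolding L using det by (simp_all add: zero_prod_def algebra_simps)
  then have "(e, - b) = 0" "(c, - a) = 0"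
    using local_diffeo_at_deriv_injective[OF assms] by metis+
  then have "?L (1, 0) = 0" using ab by (simp add: zero_prod_def)
  then have "(1::real, 0::real) = 0"
    using local_diffeo_at_deriv_injective[OF assms] by metis
  then show False by (simp add: zero_prod_def)
qed

text \<open>The substitution is u = t s(t) = p1 t + p2 t^2 + p3 t^3 + p4 t^4 + ..., so the constant
  term of \<open>s\<close> is the linear coefficient of u. Since u^n = t^n s^n, products of jets of
  \<open>s\<close> give every coefficient.\<close>

lemma reparametrised_order_4_expansion:
  assumes s: "jet3 s p1 p2 p3 p4" "smooth_at 0 s" and g: "smooth_at 0 g"
    and H: "\<forall>\<^sub>F u in nhds 0. h u = c0 + c4 * u ^ 4 + c5 * u ^ 5 + c6 * u ^ 6 + c7 * u ^ 7 + u ^ 8 * g u"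
  obtains F where "\<forall>\<^sub>F t in nhds 0. h (t * s t) = c0 + t ^ 4 * F t" "smooth_at 0 F"
    "jet3 F (c4 * p1 ^ 4) (c4 * (4 * p1 ^ 3 * p2) + c5 * p1 ^ 5)
      (c4 * (4 * p1 ^ 3 * p3 + 6 * p1 ^ 2 * p2 ^ 2) + c5 * (5 * p1 ^ 4 * p2) + c6 * p1 ^ 6)
      (c4 * (4 * p1 ^ 3 * p4 + 12 * p1 ^ 2 * p2 * p3 + 4 * p1 * p2 ^ 3)
        + c5 * (5 * p1 ^ 4 * p3 + 10 * p1 ^ 3 * p2 ^ 2) + c6 * (6 * p1 ^ 5 * p2) + c7 * p1 ^ 7)"
proof -
  let ?s2 = "\<lambda>t. s t * s t" and ?s4 = "\<lambda>t. (s t * s t) * (s t * s t)"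
  let ?s5 = "\<lambda>t. ((s t * s t) * (s t * s t)) * s t"
  let ?s6 = "\<lambda>t. ((s t * s t) * (s t * s t)) * (s t * s t)"
  let ?s7 = "\<lambda>t. (((s t * s t) * (s t * s t)) * s t) * (s t * s t)"
  have ts: "smooth_at 0 (\<lambda>t. t * s t)" by (intro smooth_at_intros s(2))
  have gs: "smooth_at 0 (\<lambda>t. ?s4 t * ?s4 t * g (t * s t))"
    by (intro smooth_at_mult s(2) smooth_at_compose[OF ts, of g]) (simp add: g)
  have s2: "jet3 ?s2 (p1 ^ 2) (2 * p1 * p2) (2 * p1 * p3 + p2 ^ 2) (2 * p1 * p4 + 2 * p2 * p3)"
    by (rule jet3_eq[OF jet3_mult[OF s(1) s(1)]]) algebra+
  have s4: "jet3 ?s4 (p1 ^ 4) (4 * p1 ^ 3 * p2) (4 * p1 ^ 3 * p3 + 6 * p1 ^ 2 * p2 ^ 2)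
      (4 * p1 ^ 3 * p4 + 12 * p1 ^ 2 * p2 * p3 + 4 * p1 * p2 ^ 3)"
    by (rule jet3_eq[OF jet3_mult[OF s2 s2]]) algebra+
  note s5 = jet3_mult[OF s4 s(1)]
  note s6 = jet3_mult[OF s4 s2]
  note s7 = jet3_mult[OF s5 s2]
  have 4: "jet3 (\<lambda>t. c4 * ?s4 t) (c4 * p1 ^ 4) (c4 * (4 * p1 ^ 3 * p2)) (c4 * (4 * p1 ^ 3 * p3 + 6 * p1 ^ 2 * p2 ^ 2))
      (c4 * (4 * p1 ^ 3 * p4 + 12 * p1 ^ 2 * p2 * p3 + 4 * p1 * p2 ^ 3))"
    by (rule jet3_eq[OF jet3_mult[OF jet3_const s4]]) algebra+
  have 5: "jet3 (\<lambda>t. c5 * (t * ?s5 t)) 0 (c5 * p1 ^ 5) (c5 * (5 * p1 ^ 4 * p2))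
      (c5 * (5 * p1 ^ 4 * p3 + 10 * p1 ^ 3 * p2 ^ 2))"
    by (rule jet3_eq[OF jet3_mult[OF jet3_const jet3_mult[OF jet3_ident s5]]]) algebra+
  have 6: "jet3 (\<lambda>t. c6 * (t * (t * ?s6 t))) 0 0 (c6 * p1 ^ 6) (c6 * (6 * p1 ^ 5 * p2))"
    by (rule jet3_eq[OF jet3_mult[OF jet3_const jet3_mult[OF jet3_ident jet3_mult[OF jet3_ident s6]]]])
      algebra+
  have 7: "jet3 (\<lambda>t. c7 * (t * (t * (t * ?s7 t)))) 0 0 0 (c7 * p1 ^ 7)"
    by (rule jet3_eq[OF jet3_mult[OF jet3_const jet3_mult[OF jet3_ident jet3_mult[OF jet3_ident
              jet3_mult[OF jet3_ident s7]]]]]) algebra+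
  let ?F = "\<lambda>t. c4 * ?s4 t + c5 * (t * ?s5 t) + c6 * (t * (t * ?s6 t)) + c7 * (t * (t * (t * ?s7 t)))
      + t ^ 4 * (?s4 t * ?s4 t * g (t * s t))"
  show ?thesis
  proof (rule that[of ?F])
    have "\<forall>\<^sub>F t in nhds 0. h (t * s t) = c0 + c4 * (t * s t) ^ 4 + c5 * (t * s t) ^ 5
        + c6 * (t * s t) ^ 6 + c7 * (t * s t) ^ 7 + (t * s t) ^ 8 * g (t * s t)"
      by (rule eventually_nhds_compose[OF smooth_at_continuous[OF ts]]) (simp add: H)
    then show "\<forall>\<^sub>F t in nhds 0. h (t * s t) = c0 + t ^ 4 * ?F t"
    proof eventually_elim
      case (elim t)
      show ?case unfolding elim by algebra
    qed
    show "smooth_at 0 ?F"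
      by (intro smooth_at_add smooth_at_mult smooth_at_const smooth_at_ident smooth_at_power s(2) gs
          smooth_at_compose[OF ts, of g]) (simp add: g)
    show "jet3 ?F (c4 * p1 ^ 4) (c4 * (4 * p1 ^ 3 * p2) + c5 * p1 ^ 5)
        (c4 * (4 * p1 ^ 3 * p3 + 6 * p1 ^ 2 * p2 ^ 2) + c5 * (5 * p1 ^ 4 * p2) + c6 * p1 ^ 6)
        (c4 * (4 * p1 ^ 3 * p4 + 12 * p1 ^ 2 * p2 * p3 + 4 * p1 * p2 ^ 3)
          + c5 * (5 * p1 ^ 4 * p3 + 10 * p1 ^ 3 * p2 ^ 2) + c6 * (6 * p1 ^ 5 * p2) + c7 * p1 ^ 7)"
      by (rule jet3_eq[OF jet3_add[OF jet3_add[OF jet3_add[OF jet3_add[OF 4 5] 6] 7] jet3_order_4[OF gs]]])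
        algebra+
  qed
qed

definition cusp_invariant :: "(real \<Rightarrow> real \<times> real) \<Rightarrow> real" where
  "cusp_invariant \<gamma> = (let A = det2 (curve_deriv 5 \<gamma> 0) (curve_deriv 4 \<gamma> 0);
     B = det2 (curve_deriv 6 \<gamma> 0) (curve_deriv 4 \<gamma> 0);
     C = det2 (curve_deriv 7 \<gamma> 0) (curve_deriv 4 \<gamma> 0);
     D = det2 (curve_deriv 6 \<gamma> 0) (curve_deriv 5 \<gamma> 0)
   in - 77 * B ^ 2 + 105 * A * D + 60 * A * C)"

text \<open>Solving the equivalence for \<gamma> writes it as \<Phi> after the cusp after \<psi>. Up
  to order 7 only the linear part of \<Phi> and four coefficients of \<psi> enter, so all the
  determinants are explicit polynomials.\<close>

lemma A_equiv_cusp_necessary: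
  assumes \<gamma>: "smooth_at 0 \<gamma>" and equiv: "A_equiv_at0 \<gamma> (cusp k)"
  shows "curve_deriv 1 \<gamma> 0 = 0" "curve_deriv 2 \<gamma> 0 = 0" "curve_deriv 3 \<gamma> 0 = 0"
    "det2 (curve_deriv 5 \<gamma> 0) (curve_deriv 4 \<gamma> 0) \<noteq> 0"
    "\<exists>q>0. cusp_invariant \<gamma> = q * k"
proof -
  obtain \<psi> \<psi>inv \<Psi> \<Phi> where \<psi>0: "\<psi> 0 = 0" and \<psi>: "local_diffeo_at \<psi> \<psi>inv 0"
    and \<Psi>: "local_diffeo_at \<Psi> \<Phi> (\<gamma> 0)" and ev: "\<forall>\<^sub>F t in nhds 0. \<Psi> (\<gamma> (\<psi>inv t)) = cusp k t"
    using equiv unfolding A_equiv_at0_def by (elim exE conjE)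
  note \<psi>s = local_diffeo_at_smooth[OF \<psi>] and \<Psi>s = local_diffeo_at_smooth[OF \<Psi>]
  have "\<forall>\<^sub>F s in nhds 0. \<Psi> (\<gamma> (\<psi>inv (\<psi> s))) = cusp k (\<psi> s)"
    by (rule eventually_nhds_compose[OF smooth_at_continuous[OF \<psi>s(1)]]) (simp add: \<psi>0 ev)
  moreover have "\<forall>\<^sub>F s in nhds 0. \<Phi> (\<Psi> (\<gamma> s)) = \<gamma> s"
    by (rule eventually_nhds_compose[OF smooth_at_continuous[OF \<gamma>] \<Psi>s(3)])
  ultimately have \<gamma>eq: "\<forall>\<^sub>F s in nhds 0. \<gamma> s = \<Phi> (cusp k (\<psi> s))"
    using \<psi>s(3)
  proof eventually_elim
    case (elim s)
    have "\<gamma> s = \<Phi> (\<Psi> (\<gamma> (\<psi>inv (\<psi> s))))" using elim(2,3) by (simp only:)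
    then show ?case by (simp only: elim(1))
  qed
  have "\<Psi> (\<gamma> (\<psi>inv 0)) = 0"
    using eventually_nhds_x_imp_x[OF ev] by (simp only: cusp_0)
  moreover have "\<psi>inv 0 = 0"
    using eventually_nhds_x_imp_x[OF \<psi>s(3)] by (simp only: \<psi>0)
  ultimately have \<Psi>0: "\<Psi> (\<gamma> 0) = 0" by (simp only:)
  have \<Phi>: "smooth_at 0 \<Phi>" using \<Psi>s(2) by (simp only: \<Psi>0)
  have "local_diffeo_at \<Phi> \<Psi> 0"
    using local_diffeo_at_sym[OF \<Psi>] by (simp only: \<Psi>0)
  then have det: "det2 (frechet_derivative \<Phi> (at 0) (0,1)) (frechet_derivative \<Phi> (at 0) (1,0)) \<noteq> 0"
    by (rule local_diffeo_at_det)
  obtain x1 y1 x2 y2 where v4: "frechet_derivative \<Phi> (at 0) (1,0) = (x1, y1)"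
    and v5: "frechet_derivative \<Phi> (at 0) (0,1) = (x2, y2)" by fastforce
  define d where "d = x2 * y1 - y2 * x1"
  have d: "d \<noteq> 0" using det by (simp add: v4 v5 det2_def d_def)

  obtain s where s: "smooth_at 0 s" "\<forall>\<^sub>F t in nhds 0. \<psi> t = \<psi> 0 + t * s t"
    by (rule Hadamard_division[OF \<psi>s(1)])
  have \<psi>eq: "\<forall>\<^sub>F t in nhds 0. \<psi> t = t * s t" using s(2) by (simp only: \<psi>0 add_0_left)
  obtain p1 p2 p3 p4 where js: "jet3 s p1 p2 p3 p4" by (rule jet3_smooth[OF s(1)])
  \<comment> \<open>\<open>p1\<close> is the derivative of \<psi> at 0.\<close>
  have p1: "p1 \<noteq> 0"
  proof
    assume "p1 = 0"
    obtain g where g: "smooth_at 0 g"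
      "\<forall>\<^sub>F t in nhds 0. s t = p1 + p2 * t + p3 * t ^ 2 + p4 * t ^ 3 + t ^ 4 * g t"
      by (rule jet3E[OF js])
    have "s 0 = 0" using eventually_nhds_x_imp_x[OF g(2)] \<open>p1 = 0\<close> by simp
    have ts: "((\<lambda>t. t * s t) has_real_derivative 0) (at 0)"
      using DERIV_mult[OF DERIV_ident smooth_at_deriv(1)[OF s(1)]] by (simp add: \<open>s 0 = 0\<close>)
    obtain U where U: "open U" "0 \<in> U" "\<forall>t\<in>U. \<psi> t = t * s t"
      using \<psi>eq unfolding eventually_nhds by (elim exE conjE)
    have "(\<psi> has_real_derivative 0) (at 0)"
      by (rule has_field_derivative_transform_within_open[OF ts U(1,2)]) (use U(3) in simp)
    then have "frechet_derivative \<psi> (at 0) 1 = 0"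
      unfolding has_field_derivative_def by (simp add: frechet_derivative_at[symmetric])
    from local_diffeo_at_deriv_injective[OF \<psi> this] show False by simp
  qed

  \<comment> \<open>Stated for an arbitrary linear functional so that one computation serves both
    coordinates.\<close>
  have comp: "\<exists>F. (\<forall>\<^sub>F t in nhds 0. L (\<gamma> t) = L (\<Phi> 0) + t ^ 4 * F t) \<and>
      jet3 F (L (x1,y1) * p1 ^ 4) (L (x1,y1) * (4 * p1 ^ 3 * p2) + L (x2,y2) * p1 ^ 5)
      (L (x1,y1) * (4 * p1 ^ 3 * p3 + 6 * p1 ^ 2 * p2 ^ 2) + L (x2,y2) * (5 * p1 ^ 4 * p2))
      (L (x1,y1) * (4 * p1 ^ 3 * p4 + 12 * p1 ^ 2 * p2 * p3 + 4 * p1 * p2 ^ 3)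
        + L (x2,y2) * (5 * p1 ^ 4 * p3 + 10 * p1 ^ 3 * p2 ^ 2 + k * p1 ^ 7))"
    if L: "bounded_linear L" for L :: "real \<times> real \<Rightarrow> real"
  proof -
    have sm: "smooth_at 0 (\<lambda>z. L (\<Phi> z))" by (rule smooth_at_linear_compose[OF \<Phi> L])
    have "((\<lambda>z. L (\<Phi> z)) has_derivative (\<lambda>h. L (frechet_derivative \<Phi> (at 0) h))) (at 0)"
      by (rule bounded_linear.has_derivative[OF L smooth_at_differentiable[OF \<Phi>]])
    from frechet_derivative_at[OF this, symmetric]
    have fd: "frechet_derivative (\<lambda>z. L (\<Phi> z)) (at 0) (1,0) = L (x1,y1)"
      "frechet_derivative (\<lambda>z. L (\<Phi> z)) (at 0) (0,1) = L (x2,y2)" by (simp_all add: v4 v5)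
    obtain g where g: "smooth_at 0 g" "\<forall>\<^sub>F u in nhds 0. L (\<Phi> (cusp k u)) = L (\<Phi> 0) + L (x1,y1) * u ^ 4
        + L (x2,y2) * (u ^ 5 + k * u ^ 7) + u ^ 8 * g u"
      by (rule smooth_along_cusp[OF sm, unfolded fd])
    have "\<forall>\<^sub>F u in nhds 0. L (\<Phi> (cusp k u)) = L (\<Phi> 0) + L (x1,y1) * u ^ 4
        + L (x2,y2) * u ^ 5 + 0 * u ^ 6 + (L (x2,y2) * k) * u ^ 7 + u ^ 8 * g u"
      using g(2) by eventually_elim (simp add: algebra_simps)
    then obtain F where F: "\<forall>\<^sub>F t in nhds 0. L (\<Phi> (cusp k (t * s t))) = L (\<Phi> 0) + t ^ 4 * F t"
      and "smooth_at 0 F"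
      and jF: "jet3 F (L (x1,y1) * p1 ^ 4) (L (x1,y1) * (4 * p1 ^ 3 * p2) + L (x2,y2) * p1 ^ 5)
      (L (x1,y1) * (4 * p1 ^ 3 * p3 + 6 * p1 ^ 2 * p2 ^ 2) + L (x2,y2) * (5 * p1 ^ 4 * p2) + 0 * p1 ^ 6)
      (L (x1,y1) * (4 * p1 ^ 3 * p4 + 12 * p1 ^ 2 * p2 * p3 + 4 * p1 * p2 ^ 3)
        + L (x2,y2) * (5 * p1 ^ 4 * p3 + 10 * p1 ^ 3 * p2 ^ 2) + 0 * (6 * p1 ^ 5 * p2)
        + L (x2,y2) * k * p1 ^ 7)"
      by (rule reparametrised_order_4_expansion[OF js s(1) g(1)])
    have "jet3 F (L (x1,y1) * p1 ^ 4) (L (x1,y1) * (4 * p1 ^ 3 * p2) + L (x2,y2) * p1 ^ 5)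
      (L (x1,y1) * (4 * p1 ^ 3 * p3 + 6 * p1 ^ 2 * p2 ^ 2) + L (x2,y2) * (5 * p1 ^ 4 * p2))
      (L (x1,y1) * (4 * p1 ^ 3 * p4 + 12 * p1 ^ 2 * p2 * p3 + 4 * p1 * p2 ^ 3)
        + L (x2,y2) * (5 * p1 ^ 4 * p3 + 10 * p1 ^ 3 * p2 ^ 2 + k * p1 ^ 7))"
      by (rule jet3_eq[OF jF]) algebra+
    moreover have "\<forall>\<^sub>F t in nhds 0. L (\<gamma> t) = L (\<Phi> 0) + t ^ 4 * F t"
      using F \<gamma>eq \<psi>eq
    proof eventually_elim
      case (elim t)
      show ?case unfolding elim(2) elim(3) by (rule elim(1))
    qed
    ultimately show ?thesis by (intro exI[of _ F] conjI)
  qed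
  obtain F where "\<forall>\<^sub>F t in nhds 0. fst (\<gamma> t) = fst (\<Phi> 0) + t ^ 4 * F t"
    "jet3 F (x1 * p1 ^ 4) (x1 * (4 * p1 ^ 3 * p2) + x2 * p1 ^ 5)
      (x1 * (4 * p1 ^ 3 * p3 + 6 * p1 ^ 2 * p2 ^ 2) + x2 * (5 * p1 ^ 4 * p2))
      (x1 * (4 * p1 ^ 3 * p4 + 12 * p1 ^ 2 * p2 * p3 + 4 * p1 * p2 ^ 3)
        + x2 * (5 * p1 ^ 4 * p3 + 10 * p1 ^ 3 * p2 ^ 2 + k * p1 ^ 7))"
    using comp[OF bounded_linear_fst] by (elim exE conjE) (simp only: fst_conv)
  note X = higher_deriv_of_order_4[OF this(2,1)]
  obtain G where "\<forall>\<^sub>F t in nhds 0. snd (\<gamma> t) = snd (\<Phi> 0) + t ^ 4 * G t"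
    "jet3 G (y1 * p1 ^ 4) (y1 * (4 * p1 ^ 3 * p2) + y2 * p1 ^ 5)
      (y1 * (4 * p1 ^ 3 * p3 + 6 * p1 ^ 2 * p2 ^ 2) + y2 * (5 * p1 ^ 4 * p2))
      (y1 * (4 * p1 ^ 3 * p4 + 12 * p1 ^ 2 * p2 * p3 + 4 * p1 * p2 ^ 3)
        + y2 * (5 * p1 ^ 4 * p3 + 10 * p1 ^ 3 * p2 ^ 2 + k * p1 ^ 7))"
    using comp[OF bounded_linear_snd] by (elim exE conjE) (simp only: snd_conv)
  note Y = higher_deriv_of_order_4[OF this(2,1)]
  note c = curve_deriv_components[OF \<gamma>]
  show "curve_deriv 1 \<gamma> 0 = 0" "curve_deriv 2 \<gamma> 0 = 0" "curve_deriv 3 \<gamma> 0 = 0"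
    unfolding c X Y by (simp_all only: zero_prod_def)
  have A: "det2 (curve_deriv 5 \<gamma> 0) (curve_deriv 4 \<gamma> 0) = 2880 * d * p1 ^ 9"
    unfolding c X Y det2_def fst_conv snd_conv d_def by algebra
  then show "det2 (curve_deriv 5 \<gamma> 0) (curve_deriv 4 \<gamma> 0) \<noteq> 0"
    using d p1 by simp
  have B: "det2 (curve_deriv 6 \<gamma> 0) (curve_deriv 4 \<gamma> 0) = 86400 * d * p1 ^ 8 * p2"
    unfolding c X Y det2_def fst_conv snd_conv d_def by algebra
  have C: "det2 (curve_deriv 7 \<gamma> 0) (curve_deriv 4 \<gamma> 0)
      = 120960 * d * p1 ^ 4 * (5 * p1 ^ 4 * p3 + 10 * p1 ^ 3 * p2 ^ 2 + k * p1 ^ 7)"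
    unfolding c X Y det2_def fst_conv snd_conv d_def by algebra
  have D: "det2 (curve_deriv 6 \<gamma> 0) (curve_deriv 5 \<gamma> 0)
      = - 86400 * d * (4 * p1 ^ 8 * p3 - 14 * p1 ^ 7 * p2 ^ 2)"
    unfolding c X Y det2_def fst_conv snd_conv d_def by algebra
  \<comment> \<open>The weights are such that the terms in \<open>p2 ^ 2\<close> and
    \<open>p3\<close> cancel; \<open>p4\<close> enters only along the image of (1,0), which is
    parallel to the fourth derivative, and so is absent from \<open>C\<close>. The constant is 60 *
    2880 * 120960, from the product of \<open>A\<close> and \<open>C\<close>.\<close>
  have "cusp_invariant \<gamma> = (20901888000 * d ^ 2 * p1 ^ 20) * k"
    unfolding cusp_invariant_def Let_def A B C D by algebra
  moreover have "20901888000 * d ^ 2 * p1 ^ 20 > 0"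
    using d p1 by (simp add: zero_less_power_eq)
  ultimately show "\<exists>q>0. cusp_invariant \<gamma> = q * k" by (intro exI conjI)
qed

subsection \<open>Sufficiency of the conditions\<close>

text \<open>The construction produces the inverses of the two coordinate changes demanded by the
  definition: a parametrisation \<phi> and a plane map \<Phi> carrying the cusp to the curve. The
  inverse function theorem turns them around.\<close>

lemma A_equiv_cuspI:
  assumes \<phi>: "smooth_at 0 \<phi>" "\<phi> 0 = 0" "(\<phi> has_real_derivative d) (at 0)" "d \<noteq> 0"
    and \<Phi>: "smooth_at 0 \<Phi>"
      "det2 (frechet_derivative \<Phi> (at 0) (1,0)) (frechet_derivative \<Phi> (at 0) (0,1)) \<noteq> 0"
    and ev: "\<forall>\<^sub>F t in nhds 0. \<gamma> (\<phi> t) = \<Phi> (cusp k t)"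
  shows "A_equiv_at0 \<gamma> (cusp k)"
proof -
  obtain \<psi> where \<psi>: "local_diffeo_at \<phi> \<psi> 0"
    using smooth_inverse_function_real[OF \<phi>(1,3,4)] by (elim exE)
  obtain \<Psi> where \<Psi>: "local_diffeo_at \<Phi> \<Psi> 0"
    using smooth_inverse_function_plane[OF \<Phi>] by (elim exE)
  have "\<psi> 0 = 0"
    using eventually_nhds_x_imp_x[OF local_diffeo_at_smooth(3)[OF \<psi>]] by (simp only: \<phi>(2))
  moreover have "local_diffeo_at \<psi> \<phi> 0"
    using local_diffeo_at_sym[OF \<psi>] by (simp only: \<phi>(2))
  moreover have "\<Phi> 0 = \<gamma> 0"
    using eventually_nhds_x_imp_x[OF ev] by (simp only: cusp_0 \<phi>(2))
  then have "local_diffeo_at \<Psi> \<Phi> (\<gamma> 0)"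
    using local_diffeo_at_sym[OF \<Psi>] by (simp only:)
  moreover have "\<forall>\<^sub>F t in nhds 0. \<Psi> (\<Phi> (cusp k t)) = cusp k t"
    by (rule eventually_nhds_compose[OF smooth_at_continuous[OF smooth_at_cusp]])
      (simp add: local_diffeo_at_smooth(3)[OF \<Psi>])
  then have "\<forall>\<^sub>F t in nhds 0. \<Psi> (\<gamma> (\<phi> t)) = cusp k t"
    using ev
  proof eventually_elim
    case (elim t)
    show ?case unfolding elim(2) by (rule elim(1))
  qed
  ultimately show ?thesis
    unfolding A_equiv_at0_def by (intro exI conjI)
qed

text \<open>Together with the criterion this yields the sign of the invariant of a model cusp
  without computing its derivatives.\<close>

lemma A_equiv_cusp_refl: "A_equiv_at0 (cusp k) (cusp k)"
proof -
  have fd: "frechet_derivative (\<lambda>z::real \<times> real. z) (at 0) = (\<lambda>z. z)"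
    by (rule frechet_derivative_at[OF has_derivative_ident, symmetric])
  show ?thesis
    by (rule A_equiv_cuspI[where \<phi>="\<lambda>t. t" and d=1 and \<Phi>="\<lambda>z. z"])
      (simp_all add: fd det2_def)
qed

text \<open>The coordinate change \<open>u = t + a t\<^sup>7 + b t\<^sup>8\<close> adjusts the coefficient of \<open>t\<^sup>1\<^sup>1\<close>, the last
  gap of the semigroup generated by 4 and 5, without disturbing those below \<open>t\<^sup>1\<^sup>0\<close>.\<close>

lemma factors_through_cusp_after_reparametrisation:
  assumes g: "smooth_at 0 g"
    and f: "\<forall>\<^sub>F u in nhds 0. f u = c0 + e4 * u ^ 4 + e5 * (u ^ 5 + k * u ^ 7) + e8 * u ^ 8 + e9 * u ^ 9
      + e10 * u ^ 10 + e11 * u ^ 11 + u ^ 12 * g u"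
    and ab: "e11 + 4 * b * e4 + 5 * a * e5 = k * e9"
  obtains h :: "real \<times> real \<Rightarrow> real" where "smooth_at 0 h"
    "\<forall>\<^sub>F t in nhds 0. f (t + a * t ^ 7 + b * t ^ 8) = h (cusp k t)"
    "frechet_derivative h (at 0) (1,0) = e4" "frechet_derivative h (at 0) (0,1) = e5"
proof -
  let ?u = "\<lambda>t::real. t + a * t ^ 7 + b * t ^ 8" and ?v = "\<lambda>t::real. a + b * t"
  let ?w = "\<lambda>t::real. t ^ 6 * ?v t"
  let ?Q = "\<lambda>n t. \<Sum>i<n. (1 + ?w t) ^ i"
  have u: "smooth_at 0 ?u" by (intro smooth_at_intros)
  have Q: "smooth_at 0 (?Q n)" for n
    by (rule smooth_at_sum) (simp, intro smooth_at_intros)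
  have un: "?u t ^ n = t ^ n * (1 + ?w t * ?Q n t)" for n t
  proof -
    have "?u t = t * (1 + ?w t)" by algebra
    then have "?u t ^ n = t ^ n * (1 + ?w t) ^ n" by (simp only: power_mult_distrib)
    also have "(1 + ?w t) ^ n = 1 + ?w t * ?Q n t"
      using power_diff_1_eq[of "1 + ?w t" n] by (simp only: add_diff_cancel_left' diff_eq_eq)
    finally show ?thesis .
  qed
  \<comment> \<open>For exponents 4 and 5 the term linear in \<open>?w\<close> must be explicit, as
    it reaches orders 10 and 11. From exponent 7 on the correction starts at order 13 and the
    geometric sums \<open>?Q\<close> suffice.\<close>
  have u4: "?u t ^ 4 = t ^ 4 * (1 + 4 * ?w t + (?w t) ^ 2 * (6 + 4 * ?w t + (?w t) ^ 2))" for t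
    by algebra
  have u5: "?u t ^ 5 = t ^ 5 * (1 + 5 * ?w t + (?w t) ^ 2 * (10 + 10 * ?w t + 5 * (?w t) ^ 2 + (?w t) ^ 3))" for t
    by algebra
  let ?G = "\<lambda>t. e4 * (t ^ 4 * ?v t ^ 2 * (6 + 4 * ?w t + (?w t) ^ 2))
      + e5 * (5 * b + t ^ 5 * ?v t ^ 2 * (10 + 10 * ?w t + 5 * (?w t) ^ 2 + (?w t) ^ 3))
      + e5 * k * t * ?v t * ?Q 7 t + e8 * t ^ 2 * ?v t * ?Q 8 t + e9 * t ^ 3 * ?v t * ?Q 9 t
      + e10 * t ^ 4 * ?v t * ?Q 10 t + e11 * t ^ 5 * ?v t * ?Q 11 t
      + (1 + ?w t * ?Q 12 t) * g (?u t)"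
  have gu: "smooth_at 0 (\<lambda>t. g (?u t))"
    by (rule smooth_at_compose[OF u, of g]) (simp add: g)
  have G: "smooth_at 0 ?G"
    by (intro smooth_at_add smooth_at_mult smooth_at_power smooth_at_const smooth_at_ident Q gu)
  have ring: "c0 + e4 * (t ^ 4 * (1 + 4 * (t ^ 6 * (a + b * t)) + (t ^ 6 * (a + b * t)) ^ 2 * R4))
      + e5 * (t ^ 5 * (1 + 5 * (t ^ 6 * (a + b * t)) + (t ^ 6 * (a + b * t)) ^ 2 * R5)
        + k * (t ^ 7 * (1 + t ^ 6 * (a + b * t) * q7)))
      + e8 * (t ^ 8 * (1 + t ^ 6 * (a + b * t) * q8)) + e9 * (t ^ 9 * (1 + t ^ 6 * (a + b * t) * q9))
      + e10 * (t ^ 10 * (1 + t ^ 6 * (a + b * t) * q10)) + e11 * (t ^ 11 * (1 + t ^ 6 * (a + b * t) * q11))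
      + t ^ 12 * (1 + t ^ 6 * (a + b * t) * q12) * y
    = c0 + e4 * t ^ 4 + e5 * (t ^ 5 + k * t ^ 7) + e8 * t ^ 8 + e9 * (t ^ 9 + k * t ^ 11)
      + (e10 + 4 * a * e4) * t ^ 10
      + t ^ 12 * (e4 * (t ^ 4 * (a + b * t) ^ 2 * R4) + e5 * (5 * b + t ^ 5 * (a + b * t) ^ 2 * R5)
        + e5 * k * t * (a + b * t) * q7 + e8 * t ^ 2 * (a + b * t) * q8 + e9 * t ^ 3 * (a + b * t) * q9
        + e10 * t ^ 4 * (a + b * t) * q10 + e11 * t ^ 5 * (a + b * t) * q11
        + (1 + t ^ 6 * (a + b * t) * q12) * y)" for t R4 R5 q7 q8 q9 q10 q11 q12 y :: real
  proof -
    have "e9 * (t ^ 9 + k * t ^ 11) = e9 * t ^ 9 + (e11 + 4 * b * e4 + 5 * a * e5) * t ^ 11"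
      unfolding ab by algebra
    then show ?thesis by algebra
  qed
  have "\<forall>\<^sub>F t in nhds 0. f (?u t) = c0 + e4 * ?u t ^ 4 + e5 * (?u t ^ 5 + k * ?u t ^ 7) + e8 * ?u t ^ 8
      + e9 * ?u t ^ 9 + e10 * ?u t ^ 10 + e11 * ?u t ^ 11 + ?u t ^ 12 * g (?u t)"
    by (rule eventually_nhds_compose[OF smooth_at_continuous[OF u]]) (simp add: f)
  then have exp: "\<forall>\<^sub>F t in nhds 0. f (?u t) = c0 + e4 * t ^ 4 + e5 * (t ^ 5 + k * t ^ 7) + e8 * t ^ 8
      + e9 * (t ^ 9 + k * t ^ 11) + (e10 + 4 * a * e4) * t ^ 10 + t ^ 12 * ?G t"
  proof eventually_elim
    case (elim t)
    show ?case
      unfolding elim u4 u5 un[of _ 7] un[of _ 8] un[of _ 9] un[of _ 10] un[of _ 11] un[of _ 12]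
      by (rule ring)
  qed
  obtain h :: "real \<times> real \<Rightarrow> real" where h: "smooth_at 0 h" "\<forall>\<^sub>F t in nhds 0. f (?u t) = h (cusp k t)"
    by (rule expansion_factors_through_cusp[OF G exp])
  \<comment> \<open>The partials of \<open>h\<close> are found by comparing two expansions of
    \<open>h\<close> along the cusp: the general one through its linear part, and the one prescribed
    by \<open>exp\<close>.\<close>
  let ?p = "frechet_derivative h (at 0) (1,0)" and ?q = "frechet_derivative h (at 0) (0,1)"
  obtain r where r: "smooth_at 0 r"
    "\<forall>\<^sub>F t in nhds 0. h (cusp k t) = h 0 + ?p * t ^ 4 + ?q * (t ^ 5 + k * t ^ 7) + t ^ 8 * r t"
    by (rule smooth_along_cusp[OF h(1)])
  define R where "R t = ?p + ?q * t + 0 * t ^ 2 + ?q * k * t ^ 3 + t ^ 4 * r t" for t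
  have "jet3 R ?p ?q 0 (?q * k)"
    unfolding jet3_def R_def using r(1) by (intro exI[of _ r]) simp
  moreover have "\<forall>\<^sub>F t in nhds 0. h (cusp k t) = h 0 + t ^ 4 * R t"
    using r(2)
  proof eventually_elim
    case (elim t)
    show ?case unfolding elim R_def by algebra
  qed
  ultimately have R: "(deriv ^^ 4) (\<lambda>t. h (cusp k t)) 0 = 24 * ?p" "(deriv ^^ 5) (\<lambda>t. h (cusp k t)) 0 = 120 * ?q"
    by (rule higher_deriv_of_order_4)+
  define Z where "Z t = e8 + e9 * (t + k * t ^ 3) + (e10 + 4 * a * e4) * t ^ 2 + t ^ 4 * ?G t" for t
  define S where "S t = e4 + e5 * t + 0 * t ^ 2 + e5 * k * t ^ 3 + t ^ 4 * Z t" for t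
  have "smooth_at 0 Z"
    unfolding Z_def[abs_def] by (intro smooth_at_add smooth_at_mult smooth_at_power smooth_at_const smooth_at_ident Q gu)
  then have "jet3 S e4 e5 0 (e5 * k)"
    unfolding jet3_def S_def by (intro exI[of _ Z]) simp
  moreover have "\<forall>\<^sub>F t in nhds 0. h (cusp k t) = c0 + t ^ 4 * S t"
    using h(2) exp
  proof eventually_elim
    case (elim t)
    have "h (cusp k t) = c0 + e4 * t ^ 4 + e5 * (t ^ 5 + k * t ^ 7) + e8 * t ^ 8
      + e9 * (t ^ 9 + k * t ^ 11) + (e10 + 4 * a * e4) * t ^ 10 + t ^ 12 * ?G t"
      using elim by (simp only:)
    then show ?case unfolding S_def Z_def by algebra
  qed
  ultimately have "(deriv ^^ 4) (\<lambda>t. h (cusp k t)) 0 = 24 * e4" "(deriv ^^ 5) (\<lambda>t. h (cusp k t)) 0 = 120 * e5"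
    by (rule higher_deriv_of_order_4)+
  then have "?p = e4" "?q = e5" using R by simp_all
  with h show ?thesis by (rule that)
qed

lemma order_4_expansion_to_order_12:
  assumes "jet3 F e4 e5 0 (k * e5)" "\<forall>\<^sub>F u in nhds 0. f u = c0 + u ^ 4 * F u"
  obtains e8 e9 e10 e11 g where "smooth_at 0 g"
    "\<forall>\<^sub>F u in nhds 0. f u = c0 + e4 * u ^ 4 + e5 * (u ^ 5 + k * u ^ 7) + e8 * u ^ 8 + e9 * u ^ 9
      + e10 * u ^ 10 + e11 * u ^ 11 + u ^ 12 * g u"
proof -
  obtain q where q: "smooth_at 0 q"
    "\<forall>\<^sub>F t in nhds 0. F t = e4 + e5 * t + 0 * t ^ 2 + k * e5 * t ^ 3 + t ^ 4 * q t"
    by (rule jet3E[OF assms(1)])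
  obtain e8 e9 e10 e11 where "jet3 q e8 e9 e10 e11" by (rule jet3_smooth[OF q(1)])
  then obtain g where g: "smooth_at 0 g"
    "\<forall>\<^sub>F t in nhds 0. q t = e8 + e9 * t + e10 * t ^ 2 + e11 * t ^ 3 + t ^ 4 * g t"
    by (rule jet3E)
  have "\<forall>\<^sub>F u in nhds 0. f u = c0 + e4 * u ^ 4 + e5 * (u ^ 5 + k * u ^ 7) + e8 * u ^ 8 + e9 * u ^ 9
      + e10 * u ^ 10 + e11 * u ^ 11 + u ^ 12 * g u"
    using assms(2) q(2) g(2)
  proof eventually_elim
    case (elim u)
    show ?case unfolding elim by algebra
  qed
  with g(1) show ?thesis by (rule that)
qed

lemma A_equiv_cusp_sufficient:
  assumes \<gamma>: "smooth_at 0 \<gamma>"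
    and d0: "curve_deriv 1 \<gamma> 0 = 0" "curve_deriv 2 \<gamma> 0 = 0" "curve_deriv 3 \<gamma> 0 = 0"
    and A: "det2 (curve_deriv 5 \<gamma> 0) (curve_deriv 4 \<gamma> 0) \<noteq> 0"
    and e: "e = 1 \<or> e = - 1" and pos: "e * cusp_invariant \<gamma> > 0"
  shows "A_equiv_at0 \<gamma> (cusp e)"
proof -
  let ?f = "\<lambda>t. fst (\<gamma> t)" and ?g = "\<lambda>t. snd (\<gamma> t)"
  note c = curve_deriv_components[OF \<gamma>]
  have f: "smooth_at 0 ?f" and g: "smooth_at 0 ?g"
    by (rule smooth_at_fst[OF \<gamma>] smooth_at_snd[OF \<gamma>])+
  have f0: "(deriv ^^ 1) ?f 0 = 0" "(deriv ^^ 2) ?f 0 = 0" "(deriv ^^ 3) ?f 0 = 0"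
    and g0: "(deriv ^^ 1) ?g 0 = 0" "(deriv ^^ 2) ?g 0 = 0" "(deriv ^^ 3) ?g 0 = 0"
    using d0 unfolding c zero_prod_def prod.inject by (simp_all only: simp_thms)
  define x4 x5 x6 x7 where x: "x4 = (deriv ^^ 4) ?f 0 / 24" "x5 = (deriv ^^ 5) ?f 0 / 120"
    "x6 = (deriv ^^ 6) ?f 0 / 720" "x7 = (deriv ^^ 7) ?f 0 / 5040"
  define y4 y5 y6 y7 where y: "y4 = (deriv ^^ 4) ?g 0 / 24" "y5 = (deriv ^^ 5) ?g 0 / 120"
    "y6 = (deriv ^^ 6) ?g 0 / 720" "y7 = (deriv ^^ 7) ?g 0 / 5040"
  have cd: "curve_deriv 4 \<gamma> 0 = (24 * x4, 24 * y4)" "curve_deriv 5 \<gamma> 0 = (120 * x5, 120 * y5)"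
    "curve_deriv 6 \<gamma> 0 = (720 * x6, 720 * y6)" "curve_deriv 7 \<gamma> 0 = (5040 * x7, 5040 * y7)"
    unfolding c x y by simp_all
  define \<Delta> where "\<Delta> = x5 * y4 - y5 * x4"
  have \<Delta>: "\<Delta> \<noteq> 0" using A by (auto simp: cd det2_def \<Delta>_def)
  \<comment> \<open>Cramer's rule: coordinates of the coefficient vectors of orders 6 and 7 in the
    basis formed by those of orders 4 and 5.\<close>
  define \<alpha> \<beta> \<alpha>' \<beta>' where ab: "\<alpha> = (y6 * x5 - x6 * y5) / \<Delta>" "\<beta> = (x6 * y4 - y6 * x4) / \<Delta>"
    "\<alpha>' = (y7 * x5 - x7 * y5) / \<Delta>" "\<beta>' = (x7 * y4 - y7 * x4) / \<Delta>"
  have ab\<Delta>: "y6 * x5 - x6 * y5 = \<alpha> * \<Delta>" "x6 * y4 - y6 * x4 = \<beta> * \<Delta>"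
    "y7 * x5 - x7 * y5 = \<alpha>' * \<Delta>" "x7 * y4 - y7 * x4 = \<beta>' * \<Delta>"
    using \<Delta> by (simp_all add: ab)
  have "\<Delta> * x6 = \<Delta> * (\<alpha> * x4 + \<beta> * x5)" "\<Delta> * y6 = \<Delta> * (\<alpha> * y4 + \<beta> * y5)"
    "\<Delta> * x7 = \<Delta> * (\<alpha>' * x4 + \<beta>' * x5)" "\<Delta> * y7 = \<Delta> * (\<alpha>' * y4 + \<beta>' * y5)"
    using ab\<Delta> \<Delta>_def by algebra+
  then have x6: "x6 = \<alpha> * x4 + \<beta> * x5" and y6: "y6 = \<alpha> * y4 + \<beta> * y5"
    and x7: "x7 = \<alpha>' * x4 + \<beta>' * x5" and y7: "y7 = \<alpha>' * y4 + \<beta>' * y5"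
    using \<Delta> by simp_all
  \<comment> \<open>The coefficient of t^7 along the order 5 vector that is left after the
    reparametrisation with \<open>m2\<close> and \<open>m3\<close> below has removed order
    6.\<close>
  define k where "k = \<beta>' - 5 / 4 * \<alpha> - 11 / 10 * \<beta> ^ 2"
  have "det2 (curve_deriv 5 \<gamma> 0) (curve_deriv 4 \<gamma> 0) = 2880 * \<Delta>"
    "det2 (curve_deriv 6 \<gamma> 0) (curve_deriv 4 \<gamma> 0) = 17280 * (\<beta> * \<Delta>)"
    "det2 (curve_deriv 7 \<gamma> 0) (curve_deriv 4 \<gamma> 0) = 120960 * (\<beta>' * \<Delta>)"
    "det2 (curve_deriv 6 \<gamma> 0) (curve_deriv 5 \<gamma> 0) = - 86400 * (\<alpha> * \<Delta>)"
    unfolding cd det2_def fst_conv snd_conv using ab\<Delta> \<Delta>_def by algebra+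
  then have inv: "cusp_invariant \<gamma> = 20901888000 * \<Delta> ^ 2 * k"
    unfolding cusp_invariant_def Let_def k_def by (simp add: algebra_simps power2_eq_square)
  have ek: "e * k > 0"
  proof -
    have "e * cusp_invariant \<gamma> = (20901888000 * \<Delta> ^ 2) * (e * k)" unfolding inv by simp
    then have "(20901888000 * \<Delta> ^ 2) * (e * k) > 0" using pos by (simp only:)
    moreover have "20901888000 * \<Delta> ^ 2 > 0" using \<Delta> by simp
    ultimately show ?thesis by (simp only: zero_less_mult_pos)
  qed
  \<comment> \<open>Rescaling by \<open>l\<close> multiplies \<open>k\<close> by l^2, which brings
    it to its sign \<open>e\<close>.\<close>
  define l where "l = 1 / sqrt (e * k)"
  have l: "l > 0" using ek by (simp add: l_def)
  have "l ^ 2 = 1 / (e * k)" using ek by (simp add: l_def power_divide)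
  then have lk: "l ^ 2 * k = e" using e ek by (auto simp: field_simps)

  \<comment> \<open>At order 6, \<open>m2\<close> cancels the component along the old order 5 vector
    and \<open>m3\<close> the one along the order 4 vector. The order 5 vector itself changes to 4
    m2 v_4 + v_5, so \<open>m4\<close> must make the order 4 component at t^7 equal to 4 k m2 rather
    than 0.\<close>
  define m2 where "m2 = - \<beta> / 5"
  define m3 where "m3 = - (6 * m2 ^ 2 + \<alpha>) / 4"
  define m4 where "m4 = (4 * k * m2 - 12 * m2 * m3 - 4 * m2 ^ 3 - 6 * m2 * \<alpha> - \<alpha>') / 4"
  have m3: "4 * m3 + 6 * m2 ^ 2 + \<alpha> = 0"
    unfolding m3_def by (simp add: field_simps)
  have m4: "4 * m4 + 12 * m2 * m3 + 4 * m2 ^ 3 + 6 * m2 * \<alpha> + \<alpha>' = 4 * k * m2"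
    unfolding m4_def by (simp add: field_simps)
  have \<beta>: "5 * m2 + \<beta> = 0" by (simp add: m2_def)
  have m': "5 * m3 + 10 * m2 ^ 2 + 6 * m2 * \<beta> + \<beta>' = k"
    unfolding k_def m3_def m2_def by (simp add: field_simps power2_eq_square)
  define s where "s t = l + l ^ 2 * m2 * t + l ^ 3 * m3 * t ^ 2 + l ^ 4 * m4 * t ^ 3" for t
  have js: "jet3 s l (l ^ 2 * m2) (l ^ 3 * m3) (l ^ 4 * m4)"
    unfolding s_def[abs_def] by (rule jet3_poly)
  have ss: "smooth_at 0 s"
    unfolding s_def[abs_def] by (intro smooth_at_intros)

  \<comment> \<open>The relations through \<alpha>, \<beta>, \<alpha>', \<beta>' are common to both
    coordinates, so a single \<open>s\<close> normalises each of them.\<close>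
  have stage: "\<exists>e8 e9 e10 e11 q. smooth_at 0 q \<and> (\<forall>\<^sub>F u in nhds 0. h (u * s u) = h 0 + (c4 * l ^ 4) * u ^ 4
      + ((4 * m2 * c4 + c5) * l ^ 5) * (u ^ 5 + e * u ^ 7) + e8 * u ^ 8 + e9 * u ^ 9
      + e10 * u ^ 10 + e11 * u ^ 11 + u ^ 12 * q u)"
    if hs: "smooth_at 0 h" "(deriv ^^ 1) h 0 = 0" "(deriv ^^ 2) h 0 = 0" "(deriv ^^ 3) h 0 = 0"
      and c4: "c4 = (deriv ^^ 4) h 0 / 24" and c5: "c5 = (deriv ^^ 5) h 0 / 120"
      and c6: "(deriv ^^ 6) h 0 / 720 = \<alpha> * c4 + \<beta> * c5"
      and c7: "(deriv ^^ 7) h 0 / 5040 = \<alpha>' * c4 + \<beta>' * c5" for h :: "real \<Rightarrow> real" and c4 c5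
  proof -
    obtain F where F: "jet3 F c4 c5 (\<alpha> * c4 + \<beta> * c5) (\<alpha>' * c4 + \<beta>' * c5)"
      and Fs: "smooth_at 0 F" and hF: "\<forall>\<^sub>F t in nhds 0. h t = h 0 + t ^ 4 * F t"
      by (rule order_4_expansion[OF hs, folded c4 c5, unfolded c6 c7])
    obtain q where q: "smooth_at 0 q" "\<forall>\<^sub>F t in nhds 0. F t = c4 + c5 * t + (\<alpha> * c4 + \<beta> * c5) * t ^ 2
        + (\<alpha>' * c4 + \<beta>' * c5) * t ^ 3 + t ^ 4 * q t"
      by (rule jet3E[OF F])
    have "\<forall>\<^sub>F u in nhds 0. h u = h 0 + c4 * u ^ 4 + c5 * u ^ 5 + (\<alpha> * c4 + \<beta> * c5) * u ^ 6
        + (\<alpha>' * c4 + \<beta>' * c5) * u ^ 7 + u ^ 8 * q u"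
      using hF q(2)
    proof eventually_elim
      case (elim u)
      have "h u = h 0 + u ^ 4 * (c4 + c5 * u + (\<alpha> * c4 + \<beta> * c5) * u ^ 2
        + (\<alpha>' * c4 + \<beta>' * c5) * u ^ 3 + u ^ 4 * q u)" using elim(1) unfolding elim(2) .
      then show ?case by algebra
    qed
    then obtain G where G: "\<forall>\<^sub>F t in nhds 0. h (t * s t) = h 0 + t ^ 4 * G t"
      and "smooth_at 0 G" and jG: "jet3 G (c4 * l ^ 4) (c4 * (4 * l ^ 3 * (l ^ 2 * m2)) + c5 * l ^ 5)
        (c4 * (4 * l ^ 3 * (l ^ 3 * m3) + 6 * l ^ 2 * (l ^ 2 * m2) ^ 2) + c5 * (5 * l ^ 4 * (l ^ 2 * m2))
          + (\<alpha> * c4 + \<beta> * c5) * l ^ 6)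
        (c4 * (4 * l ^ 3 * (l ^ 4 * m4) + 12 * l ^ 2 * (l ^ 2 * m2) * (l ^ 3 * m3) + 4 * l * (l ^ 2 * m2) ^ 3)
          + c5 * (5 * l ^ 4 * (l ^ 3 * m3) + 10 * l ^ 3 * (l ^ 2 * m2) ^ 2)
          + (\<alpha> * c4 + \<beta> * c5) * (6 * l ^ 5 * (l ^ 2 * m2)) + (\<alpha>' * c4 + \<beta>' * c5) * l ^ 7)"
      by (rule reparametrised_order_4_expansion[OF js ss q(1)])
    have "jet3 G (c4 * l ^ 4) ((4 * m2 * c4 + c5) * l ^ 5) 0 (e * ((4 * m2 * c4 + c5) * l ^ 5))"
    proof (rule jet3_eq[OF jG])
      show "c4 * (4 * l ^ 3 * (l ^ 2 * m2)) + c5 * l ^ 5 = (4 * m2 * c4 + c5) * l ^ 5" by algebra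
      have "c4 * (4 * l ^ 3 * (l ^ 3 * m3) + 6 * l ^ 2 * (l ^ 2 * m2) ^ 2) + c5 * (5 * l ^ 4 * (l ^ 2 * m2))
          + (\<alpha> * c4 + \<beta> * c5) * l ^ 6
          = l ^ 6 * (c4 * (4 * m3 + 6 * m2 ^ 2 + \<alpha>) + c5 * (5 * m2 + \<beta>))" by algebra
      then show "c4 * (4 * l ^ 3 * (l ^ 3 * m3) + 6 * l ^ 2 * (l ^ 2 * m2) ^ 2) + c5 * (5 * l ^ 4 * (l ^ 2 * m2))
          + (\<alpha> * c4 + \<beta> * c5) * l ^ 6 = 0" unfolding m3 \<beta> by simp
      have "c4 * (4 * l ^ 3 * (l ^ 4 * m4) + 12 * l ^ 2 * (l ^ 2 * m2) * (l ^ 3 * m3) + 4 * l * (l ^ 2 * m2) ^ 3)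
          + c5 * (5 * l ^ 4 * (l ^ 3 * m3) + 10 * l ^ 3 * (l ^ 2 * m2) ^ 2)
          + (\<alpha> * c4 + \<beta> * c5) * (6 * l ^ 5 * (l ^ 2 * m2)) + (\<alpha>' * c4 + \<beta>' * c5) * l ^ 7
          = l ^ 7 * (c4 * (4 * m4 + 12 * m2 * m3 + 4 * m2 ^ 3 + 6 * m2 * \<alpha> + \<alpha>')
            + c5 * (5 * m3 + 10 * m2 ^ 2 + 6 * m2 * \<beta> + \<beta>'))" by algebra
      also have "\<dots> = (l ^ 2 * k) * ((4 * m2 * c4 + c5) * l ^ 5)"
        unfolding m4 m' by algebra
      finally show "c4 * (4 * l ^ 3 * (l ^ 4 * m4) + 12 * l ^ 2 * (l ^ 2 * m2) * (l ^ 3 * m3) + 4 * l * (l ^ 2 * m2) ^ 3)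
          + c5 * (5 * l ^ 4 * (l ^ 3 * m3) + 10 * l ^ 3 * (l ^ 2 * m2) ^ 2)
          + (\<alpha> * c4 + \<beta> * c5) * (6 * l ^ 5 * (l ^ 2 * m2)) + (\<alpha>' * c4 + \<beta>' * c5) * l ^ 7
          = e * ((4 * m2 * c4 + c5) * l ^ 5)" unfolding lk .
    qed simp
    then obtain e8 e9 e10 e11 r where "smooth_at 0 r"
      "\<forall>\<^sub>F u in nhds 0. h (u * s u) = h 0 + (c4 * l ^ 4) * u ^ 4
      + ((4 * m2 * c4 + c5) * l ^ 5) * (u ^ 5 + e * u ^ 7) + e8 * u ^ 8 + e9 * u ^ 9
      + e10 * u ^ 10 + e11 * u ^ 11 + u ^ 12 * r u"
      using G by (rule order_4_expansion_to_order_12)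
    then show ?thesis by (intro exI conjI)
  qed

  define X4 X5 Y4 Y5 where XY: "X4 = x4 * l ^ 4" "X5 = (4 * m2 * x4 + x5) * l ^ 5"
    "Y4 = y4 * l ^ 4" "Y5 = (4 * m2 * y4 + y5) * l ^ 5"
  obtain x8 x9 x10 x11 p where p: "smooth_at 0 p" "\<forall>\<^sub>F u in nhds 0. ?f (u * s u) = ?f 0 + X4 * u ^ 4
      + X5 * (u ^ 5 + e * u ^ 7) + x8 * u ^ 8 + x9 * u ^ 9 + x10 * u ^ 10 + x11 * u ^ 11 + u ^ 12 * p u"
    using stage[OF f f0 x(1,2) x6[unfolded x(3)] x7[unfolded x(4)]] unfolding XY by (elim exE conjE)
  obtain y8 y9 y10 y11 q where q: "smooth_at 0 q" "\<forall>\<^sub>F u in nhds 0. ?g (u * s u) = ?g 0 + Y4 * u ^ 4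
      + Y5 * (u ^ 5 + e * u ^ 7) + y8 * u ^ 8 + y9 * u ^ 9 + y10 * u ^ 10 + y11 * u ^ 11 + u ^ 12 * q u"
    using stage[OF g g0 y(1,2) y6[unfolded y(3)] y7[unfolded y(4)]] unfolding XY by (elim exE conjE)
  have "X4 * Y5 - X5 * Y4 = - (l ^ 9 * \<Delta>)"
    unfolding XY \<Delta>_def by algebra
  then have W: "X4 * Y5 - X5 * Y4 \<noteq> 0" using l \<Delta> by simp
  \<comment> \<open>Each coordinate imposes one linear equation on \<open>a\<close> and
    \<open>b\<close> at order 11. The system has determinant a nonzero multiple of \<open>w\<close>,
    and Cramer's rule solves it.\<close>
  define w where "w = X4 * Y5 - X5 * Y4"
  define b where "b = ((e * x9 - x11) * Y5 - (e * y9 - y11) * X5) / (4 * w)"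
  define a where "a = ((e * y9 - y11) * X4 - (e * x9 - x11) * Y4) / (5 * w)"
  have "4 * b * w = (e * x9 - x11) * Y5 - (e * y9 - y11) * X5"
    "5 * a * w = (e * y9 - y11) * X4 - (e * x9 - x11) * Y4"
    using W by (simp_all add: a_def b_def w_def[symmetric])
  then have "w * (4 * b * X4 + 5 * a * X5) = w * (e * x9 - x11)"
    "w * (4 * b * Y4 + 5 * a * Y5) = w * (e * y9 - y11)"
    using w_def by algebra+
  then have eqs: "x11 + 4 * b * X4 + 5 * a * X5 = e * x9" "y11 + 4 * b * Y4 + 5 * a * Y5 = e * y9"
    using W by (simp_all add: w_def[symmetric])
  let ?v = "\<lambda>t. t + a * t ^ 7 + b * t ^ 8"
  obtain h1 :: "real \<times> real \<Rightarrow> real" where h1: "smooth_at 0 h1"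
    "\<forall>\<^sub>F t in nhds 0. ?f (?v t * s (?v t)) = h1 (cusp e t)"
    "frechet_derivative h1 (at 0) (1,0) = X4" "frechet_derivative h1 (at 0) (0,1) = X5"
    by (rule factors_through_cusp_after_reparametrisation[OF p eqs(1)])
  obtain h2 :: "real \<times> real \<Rightarrow> real" where h2: "smooth_at 0 h2"
    "\<forall>\<^sub>F t in nhds 0. ?g (?v t * s (?v t)) = h2 (cusp e t)"
    "frechet_derivative h2 (at 0) (1,0) = Y4" "frechet_derivative h2 (at 0) (0,1) = Y5"
    by (rule factors_through_cusp_after_reparametrisation[OF q eqs(2)])
  have "((\<lambda>z. (h1 z, h2 z)) has_derivative
      (\<lambda>z. (frechet_derivative h1 (at 0) z, frechet_derivative h2 (at 0) z))) (at 0)"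
    by (intro has_derivative_Pair smooth_at_differentiable h1(1) h2(1))
  note fd = frechet_derivative_at[OF this, symmetric]
  show ?thesis
  proof (rule A_equiv_cuspI[where \<phi>="\<lambda>t. ?v t * s (?v t)" and \<Phi>="\<lambda>z. (h1 z, h2 z)" and d=l])
    have v: "smooth_at 0 ?v" by (intro smooth_at_intros)
    show "smooth_at 0 (\<lambda>t. ?v t * s (?v t))"
      by (intro smooth_at_mult v smooth_at_compose[OF v, of s]) (simp add: ss)
    show "?v 0 * s (?v 0) = 0" by simp
    show "((\<lambda>t. ?v t * s (?v t)) has_real_derivative l) (at 0)"
      unfolding s_def by (rule derivative_eq_intros refl | simp)+
    show "l \<noteq> 0" using l by simp
    show "smooth_at 0 (\<lambda>z. (h1 z, h2 z))" by (rule smooth_at_Pair[OF h1(1) h2(1)])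
    show "det2 (frechet_derivative (\<lambda>z. (h1 z, h2 z)) (at 0) (1,0))
        (frechet_derivative (\<lambda>z. (h1 z, h2 z)) (at 0) (0,1)) \<noteq> 0"
      unfolding fd h1(3,4) h2(3,4) det2_def using W by (simp add: mult.commute)
    show "\<forall>\<^sub>F t in nhds 0. \<gamma> (?v t * s (?v t)) = (h1 (cusp e t), h2 (cusp e t))"
      using h1(2) h2(2) by eventually_elim (simp add: prod_eq_iff)
  qed
qed

lemma A_equiv_cusp_iff:
  assumes "smooth_at 0 \<gamma>" "e = 1 \<or> e = - 1"
  shows "A_equiv_at0 \<gamma> (cusp e) \<longleftrightarrow>
    curve_deriv 1 \<gamma> 0 = 0 \<and> curve_deriv 2 \<gamma> 0 = 0 \<and> curve_deriv 3 \<gamma> 0 = 0 \<and>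
    det2 (curve_deriv 5 \<gamma> 0) (curve_deriv 4 \<gamma> 0) \<noteq> 0 \<and> e * cusp_invariant \<gamma> > 0" (is "?L \<longleftrightarrow> ?R")
proof
  assume L: ?L
  obtain q where "q > 0" "cusp_invariant \<gamma> = q * e"
    using A_equiv_cusp_necessary(5)[OF assms(1) L] by (elim exE conjE)
  then have "e * cusp_invariant \<gamma> > 0" using assms(2) by auto
  with A_equiv_cusp_necessary(1-4)[OF assms(1) L] show ?R by (intro conjI)
next
  assume ?R
  then show ?L using A_equiv_cusp_sufficient[OF assms(1) _ _ _ _ assms(2)] by (elim conjE)
qed

theorem mainTheorem15:
  fixes \<gamma> :: "real \<Rightarrow> real \<times> real" and I :: "real set"
  assumes "open I" and "is_interval I" and "0 \<in> I" and "smooth_on I \<gamma>"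
  defines "A \<equiv> det2 (curve_deriv 5 \<gamma> 0) (curve_deriv 4 \<gamma> 0)"
      and "B \<equiv> det2 (curve_deriv 6 \<gamma> 0) (curve_deriv 4 \<gamma> 0)"
      and "C \<equiv> det2 (curve_deriv 7 \<gamma> 0) (curve_deriv 4 \<gamma> 0)"
      and "D \<equiv> det2 (curve_deriv 6 \<gamma> 0) (curve_deriv 5 \<gamma> 0)"
  shows "(A_equiv_at0 \<gamma> cusp_plus \<longleftrightarrow>
            (curve_deriv 1 \<gamma> 0 = 0 \<and> curve_deriv 2 \<gamma> 0 = 0 \<and> curve_deriv 3 \<gamma> 0 = 0 \<and>
             A \<noteq> 0 \<and> - 77 * B ^ 2 + 105 * A * D + 60 * A * C > 0))
       \<and> (A_equiv_at0 \<gamma> cusp_minus \<longleftrightarrow>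
            (curve_deriv 1 \<gamma> 0 = 0 \<and> curve_deriv 2 \<gamma> 0 = 0 \<and> curve_deriv 3 \<gamma> 0 = 0 \<and>
             A \<noteq> 0 \<and> - 77 * B ^ 2 + 105 * A * D + 60 * A * C < 0))
       \<and> \<not> A_equiv_at0 cusp_plus cusp_minus"
proof -
  have \<gamma>: "smooth_at 0 \<gamma>" by (rule smooth_on_imp_at[OF assms(4,3)])
  have plus: "cusp_plus = cusp 1" and minus: "cusp_minus = cusp (- 1)"
    by (simp_all add: fun_eq_iff cusp_plus_def cusp_minus_def cusp_def)
  have inv: "cusp_invariant \<gamma> = - 77 * B ^ 2 + 105 * A * D + 60 * A * C"
    unfolding cusp_invariant_def Let_def A_def B_def C_def D_def by (rule refl)
  \<comment> \<open>An equivalence would make the invariant of \<open>cusp 1\<close> negative,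
    whereas reflexivity makes it positive.\<close>
  have "\<not> A_equiv_at0 (cusp 1) (cusp (- 1))"
  proof
    assume "A_equiv_at0 (cusp 1) (cusp (- 1))"
    then have "- 1 * cusp_invariant (cusp 1) > 0"
      using A_equiv_cusp_iff[OF smooth_at_cusp, of "- 1" 1] by simp
    moreover have "1 * cusp_invariant (cusp 1) > 0"
      using A_equiv_cusp_iff[OF smooth_at_cusp, of 1 1] A_equiv_cusp_refl[of 1] by simp
    ultimately show False by simp
  qed
  then show ?thesis
    unfolding plus minus inv[symmetric]
    using A_equiv_cusp_iff[OF \<gamma>, of 1] A_equiv_cusp_iff[OF \<gamma>, of "- 1"]
    by (simp add: A_def[symmetric])
qed

end
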